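(* For any $\alpha>0$ and $t\in\mathbb{N}$ there exist $\epsilon>0$ and $n_0$ such that the following is true for any $n\ge n_0$. Let $G$ be a bipartite graph with parts $A,B$ of size $n$ each, with a proper linear $t$-fold edge colouring. Assume that for some $d$ the following conditions are satisfied: (i) every vertex of $G$ has degree $(1\pm\epsilon)d$; (ii) every colour has degree at most $(1-\alpha)d$; (iii) any two sets $A'\subset A$ and $B'\subset B$, each of size at least $(1-\alpha)d$, have at least $\alpha n^2$ edges of $G$ between them. Then $G$ has a perfect rainbow matching.
   Context: A $t$-fold edge colouring of a graph $G$ is an assignment of sets (of colours) of size $t$ to the edges of $G$. It is proper if the edges at any given vertex have pairwise disjoint colour sets. It is linear if for every pair of distinct colours there is at most one edge whose colour set contains both. The degree of a colour $c$ is the number of edges whose colour set contains $c$. A subgraph (in particular, a matching) of $G$ is rainbow if all its edges have pairwise disjoint colour sets. A perfect matching is a matching covering all vertices. "$x=(1\pm\epsilon)d$" means $(1-\epsilon)d\le x\le(1+\epsilon)d$. Graphs are finite and simple; $\mathbb{N}$ denotes the positive integers. *)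

theory Defs
  imports Complex_Main "HOL-Library.Disjoint_Sets"
begin

text \<open>A finite simple graph is given by its vertex set \<open>V\<close> and its edge set \<open>E\<close>, the edges being
  two-element subsets of \<open>V\<close>.\<close>

definition simple_graph :: "'v set \<Rightarrow> 'v set set \<Rightarrow> bool" where
  "simple_graph V E \<longleftrightarrow> finite V \<and> (\<forall>e\<in>E. e \<subseteq> V \<and> card e = 2)"

definition bipartite_graph :: "'v set \<Rightarrow> 'v set \<Rightarrow> 'v set set \<Rightarrow> bool" where
  "bipartite_graph A B E \<longleftrightarrow>
     simple_graph (A \<union> B) E \<and> A \<inter> B = {} \<and> (\<forall>e\<in>E. \<exists>a\<in>A. \<exists>b\<in>B. e = {a, b})"

definition incident_edges :: "'v set set \<Rightarrow> 'v \<Rightarrow> 'v set set" where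
  "incident_edges E v = {e \<in> E. v \<in> e}"

definition vertex_degree :: "'v set set \<Rightarrow> 'v \<Rightarrow> nat" where
  "vertex_degree E v = card (incident_edges E v)"

definition edges_between :: "'v set set \<Rightarrow> 'v set \<Rightarrow> 'v set \<Rightarrow> 'v set set" where
  "edges_between E X Y = {e \<in> E. \<exists>x\<in>X. \<exists>y\<in>Y. e = {x, y}}"

text \<open>A colouring is a function on all sets of vertices; only its values on the edges matter.\<close>

definition fold_edge_colouring :: "nat \<Rightarrow> 'v set set \<Rightarrow> ('v set \<Rightarrow> 'c set) \<Rightarrow> bool" where
  "fold_edge_colouring t E \<phi> \<longleftrightarrow> (\<forall>e\<in>E. finite (\<phi> e) \<and> card (\<phi> e) = t)"

definition proper_colouring :: "'v set \<Rightarrow> 'v set set \<Rightarrow> ('v set \<Rightarrow> 'c set) \<Rightarrow> bool" where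
  "proper_colouring V E \<phi> \<longleftrightarrow> (\<forall>v\<in>V. disjoint_family_on \<phi> (incident_edges E v))"

definition linear_colouring :: "'v set set \<Rightarrow> ('v set \<Rightarrow> 'c set) \<Rightarrow> bool" where
  "linear_colouring E \<phi> \<longleftrightarrow> (\<forall>c c'. c \<noteq> c' \<longrightarrow> card {e \<in> E. c \<in> \<phi> e \<and> c' \<in> \<phi> e} \<le> 1)"

definition colour_degree :: "'v set set \<Rightarrow> ('v set \<Rightarrow> 'c set) \<Rightarrow> 'c \<Rightarrow> nat" where
  "colour_degree E \<phi> c = card {e \<in> E. c \<in> \<phi> e}"

definition matching :: "'v set set \<Rightarrow> 'v set set \<Rightarrow> bool" where
  "matching E M \<longleftrightarrow> M \<subseteq> E \<and> disjoint M"

definition perfect_matching :: "'v set \<Rightarrow> 'v set set \<Rightarrow> 'v set set \<Rightarrow> bool" where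
  "perfect_matching V E M \<longleftrightarrow> matching E M \<and> \<Union>M = V"

definition rainbow :: "('v set \<Rightarrow> 'c set) \<Rightarrow> 'v set set \<Rightarrow> bool" where
  "rainbow \<phi> M \<longleftrightarrow> disjoint_family_on \<phi> M"

end

theory Submission
  imports Defs "HOL-Analysis.Convex"
begin

text \<open>
  Condition (iii) forces \<open>d\<close> to be linear in \<open>n\<close>. Reserve a random set \<open>R\<close> of colours, each colour with
  probability \<open>\<alpha> / t\<close>. A second moment computation with 4-cycles shows that, for some choice of \<open>R\<close>, the
  edges all of whose colours lie in \<open>R\<close> are distributed like a random subset of the edges between any two
  large sets, while the edges avoiding \<open>R\<close> form an almost regular graph in which, by (ii), no colour has
  larger degree than the vertices.

  The edges avoiding \<open>R\<close>, each together with its two ends and \<open>t\<close> colours, form a linear \<open>(t + 2)\<close>-uniform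
  hypergraph, and a derandomised nibble finds in it a matching that misses only few vertices: edges are
  selected one at a time, so as to keep a quadratic potential, measuring by how much weighted degrees
  exceed 1, below its average.

  An uncovered pair \<open>a, b\<close> is then absorbed along a path \<open>a b\<^sub>1 a\<^sub>1 b\<^sub>2 a\<^sub>2 b\<^sub>3 a\<^sub>3 b\<^sub>4 a\<^sub>4 b\<close> whose
  edges \<open>a\<^sub>i b\<^sub>i\<close> are in the matching and whose other five edges have fresh colours from \<open>R\<close>. The ends \<open>a\<^sub>2\<close>
  that can be reached in many ways from \<open>a\<close> are at least \<open>(1 - \<alpha>) d\<close> in number, because all the edges at a
  large set of vertices cannot go into fewer than \<open>(1 - \<alpha>) d\<close> vertices; the same holds for \<open>b\<^sub>3\<close> and
  \<open>b\<close>, and (iii) provides the edge \<open>a\<^sub>2 b\<^sub>3\<close> in the middle.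
\<close>

section \<open>Near-perfect fractional matchings in linear hypergraphs\<close>

text \<open>The probability \<open>\<alpha> / t\<close> comes from Bernoulli's inequality: an edge
  avoids \<open>R\<close> with probability
  \<open>q = (1 - \<alpha> / t) ^ t \<ge> 1 - \<alpha>\<close>, so vertex degrees in the remaining
  graph are around \<open>q d\<close>, which is no less than the bound
  \<open>(1 - \<alpha>) d\<close> that colours obey before any edge is removed. The uses of
  \<open>R\<close> need control of different strength. The nibble only asks that the squared
  excesses have a bounded sum, so second moments suffice and single vertices may behave badly;
  absorption has to work at every vertex, so minimum degrees are secured by an exponential moment;
  edge counts have to be right for exponentially many pairs of sets, which a bound on one number,
  the weighted count of 4-cycles, achieves at once. Both \<open>R\<close> and the next edge of the
  nibble come from a single average, all requirements being added up to one functional beforehand. A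
  single absorbing path is not enough, as its new edges may clash in colour; hence an end counts as
  reached only if linearly many routes lead to it, while each clash excludes boundedly many.\<close>

definition wdeg :: "'v set set \<Rightarrow> ('v set \<Rightarrow> real) \<Rightarrow> 'v \<Rightarrow> real" where
  "wdeg H w v = (\<Sum>f\<in>H. if v \<in> f then w f else 0)"

text \<open>Only degrees above 1 are penalised; low degrees show up in the total weight instead. For
  nonnegative \<open>w\<close> on a finite hypergraph with finite edges, value 0 means that
  \<open>w\<close> is a fractional matching.\<close>

definition excess :: "'v set set \<Rightarrow> ('v set \<Rightarrow> real) \<Rightarrow> real" where
  "excess H w = (\<Sum>v\<in>\<Union>H. (max 0 (wdeg H w v - 1))\<^sup>2)"

locale linear_hypergraph =
  fixes H :: "'v set set" and k :: nat
  assumes finite_H: "finite H"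
    and finite_edge: "e \<in> H \<Longrightarrow> finite e"
    and card_edge: "e \<in> H \<Longrightarrow> card e = k"
    and linear: "e \<in> H \<Longrightarrow> f \<in> H \<Longrightarrow> e \<noteq> f \<Longrightarrow> card (e \<inter> f) \<le> 1"
    and k_pos: "k \<ge> 1"
begin

lemma finite_vertices: "finite (\<Union>H)"
  using finite_H finite_edge by blast

lemma sum_edge_wdeg:
  assumes "f \<in> H"
  shows "(\<Sum>u\<in>f. wdeg H w u) = (\<Sum>e\<in>H. w e * real (card (f \<inter> e)))"
proof -
  have "(\<Sum>u\<in>f. wdeg H w u) = (\<Sum>e\<in>H. \<Sum>u\<in>f. if u \<in> e then w e else 0)"
    unfolding wdeg_def by (rule sum.swap)
  also have "\<dots> = (\<Sum>e\<in>H. w e * real (card (f \<inter> e)))"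
  proof (rule sum.cong[OF refl])
    fix e
    have "(\<Sum>u\<in>f. if u \<in> e then w e else 0) = (\<Sum>u\<in>f \<inter> e. w e)"
      by (rule sum.inter_restrict[symmetric]) (rule finite_edge[OF assms])
    then show "(\<Sum>u\<in>f. if u \<in> e then w e else 0) = w e * real (card (f \<inter> e))" by simp
  qed
  finally show ?thesis .
qed

lemma sum_wdeg_mult:
  "(\<Sum>v\<in>\<Union>H. wdeg H w v * x v) = (\<Sum>f\<in>H. w f * (\<Sum>u\<in>f. x u))"
proof -
  have "(\<Sum>v\<in>\<Union>H. wdeg H w v * x v) = (\<Sum>f\<in>H. \<Sum>v\<in>\<Union>H. if v \<in> f then w f * x v else 0)"
    unfolding wdeg_def sum_distrib_right
    by (subst sum.swap) (intro sum.cong refl, simp)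
  also have "\<dots> = (\<Sum>f\<in>H. w f * (\<Sum>u\<in>f. x u))"
  proof (rule sum.cong[OF refl])
    fix f assume "f \<in> H"
    then have "\<Union>H \<inter> f = f" by blast
    then have "(\<Sum>v\<in>\<Union>H. if v \<in> f then w f * x v else 0) = (\<Sum>v\<in>f. w f * x v)"
      using sum.inter_restrict[OF finite_vertices, of "\<lambda>v. w f * x v" f] by simp
    then show "(\<Sum>v\<in>\<Union>H. if v \<in> f then w f * x v else 0) = w f * (\<Sum>u\<in>f. x u)"
      by (simp add: sum_distrib_left)
  qed
  finally show ?thesis .
qed

lemma sum_wdeg: "(\<Sum>v\<in>\<Union>H. wdeg H w v) = real k * sum w H"
  using sum_wdeg_mult[of w "\<lambda>_. 1"] card_edge by (simp add: sum_distrib_left mult.commute)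

text \<open>By linearity an edge \<open>e \<noteq> f\<close> meets \<open>f\<close> in at most one
  vertex, so the degrees along \<open>f\<close> count every edge meeting \<open>f\<close> once,
  except \<open>f\<close> itself, which is counted \<open>k\<close> times; the last term corrects
  this.\<close>

lemma sum_disjoint_edges:
  assumes f: "f \<in> H"
  shows "(\<Sum>e\<in>H. if f \<inter> e = {} then w e else 0)
       = sum w H - (\<Sum>u\<in>f. wdeg H w u) + (real k - 1) * w f"
proof -
  have eq: "(if f \<inter> e = {} then w e else 0)
      = w e - w e * real (card (f \<inter> e)) + (if e = f then (real k - 1) * w f else 0)"
    if e: "e \<in> H" for e
  proof (cases "e = f")
    case True
    then show ?thesis using card_edge[OF f] k_pos by (auto simp: algebra_simps)
  next
    case False
    show ?thesis
    proof (cases "f \<inter> e = {}")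
      case True
      then show ?thesis using False by simp
    next
      case ne: False
      have "card (f \<inter> e) \<noteq> 0" using ne finite_edge[OF f] by simp
      moreover have "card (f \<inter> e) \<le> 1" using linear[OF f e] False by blast
      ultimately have "card (f \<inter> e) = 1" by simp
      then show ?thesis using ne False by simp
    qed
  qed
  have "(\<Sum>e\<in>H. if f \<inter> e = {} then w e else 0)
      = (\<Sum>e\<in>H. w e - w e * real (card (f \<inter> e)) + (if e = f then (real k - 1) * w f else 0))"
    by (rule sum.cong[OF refl]) (rule eq)
  also have "\<dots> = sum w H - (\<Sum>e\<in>H. w e * real (card (f \<inter> e))) + (real k - 1) * w f"
    using finite_H f by (simp add: sum.distrib sum_subtractf)
  finally show ?thesis by (simp add: sum_edge_wdeg[OF f])
qed

text \<open>Two edges through \<open>v\<close> that meet \<open>e\<close> in the same vertex would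
  share two vertices, as \<open>v\<close> is not in \<open>e\<close>. So the vertices of
  \<open>e\<close> count them.\<close>

lemma card_edges_through:
  assumes "e \<in> H" "v \<notin> e"
  shows "card {f \<in> H. v \<in> f \<and> f \<inter> e \<noteq> {}} \<le> k"
proof -
  define F where "F = {f \<in> H. v \<in> f \<and> f \<inter> e \<noteq> {}}"
  define pick where "pick f = (SOME u. u \<in> f \<inter> e)" for f
  have pick: "pick f \<in> f \<inter> e" if "f \<in> F" for f
    unfolding pick_def by (rule someI_ex) (use that in \<open>auto simp: F_def\<close>)
  have "inj_on pick F"
  proof (rule inj_onI, rule ccontr)
    fix f g assume fg: "f \<in> F" "g \<in> F" "pick f = pick g" "f \<noteq> g"
    then have "{v, pick f} \<subseteq> f \<inter> g" using pick[of f] pick[of g] by (auto simp: F_def)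
    moreover have "v \<noteq> pick f" using pick[OF fg(1)] assms by auto
    ultimately have "2 \<le> card (f \<inter> g)"
      using card_mono[of "f \<inter> g" "{v, pick f}"] finite_edge fg by (auto simp: F_def)
    then show False using linear[of f g] fg by (auto simp: F_def)
  qed
  moreover have "pick ` F \<subseteq> e" using pick by blast
  ultimately have "card F \<le> card e" using card_inj_on_le finite_edge[OF assms(1)] by blast
  then show ?thesis using card_edge[OF assms(1)] by (simp add: F_def)
qed

lemma wdeg_nonneg: "(\<And>f. f \<in> H \<Longrightarrow> w f \<ge> 0) \<Longrightarrow> wdeg H w v \<ge> 0"
  unfolding wdeg_def by (rule sum_nonneg) auto

lemma wdeg_mono: "(\<And>f. f \<in> H \<Longrightarrow> w f \<le> w' f) \<Longrightarrow> wdeg H w v \<le> wdeg H w' v"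
  unfolding wdeg_def by (rule sum_mono) auto

end

section \<open>One step of the nibble and its averages\<close>

definition step_error :: "nat \<Rightarrow> real \<Rightarrow> real \<Rightarrow> real" where
  "step_error k L \<omega> = 6 * real k * L\<^sup>2 / \<omega> + 8 * (real k)\<^sup>2 * L ^ 3 / \<omega>\<^sup>2"

text \<open>The next matching edge is chosen with probability proportional to \<open>w\<close>. To first order in \<open>1 / W\<close>, the
  factor \<open>gain f\<close> compensates for the chance that \<open>f\<close> is lost although a given vertex of \<open>f\<close> survives, where
  weighted degrees above 1 are counted as 1. So on average weighted degrees are not pushed above 1, while
  the total weight drops by only about 1.\<close>

locale nibble_step = linear_hypergraph H k for H :: "'v set set" and k +
  fixes w :: "'v set \<Rightarrow> real" and L N \<omega> :: real
  assumes w_nonneg: "f \<in> H \<Longrightarrow> w f \<ge> 0"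
    and w_le: "f \<in> H \<Longrightarrow> w f \<le> L / N"
    and wdeg_le: "wdeg H w v \<le> L"
    and total_le: "sum w H \<le> L * N"
    and total_ge: "sum w H \<ge> \<omega> * N"
    and L: "L \<ge> 1" and om: "0 < \<omega>" "\<omega> \<le> 1" and N: "N > 0"
    and N_large: "\<omega> * N \<ge> 4 * real k * L"
begin

definition "W = sum w H"
text \<open>The inner \<open>- 1\<close> takes out the one vertex of \<open>f\<close> that is
  assumed to survive, with its weighted degree taken to be 1.\<close>

definition "gain f = 1 + ((\<Sum>u\<in>f. min 1 (wdeg H w u)) - 1) / W"
definition "upd e f = (if f \<inter> e = {} then w f * gain f else 0)"

lemma W_ge: "W \<ge> \<omega> * N" "W \<ge> 4 * real k * L" "W \<ge> 1" "W > 0" "W \<le> L * N"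
proof -
  show 1: "W \<ge> \<omega> * N" using total_ge by (simp add: W_def)
  then show 2: "W \<ge> 4 * real k * L" using N_large by simp
  have "1 * 1 \<le> real k * L" using L k_pos by (intro mult_mono) auto
  then show "W \<ge> 1" "W > 0" using 2 by linarith+
  show "W \<le> L * N" using total_le by (simp add: W_def)
qed

lemma deg_nonneg: "wdeg H w v \<ge> 0"
  by (rule wdeg_nonneg) (rule w_nonneg)

lemma capped_bounds:
  assumes "f \<in> H"
  shows "0 \<le> (\<Sum>u\<in>f. min 1 (wdeg H w u))" "(\<Sum>u\<in>f. min 1 (wdeg H w u)) \<le> real k"
    "(\<Sum>u\<in>f. min 1 (wdeg H w u)) \<le> (\<Sum>u\<in>f. wdeg H w u)"
    "(\<Sum>u\<in>f. wdeg H w u) \<le> real k * L"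
proof -
  show "0 \<le> (\<Sum>u\<in>f. min 1 (wdeg H w u))" by (rule sum_nonneg) (simp add: deg_nonneg)
  show "(\<Sum>u\<in>f. min 1 (wdeg H w u)) \<le> real k"
    using sum_mono[of f "\<lambda>u. min 1 (wdeg H w u)" "\<lambda>_. 1"] card_edge[OF assms] by simp
  show "(\<Sum>u\<in>f. min 1 (wdeg H w u)) \<le> (\<Sum>u\<in>f. wdeg H w u)" by (rule sum_mono) simp
  show "(\<Sum>u\<in>f. wdeg H w u) \<le> real k * L"
    using sum_mono[of f "\<lambda>u. wdeg H w u" "\<lambda>_. L"] wdeg_le card_edge[OF assms] by simp
qed

lemma gain_bounds:
  assumes "f \<in> H"
  shows "0 \<le> gain f" "\<bar>gain f - 1\<bar> \<le> real k / W" "gain f \<le> 1 + real k / W" "gain f \<le> 2"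
proof -
  have "\<bar>(\<Sum>u\<in>f. min 1 (wdeg H w u)) - 1\<bar> \<le> real k"
    using capped_bounds[OF assms] k_pos by linarith
  then show 1: "\<bar>gain f - 1\<bar> \<le> real k / W"
    using W_ge by (simp add: gain_def divide_right_mono)
  have "real k * 1 \<le> real k * L" using L by (intro mult_left_mono) auto
  then have "real k \<le> W" using W_ge(2) k_pos by linarith
  then have "real k / W \<le> 1" using W_ge by simp
  with 1 show "0 \<le> gain f" "gain f \<le> 1 + real k / W" "gain f \<le> 2" by linarith+
qed

lemma upd_nonneg: "f \<in> H \<Longrightarrow> 0 \<le> upd e f"
  using gain_bounds w_nonneg by (simp add: upd_def)

lemma upd_le:
  assumes "f \<in> H" shows "upd e f \<le> w f * (1 + real k / W)"
proof -
  have "0 \<le> w f * (1 + real k / W)" using w_nonneg[OF assms] W_ge by simp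
  moreover have "w f * gain f \<le> w f * (1 + real k / W)"
    using gain_bounds[OF assms] w_nonneg[OF assms] by (intro mult_left_mono) auto
  ultimately show ?thesis by (simp add: upd_def)
qed

text \<open>Averages stay unnormalised: a sum with weights \<open>w e\<close> is \<open>W\<close>
  times the expectation when \<open>e\<close> is drawn with probability \<open>w e / W\<close>. The
  edge \<open>f\<close> keeps weight only if \<open>e\<close> is disjoint from it.\<close>

lemma average_upd:
  assumes "f \<in> H"
  shows "(\<Sum>e\<in>H. w e * upd e f)
       = w f * (gain f * (W - (\<Sum>u\<in>f. wdeg H w u) + (real k - 1) * w f))"
proof -
  have "(\<Sum>e\<in>H. w e * upd e f) = (\<Sum>e\<in>H. if f \<inter> e = {} then w e else 0) * (w f * gain f)"
    unfolding sum_distrib_right by (rule sum.cong) (auto simp: upd_def)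
  then show ?thesis by (simp add: sum_disjoint_edges[OF assms] W_def)
qed

text \<open>With \<open>s\<close> the sum of the degrees along \<open>f\<close> and
  \<open>s'\<close> that of the capped degrees,
  \<open>gain f * (W - s) = W - 1 - (s - s') - (s' - 1) * s / W\<close>. Here \<open>s - s'\<close>
  is the excess along \<open>f\<close>, the only first-order loss besides the inevitable 1.\<close>

lemma average_upd_ge:
  assumes f: "f \<in> H"
  shows "(\<Sum>e\<in>H. w e * upd e f)
       \<ge> w f * (W - 1 - (\<Sum>u\<in>f. max 0 (wdeg H w u - 1)) - (real k)\<^sup>2 * L / W)"
proof -
  define s where "s = (\<Sum>u\<in>f. wdeg H w u)"
  define s' where "s' = (\<Sum>u\<in>f. min 1 (wdeg H w u))"
  have s: "0 \<le> s'" "s' \<le> real k" "s' \<le> s" "s \<le> real k * L"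
    using capped_bounds[OF f] by (simp_all add: s_def s'_def)
  have diff: "s - s' = (\<Sum>u\<in>f. max 0 (wdeg H w u - 1))"
    unfolding s_def s'_def sum_subtractf[symmetric] by (rule sum.cong) auto
  have "(s' - 1) * s \<le> real k * (real k * L)"
  proof -
    have "(s' - 1) * s \<le> real k * s" using s by (intro mult_right_mono) auto
    also have "\<dots> \<le> real k * (real k * L)" using s by (intro mult_left_mono) auto
    finally show ?thesis .
  qed
  then have "(s' - 1) * s / W \<le> (real k)\<^sup>2 * L / W"
    using W_ge by (intro divide_right_mono) (auto simp: power2_eq_square algebra_simps)
  moreover have "gain f * (W - s) = W - 1 - (s - s') - (s' - 1) * s / W"
    using W_ge by (simp add: gain_def s'_def field_simps)
  ultimately have "W - 1 - (s - s') - (real k)\<^sup>2 * L / W \<le> gain f * (W - s)" by linarith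
  also have "\<dots> \<le> gain f * (W - s + (real k - 1) * w f)"
    using gain_bounds(1)[OF f] w_nonneg[OF f] k_pos by (intro mult_left_mono) auto
  finally show ?thesis unfolding average_upd[OF f] diff[symmetric] s_def[symmetric]
    using w_nonneg[OF f] by (intro mult_left_mono) auto
qed

lemma average_upd_le:
  assumes f: "f \<in> H"
  shows "(\<Sum>e\<in>H. w e * upd e f) \<le> w f * (W - 1 + 3 * real k * L / (\<omega> * N))"
proof -
  define s where "s = (\<Sum>u\<in>f. wdeg H w u)"
  define s' where "s' = (\<Sum>u\<in>f. min 1 (wdeg H w u))"
  have s: "0 \<le> s'" "s' \<le> real k" "s' \<le> s" "s \<le> real k * L"
    using capped_bounds[OF f] by (simp_all add: s_def s'_def)
  have "gain f * (W - s) = W - 1 - (s - s') + (1 - s') * s / W"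
    using W_ge by (simp add: gain_def s'_def field_simps)
  also have "(1 - s') * s / W \<le> real k * L / W"
  proof (rule divide_right_mono)
    have "(1 - s') * s \<le> 1 * s" using s by (intro mult_right_mono) auto
    then show "(1 - s') * s \<le> real k * L" using s by linarith
  qed (use W_ge in auto)
  also have "real k * L / W \<le> real k * L / (\<omega> * N)"
    using W_ge L om N by (intro divide_left_mono mult_pos_pos) auto
  finally have 1: "gain f * (W - s) \<le> W - 1 + real k * L / (\<omega> * N)" using s by linarith
  have "gain f * ((real k - 1) * w f) \<le> 2 * (real k * (L / N))"
    using gain_bounds[OF f] w_nonneg[OF f] w_le[OF f] k_pos L N
    by (intro mult_mono) auto
  also have "\<dots> \<le> 2 * (real k * L / (\<omega> * N))"
  proof -
    have "real k * L / (1 * N) \<le> real k * L / (\<omega> * N)"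
      using om L N by (intro divide_left_mono mult_right_mono mult_pos_pos) auto
    then show ?thesis by simp
  qed
  finally have "gain f * ((real k - 1) * w f) \<le> 2 * (real k * L / (\<omega> * N))" .
  then have "gain f * (W - s + (real k - 1) * w f) \<le> W - 1 + 3 * real k * L / (\<omega> * N)"
  proof -
    have sum_le: "x + y \<le> V - 1 + 3 * z" if "x \<le> V - 1 + z" "y \<le> 2 * z" for x y z V :: real
      using that by linarith
    have "3 * real k * L / (\<omega> * N) = 3 * (real k * L / (\<omega> * N))" by simp
    then show ?thesis
      using sum_le[OF 1 \<open>gain f * ((real k - 1) * w f) \<le> 2 * (real k * L / (\<omega> * N))\<close>]
      unfolding distrib_left by simp
  qed
  then show ?thesis unfolding average_upd[OF f] s_def[symmetric]
    using w_nonneg[OF f] by (intro mult_left_mono) auto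
qed

text \<open>Double counting turns the losses of \<open>average_upd_ge\<close> into the sum of
  \<open>wdeg H w v * x v\<close> over all vertices, which is linear in the excesses
  \<open>x v\<close>, whereas \<open>excess\<close> is quadratic. The parameter
  \<open>\<eta>\<close> trades one for the other by AM-GM: a loss of \<open>\<eta> * k\<close> per
  step is affordable, and the rest is charged to \<open>excess\<close>.\<close>

lemma average_total:
  assumes \<eta>: "\<eta> > 0"
  shows "(\<Sum>e\<in>H. w e * sum (upd e) H)
       \<ge> W * (W - 1) - \<eta> * real k * W - L / (4 * \<eta>) * excess H w - (real k)\<^sup>2 * L"
proof -
  define x where "x v = max 0 (wdeg H w v - 1)" for v
  have "(\<Sum>f\<in>H. w f * (\<Sum>u\<in>f. x u)) = (\<Sum>v\<in>\<Union>H. wdeg H w v * x v)"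
    by (simp add: sum_wdeg_mult)
  also have "\<dots> \<le> (\<Sum>v\<in>\<Union>H. wdeg H w v * \<eta> + L / (4 * \<eta>) * (x v)\<^sup>2)"
  proof (rule sum_mono)
    fix v
    have "x v \<le> \<eta> + (x v)\<^sup>2 / (4 * \<eta>)"
    proof -
      have "0 \<le> (x v - 2 * \<eta>)\<^sup>2" by simp
      then have "4 * \<eta> * x v \<le> 4 * \<eta> * \<eta> + (x v)\<^sup>2" by (simp add: power2_eq_square algebra_simps)
      then show ?thesis using \<eta> by (simp add: field_simps)
    qed
    then have "wdeg H w v * x v \<le> wdeg H w v * (\<eta> + (x v)\<^sup>2 / (4 * \<eta>))"
      using deg_nonneg by (intro mult_left_mono) auto
    also have "\<dots> = wdeg H w v * \<eta> + wdeg H w v * ((x v)\<^sup>2 / (4 * \<eta>))"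
      by (simp add: algebra_simps)
    also have "wdeg H w v * ((x v)\<^sup>2 / (4 * \<eta>)) \<le> L * ((x v)\<^sup>2 / (4 * \<eta>))"
      using wdeg_le \<eta> by (intro mult_right_mono) auto
    finally show "wdeg H w v * x v \<le> wdeg H w v * \<eta> + L / (4 * \<eta>) * (x v)\<^sup>2" by simp
  qed
  also have "\<dots> = \<eta> * real k * W + L / (4 * \<eta>) * excess H w"
    unfolding sum.distrib sum_distrib_right[symmetric] sum_distrib_left[symmetric] sum_wdeg
      excess_def x_def W_def by simp
  finally have x_sum: "(\<Sum>f\<in>H. w f * (\<Sum>u\<in>f. x u)) \<le> \<eta> * real k * W + L / (4 * \<eta>) * excess H w" .
  have "(\<Sum>e\<in>H. w e * sum (upd e) H) = (\<Sum>f\<in>H. \<Sum>e\<in>H. w e * upd e f)"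
    unfolding sum_distrib_left by (rule sum.swap)
  also have "\<dots> \<ge> (\<Sum>f\<in>H. w f * (W - 1 - (\<Sum>u\<in>f. x u) - (real k)\<^sup>2 * L / W))"
    unfolding x_def by (rule sum_mono) (rule average_upd_ge)
  also have "(\<Sum>f\<in>H. w f * (W - 1 - (\<Sum>u\<in>f. x u) - (real k)\<^sup>2 * L / W))
      = W * (W - 1 - (real k)\<^sup>2 * L / W) - (\<Sum>f\<in>H. w f * (\<Sum>u\<in>f. x u))"
    unfolding W_def[symmetric] by (simp add: algebra_simps sum.distrib sum_subtractf W_def
        flip: sum_distrib_left sum_distrib_right sum_divide_distrib)
  also have "W * (W - 1 - (real k)\<^sup>2 * L / W) = W * (W - 1) - (real k)\<^sup>2 * L"
    using W_ge by (simp add: field_simps)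
  finally show ?thesis using x_sum by linarith
qed

text \<open>Surviving edges at \<open>v\<close> are rescaled by a factor within \<open>k / W\<close>
  of 1, and at most \<open>k\<close> edges at \<open>v\<close> meet \<open>e\<close> and vanish,
  each of weight at most \<open>L / N\<close>.\<close>

lemma wdeg_upd_change:
  assumes e: "e \<in> H" and v: "v \<notin> e"
  shows "\<bar>wdeg H (upd e) v - wdeg H w v\<bar> \<le> 2 * real k * L / (\<omega> * N)"
proof -
  have "\<bar>wdeg H (upd e) v - wdeg H w v\<bar>
      \<le> (\<Sum>f\<in>H. \<bar>(if v \<in> f then upd e f else 0) - (if v \<in> f then w f else 0)\<bar>)"
    unfolding wdeg_def sum_subtractf[symmetric] by (rule sum_abs)
  also have "\<dots> \<le> (\<Sum>f\<in>H. (if v \<in> f then w f else 0) * (real k / W) +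
      (if f \<in> {f \<in> H. v \<in> f \<and> f \<inter> e \<noteq> {}} then L / N else 0))"
  proof (rule sum_mono)
    fix f assume f: "f \<in> H"
    show "\<bar>(if v \<in> f then upd e f else 0) - (if v \<in> f then w f else 0)\<bar>
       \<le> (if v \<in> f then w f else 0) * (real k / W) +
      (if f \<in> {f \<in> H. v \<in> f \<and> f \<inter> e \<noteq> {}} then L / N else 0)"
    proof (cases "v \<in> f \<and> f \<inter> e = {}")
      case True
      have "\<bar>w f * gain f - w f\<bar> = w f * \<bar>gain f - 1\<bar>"
        using w_nonneg[OF f] abs_mult[of "w f" "gain f - 1"] by (simp add: algebra_simps)
      also have "\<dots> \<le> w f * (real k / W)"
        using gain_bounds[OF f] w_nonneg[OF f] by (intro mult_left_mono) auto
      finally show ?thesis using True by (simp add: upd_def)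
    next
      case False
      then show ?thesis using f w_le[OF f] w_nonneg[OF f] W_ge
        by (auto simp: upd_def intro!: add_increasing)
    qed
  qed
  also have "\<dots> = wdeg H w v * (real k / W) +
      real (card {f \<in> H. v \<in> f \<and> f \<inter> e \<noteq> {}}) * (L / N)"
  proof -
    have "H \<inter> {f \<in> H. v \<in> f \<and> f \<inter> e \<noteq> {}} = {f \<in> H. v \<in> f \<and> f \<inter> e \<noteq> {}}" by blast
    then show ?thesis
      using sum.inter_restrict[OF finite_H, of "\<lambda>_. L / N" "{f \<in> H. v \<in> f \<and> f \<inter> e \<noteq> {}}"]
      unfolding sum.distrib sum_distrib_right[symmetric] wdeg_def by simp
  qed
  also have "\<dots> \<le> L * (real k / (\<omega> * N)) + real k * (L / (\<omega> * N))"
  proof (intro add_mono mult_mono)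
    show "real k / W \<le> real k / (\<omega> * N)"
      using W_ge om N by (intro divide_left_mono mult_pos_pos) auto
    have "L / (1 * N) \<le> L / (\<omega> * N)"
      using om L N by (intro divide_left_mono mult_right_mono mult_pos_pos) auto
    then show "L / N \<le> L / (\<omega> * N)" by simp
    show "real (card {f \<in> H. v \<in> f \<and> f \<inter> e \<noteq> {}}) \<le> real k"
      using card_edges_through[OF e v] by simp
  qed (use wdeg_le L W_ge om N in auto)
  also have "\<dots> = 2 * real k * L / (\<omega> * N)" by (simp add: mult.commute mult.left_commute)
  finally show ?thesis .
qed

abbreviation "err \<equiv> step_error k L \<omega>"

text \<open>The square is expanded to second order around the old excess. The error carries the
  factor \<open>wdeg H w v\<close> so that its sum over the vertices is governed by
  \<open>k * W\<close>, however many vertices there are.\<close>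

lemma average_vertex_excess:
  "(\<Sum>e\<in>H. w e * (max 0 (wdeg H (upd e) v - 1))\<^sup>2)
     \<le> (W + 2 * L) * (max 0 (wdeg H w v - 1))\<^sup>2 + wdeg H w v * (err / N)"
proof -
  define x where "x = max 0 (wdeg H w v - 1)"
  define c where "c = 2 * real k * L / (\<omega> * N)"
  define h where "h e = wdeg H (upd e) v - wdeg H w v" for e
  have c: "0 \<le> c" "c \<le> 1/2" using N_large om N L unfolding c_def by (auto simp: field_simps)
  have through: "wdeg H (upd e) v = 0" if "v \<in> e" for e
    unfolding wdeg_def using that by (auto intro!: sum.neutral simp: upd_def)
  have dn: "0 \<le> wdeg H w v" by (rule deg_nonneg)
  have xL: "0 \<le> x" "x \<le> L" using wdeg_le[of v] L by (auto simp: x_def)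
  have pt: "w e * (max 0 (wdeg H (upd e) v - 1))\<^sup>2
      \<le> w e * (x\<^sup>2 + 2 * wdeg H w v * c\<^sup>2) + 2 * x * (if v \<in> e then 0 else w e * h e)"
    if e: "e \<in> H" for e
  proof (cases "v \<in> e")
    case True
    then show ?thesis using through[OF True] w_nonneg[OF e] dn c by simp
  next
    case False
    then have hc: "\<bar>h e\<bar> \<le> c" using wdeg_upd_change[OF e False] by (simp add: h_def c_def)
    have "(max 0 (wdeg H w v + h e - 1))\<^sup>2 \<le> x\<^sup>2 + 2 * x * h e + 2 * wdeg H w v * c\<^sup>2"
    \<comment> \<open>Since \<open>c \<le> 1/2\<close>, a degree below 1/2 has no excess before or
      after the step. From 1/2 on, the second-order error \<open>c\<^sup>2\<close> is at most
      \<open>2 * wdeg H w v * c\<^sup>2\<close>.\<close>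
    proof (cases "wdeg H w v < 1/2")
      case True
      then have "max 0 (wdeg H w v + h e - 1) = 0" "x = 0" using hc c by (auto simp: x_def)
      then show ?thesis using dn by simp
    next
      case False
      have "(max 0 (wdeg H w v + h e - 1))\<^sup>2 \<le> (x + h e)\<^sup>2"
      proof (cases "wdeg H w v + h e - 1 \<le> 0")
        case True then show ?thesis by simp
      next
        case False
        then show ?thesis by (intro power_mono) (auto simp: x_def)
      qed
      also have "\<dots> = x\<^sup>2 + 2 * x * h e + (h e)\<^sup>2" by (simp add: power2_sum)
      also have "(h e)\<^sup>2 \<le> c\<^sup>2" using hc by (metis abs_le_square_iff abs_of_nonneg c(1))
      also have "c\<^sup>2 \<le> 2 * wdeg H w v * c\<^sup>2"
        using False mult_right_mono[of 1 "2 * wdeg H w v" "c\<^sup>2"] by simp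
      finally show ?thesis by simp
    qed
    then have "w e * (max 0 (wdeg H (upd e) v - 1))\<^sup>2
       \<le> w e * (x\<^sup>2 + 2 * x * h e + 2 * wdeg H w v * c\<^sup>2)"
      using w_nonneg[OF e] unfolding h_def by (intro mult_left_mono) auto
    then show ?thesis using False by (simp add: algebra_simps)
  qed
  have "(\<Sum>e\<in>H. w e * (max 0 (wdeg H (upd e) v - 1))\<^sup>2)
      \<le> (\<Sum>e\<in>H. w e * (x\<^sup>2 + 2 * wdeg H w v * c\<^sup>2) + 2 * x * (if v \<in> e then 0 else w e * h e))"
    by (rule sum_mono) (rule pt)
  also have "\<dots> = W * (x\<^sup>2 + 2 * wdeg H w v * c\<^sup>2) + 2 * x * (\<Sum>e\<in>H. if v \<in> e then 0 else w e * h e)"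
    by (simp add: sum.distrib W_def flip: sum_distrib_left sum_distrib_right)
  also have "2 * x * (\<Sum>e\<in>H. if v \<in> e then 0 else w e * h e)
      \<le> 2 * L * x\<^sup>2 + wdeg H w v * (6 * real k * L\<^sup>2 / \<omega> / N)"
  proof (cases "x = 0")
    case True then show ?thesis using dn L om N by simp
  next
    case False
    then have xd: "x = wdeg H w v - 1" by (auto simp: x_def)
    define \<theta> where "\<theta> = 3 * real k * L / (\<omega> * N)"
    have \<theta>: "0 \<le> \<theta>" using om N L by (simp add: \<theta>_def)
    \<comment> \<open>The omitted choices of \<open>e\<close> through \<open>v\<close> have total
      weight \<open>wdeg H w v\<close>. Leaving them out adds the square of this degree, and against
      the \<open>- 1\<close> of \<open>average_upd_le\<close> the factor
      \<open>wdeg H w v - 1 = x\<close> remains.\<close>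
    have "(\<Sum>e\<in>H. if v \<in> e then 0 else w e * h e)
        = (\<Sum>e\<in>H. w e * wdeg H (upd e) v - w e * wdeg H w v + (if v \<in> e then w e else 0) * wdeg H w v)"
      by (rule sum.cong) (auto simp: h_def through algebra_simps)
    also have "\<dots> = (\<Sum>e\<in>H. w e * wdeg H (upd e) v) - W * wdeg H w v + wdeg H w v * wdeg H w v"
      unfolding sum.distrib sum_subtractf sum_distrib_right[symmetric] W_def wdeg_def[of H w] by simp
    also have "(\<Sum>e\<in>H. w e * wdeg H (upd e) v) = (\<Sum>f\<in>H. if v \<in> f then (\<Sum>e\<in>H. w e * upd e f) else 0)"
      unfolding wdeg_def sum_distrib_left by (subst sum.swap) (rule sum.cong, auto)
    also have "\<dots> \<le> (\<Sum>f\<in>H. (if v \<in> f then w f else 0) * (W - 1 + \<theta>))"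
      by (rule sum_mono) (use average_upd_le in \<open>auto simp: \<theta>_def\<close>)
    also have "\<dots> = wdeg H w v * (W - 1 + \<theta>)"
      unfolding sum_distrib_right[symmetric] wdeg_def by simp
    finally have "(\<Sum>e\<in>H. if v \<in> e then 0 else w e * h e) \<le> wdeg H w v * (x + \<theta>)"
      by (simp add: xd algebra_simps)
    then have "2 * x * (\<Sum>e\<in>H. if v \<in> e then 0 else w e * h e) \<le> 2 * x * (wdeg H w v * (x + \<theta>))"
      using xL by (intro mult_left_mono) auto
    also have "\<dots> = 2 * wdeg H w v * x\<^sup>2 + 2 * x * (wdeg H w v * \<theta>)"
      by (simp add: power2_eq_square algebra_simps)
    also have "\<dots> \<le> 2 * L * x\<^sup>2 + 2 * L * (wdeg H w v * \<theta>)"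
      using xL wdeg_le dn \<theta> by (intro add_mono mult_right_mono) auto
    also have "2 * L * (wdeg H w v * \<theta>) = wdeg H w v * (6 * real k * L\<^sup>2 / \<omega> / N)"
      by (simp add: \<theta>_def power2_eq_square)
    finally show ?thesis by simp
  qed
  also have "W * (x\<^sup>2 + 2 * wdeg H w v * c\<^sup>2) + (2 * L * x\<^sup>2 + wdeg H w v * (6 * real k * L\<^sup>2 / \<omega> / N))
     = (W + 2 * L) * x\<^sup>2 + wdeg H w v * (2 * W * c\<^sup>2 + 6 * real k * L\<^sup>2 / \<omega> / N)"
    by (simp add: algebra_simps)
  also have "\<dots> \<le> (W + 2 * L) * x\<^sup>2 + wdeg H w v * (err / N)"
  proof -
    \<comment> \<open>As \<open>W \<le> L * N\<close>, this is of order \<open>1 / N\<close> and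
      yields the second summand of \<open>step_error\<close>; the first one came from
      \<open>\<theta>\<close>.\<close>
    have "2 * W * c\<^sup>2 \<le> 2 * (L * N) * c\<^sup>2" using W_ge by (intro mult_right_mono) auto
    also have "\<dots> = 8 * (real k)\<^sup>2 * L ^ 3 / \<omega>\<^sup>2 / N"
      using N om by (simp add: c_def power2_eq_square power3_eq_cube field_simps)
    finally have "2 * W * c\<^sup>2 + 6 * real k * L\<^sup>2 / \<omega> / N \<le> err / N"
      by (simp add: step_error_def add_divide_distrib)
    then show ?thesis using dn by (intro add_left_mono mult_left_mono)
  qed
  finally show ?thesis by (simp add: x_def)
qed

lemma excess_nonneg: "0 \<le> excess H w"
  unfolding excess_def by (rule sum_nonneg) simp

lemma average_excess:
  "(\<Sum>e\<in>H. w e * excess H (upd e)) \<le> (W + 2 * L) * excess H w + real k * W * (err / N)"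
proof -
  have "(\<Sum>e\<in>H. w e * excess H (upd e)) = (\<Sum>v\<in>\<Union>H. \<Sum>e\<in>H. w e * (max 0 (wdeg H (upd e) v - 1))\<^sup>2)"
    unfolding excess_def sum_distrib_left by (rule sum.swap)
  also have "\<dots> \<le> (\<Sum>v\<in>\<Union>H. (W + 2 * L) * (max 0 (wdeg H w v - 1))\<^sup>2 + wdeg H w v * (err / N))"
    by (rule sum_mono) (rule average_vertex_excess)
  also have "\<dots> = (W + 2 * L) * excess H w + real k * W * (err / N)"
    unfolding excess_def sum.distrib sum_distrib_left[symmetric] sum_distrib_right[symmetric]
      sum_wdeg W_def by simp
  finally show ?thesis .
qed

text \<open>Excess and total weight have to be controlled by the same \<open>e\<close>, so one
  combination of them is averaged. In a step its excess part grows by a factor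
  \<open>1 + c / \<omega> / N\<close>, with \<open>c\<close> as in the proof, which a decreasing
  \<open>lam\<close> can cancel later; the weight drops by 1, by \<open>\<eta> * k\<close> and by an
  error of order \<open>1 / N\<close>.\<close>

lemma good_edge:
  assumes \<eta>: "\<eta> > 0" and lam: "lam \<ge> 1"
  shows "\<exists>e\<in>H. w e > 0 \<and>
    lam * excess H (upd e) - sum (upd e) H
      \<le> lam * (1 + (2 * L + L / (4 * \<eta>)) / \<omega> / N) * excess H w - sum w H
        + 1 + \<eta> * real k + (lam * real k * err + (real k)\<^sup>2 * L / \<omega>) / N"
proof (rule ccontr)
  define c where "c = 2 * L + L / (4 * \<eta>)"
  define rhs where "rhs = lam * (1 + c / \<omega> / N) * excess H w - W
        + 1 + \<eta> * real k + (lam * real k * err + (real k)\<^sup>2 * L / \<omega>) / N"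
  define val where "val e = lam * excess H (upd e) - sum (upd e) H" for e
  assume "\<not> ?thesis"
  then have bad: "\<And>e. e \<in> H \<Longrightarrow> w e > 0 \<Longrightarrow> rhs < val e"
    by (force simp: rhs_def c_def W_def val_def)
  have "\<exists>e\<in>H. w e > 0"
  proof (rule ccontr)
    assume "\<not> ?thesis"
    then have "W \<le> 0" unfolding W_def by (intro sum_nonpos) force
    then show False using W_ge by simp
  qed
  then have "\<exists>e\<in>H. w e * rhs < w e * val e" using bad by (meson mult_strict_left_mono)
  then have "(\<Sum>e\<in>H. w e * rhs) < (\<Sum>e\<in>H. w e * val e)"
  proof (intro sum_strict_mono_ex1 finite_H ballI)
    fix e assume "e \<in> H"
    then show "w e * rhs \<le> w e * val e"
      using bad[of e] w_nonneg[of e] by (cases "w e = 0") auto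
  qed
  also have "(\<Sum>e\<in>H. w e * val e) = lam * (\<Sum>e\<in>H. w e * excess H (upd e)) - (\<Sum>e\<in>H. w e * sum (upd e) H)"
    by (simp add: val_def algebra_simps sum_subtractf sum_distrib_left)
  also have "\<dots> \<le> lam * ((W + 2 * L) * excess H w + real k * W * (err / N))
      - (W * (W - 1) - \<eta> * real k * W - L / (4 * \<eta>) * excess H w - (real k)\<^sup>2 * L)"
    using average_excess average_total[OF \<eta>] lam by (intro diff_mono mult_left_mono) auto
  \<comment> \<open>Terms without a factor \<open>W\<close> receive one at the price of
    \<open>1 / (\<omega> * N)\<close>, by \<open>W \<ge> \<omega> * N\<close>. The excess term that
    stems from the total weight is absorbed because \<open>lam \<ge> 1\<close>.\<close>
  also have "\<dots> \<le> W * rhs"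
  proof -
    have ex: "0 \<le> excess H w" by (rule excess_nonneg)
    have Wn: "1 \<le> W / (\<omega> * N)" using W_ge om N by (simp add: field_simps)
    have "L / (4 * \<eta>) * excess H w \<le> lam * (L / (4 * \<eta>) * excess H w)"
      using lam ex L \<eta> mult_right_mono[of 1 lam "L / (4 * \<eta>) * excess H w"] by simp
    then have "lam * (2 * L * excess H w) + L / (4 * \<eta>) * excess H w \<le> lam * c * excess H w"
      by (simp add: c_def algebra_simps)
    also have "\<dots> \<le> (lam * c * excess H w) * (W / (\<omega> * N))"
      using Wn lam ex L \<eta> mult_left_mono[OF Wn, of "lam * c * excess H w"] by (simp add: c_def)
    finally have 1: "lam * (2 * L * excess H w) + L / (4 * \<eta>) * excess H w
        \<le> (lam * c * excess H w) * (W / (\<omega> * N))" .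
    have 2: "(real k)\<^sup>2 * L \<le> (real k)\<^sup>2 * L * (W / (\<omega> * N))"
      using mult_left_mono[OF Wn, of "(real k)\<^sup>2 * L"] L by simp
    have "W * rhs = lam * W * excess H w + (lam * c * excess H w) * (W / (\<omega> * N))
        - W * W + W + \<eta> * real k * W + lam * real k * W * (err / N) + (real k)\<^sup>2 * L * (W / (\<omega> * N))"
      unfolding rhs_def using om N by (simp add: field_simps)
    then show ?thesis using 1 2 by (simp add: algebra_simps)
  qed
  also have "W * rhs = (\<Sum>e\<in>H. w e * rhs)" by (simp add: W_def sum_distrib_right)
  finally show False by simp
qed

end

text \<open>There are at most \<open>K * N\<close> steps, so factors \<open>1 + x / N\<close>, one
  per step, multiply to at most \<open>exp (x * K)\<close>. With \<open>x = k / \<omega>\<close>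
  this explains \<open>L\<close>, with \<open>x = c\<close> it explains \<open>\<Lambda>\<close>.
  The exponent \<open>J - i\<close> drops by one in each step, which cancels the growth of the
  excess in \<open>good_edge\<close>. Beyond 1, a step costs \<open>\<tau>\<close>. The process
  stops while \<open>2 * \<omega> * N\<close> of the weight should be left, and \<open>slack\<close>
  says that all errors together use at most half of it.\<close>

lemma (in linear_hypergraph) nibble_process:
  fixes w0 :: "'v set \<Rightarrow> real" and K N \<omega> \<eta> :: real and J :: nat
  defines "L \<equiv> K * exp (real k * K / \<omega>)"
  defines "c \<equiv> (2 * L + L / (4 * \<eta>)) / \<omega>"
  defines "\<Lambda> \<equiv> exp (c * K)"
  defines "\<tau> \<equiv> \<eta> * real k + (\<Lambda> * real k * step_error k L \<omega> + (real k)\<^sup>2 * L / \<omega>) / N"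
  assumes K: "K \<ge> 1" and om: "0 < \<omega>" "\<omega> \<le> 1" and \<eta>: "\<eta> > 0" and N: "N > 0"
    and N_large: "\<omega> * N \<ge> 4 * real k * L" and slack: "\<Lambda> * K + K * N * \<tau> \<le> \<omega> * N"
    and w0: "\<And>f. f \<in> H \<Longrightarrow> 0 \<le> w0 f" "\<And>f. f \<in> H \<Longrightarrow> w0 f \<le> K / N"
    and deg0: "\<And>v. wdeg H w0 v \<le> K"
    and excess0: "excess H w0 \<le> K"
    and total0: "sum w0 H \<le> K * N"
    and J: "real J \<le> sum w0 H - 2 * \<omega> * N"
  shows "i \<le> J \<Longrightarrow> \<exists>M w. M \<subseteq> H \<and> disjoint M \<and> card M = i \<and>
    (\<forall>f\<in>H. 0 \<le> w f \<and> w f \<le> w0 f * (1 + real k / (\<omega> * N)) ^ i) \<and>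
    (\<forall>f\<in>H. w f \<noteq> 0 \<longrightarrow> f \<inter> \<Union>M = {}) \<and>
    (1 + c / N) ^ (J - i) * excess H w - sum w H \<le> \<Lambda> * K - sum w0 H + real i * (1 + \<tau>)"
proof (induction i)
  have L: "L \<ge> 1" "L > 0"
  proof -
    have "1 * 1 \<le> K * exp (real k * K / \<omega>)" using K om by (intro mult_mono) auto
    then show "L \<ge> 1" "L > 0" by (simp_all add: L_def)
  qed
  have c: "c \<ge> 0" using L \<eta> om by (simp add: c_def)
  have JK: "real J \<le> K * N"
  proof -
    have "0 \<le> 2 * \<omega> * N" using om N by simp
    then show ?thesis using J total0 by linarith
  qed
  have pow_exp: "(1 + x / N) ^ i \<le> exp (x * K)" if "x \<ge> 0" "i \<le> J" for x i
  proof -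
    have "(1 + x / N) ^ i \<le> exp (x / N) ^ i"
      using that N by (intro power_mono) auto
    also have "\<dots> = exp (real i * (x / N))" by (rule exp_of_nat_mult[symmetric])
    also have "\<dots> \<le> exp (x * K)"
    proof -
      have "real i * x \<le> K * N * x" using that JK by (intro mult_right_mono) auto
      then show ?thesis using N by (simp add: field_simps)
    qed
    finally show ?thesis .
  qed
  have growth: "(1 + real k / (\<omega> * N)) ^ i \<le> exp (real k * K / \<omega>)" if "i \<le> J" for i
    using pow_exp[of "real k / \<omega>" i] that om by simp
  have lam: "1 \<le> (1 + c / N) ^ i" "i \<le> J \<Longrightarrow> (1 + c / N) ^ i \<le> \<Lambda>" for i
    using c N pow_exp[of c i] by (auto simp: \<Lambda>_def intro: one_le_power)
  {
    case 0
    have "0 \<le> excess H w0" by (simp add: excess_def sum_nonneg)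
    then have "(1 + c / N) ^ J * excess H w0 \<le> \<Lambda> * K"
      using lam excess0 by (intro mult_mono) (auto simp: \<Lambda>_def)
    then show ?case using w0 by (intro exI[of _ "{}"] exI[of _ w0]) auto
  next
    case (Suc i)
    obtain M w where st: "M \<subseteq> H \<and> disjoint M \<and> card M = i \<and>
      (\<forall>f\<in>H. 0 \<le> w f \<and> w f \<le> w0 f * (1 + real k / (\<omega> * N)) ^ i) \<and>
      (\<forall>f\<in>H. w f \<noteq> 0 \<longrightarrow> f \<inter> \<Union>M = {}) \<and>
      (1 + c / N) ^ (J - i) * excess H w - sum w H \<le> \<Lambda> * K - sum w0 H + real i * (1 + \<tau>)"
      using Suc.IH[OF Suc_leD[OF Suc.prems]] by blast
    then have M: "M \<subseteq> H" "disjoint M" "card M = i"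
      and w: "\<And>f. f \<in> H \<Longrightarrow> 0 \<le> w f" "\<And>f. f \<in> H \<Longrightarrow> w f \<le> w0 f * (1 + real k / (\<omega> * N)) ^ i"
      and supp: "\<And>f. f \<in> H \<Longrightarrow> w f \<noteq> 0 \<Longrightarrow> f \<inter> \<Union>M = {}"
      and pot: "(1 + c / N) ^ (J - i) * excess H w - sum w H
        \<le> \<Lambda> * K - sum w0 H + real i * (1 + \<tau>)"
      by blast+
    define G where "G = exp (real k * K / \<omega>)"
    have wG: "w f \<le> w0 f * G" if "f \<in> H" for f
    proof -
      have "w0 f * (1 + real k / (\<omega> * N)) ^ i \<le> w0 f * G"
        using growth[of i] Suc.prems w0(1)[OF that] unfolding G_def by (intro mult_left_mono) auto
      then show ?thesis using w(2)[OF that] by linarith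
    qed
    have \<tau>0: "0 \<le> \<tau>"
      using \<eta> L om N unfolding \<tau>_def step_error_def \<Lambda>_def by (intro add_nonneg_nonneg divide_nonneg_pos) auto
    have iJ: "real i \<le> K * N" using Suc.prems JK by simp
    \<comment> \<open>Dropping the nonnegative excess part from the invariant leaves a lower bound
      for the weight.\<close>
    have Wge: "\<omega> * N \<le> sum w H"
    proof -
      have "0 \<le> (1 + c / N) ^ (J - i) * excess H w"
        using lam(1)[of "J - i"] by (simp add: excess_def sum_nonneg)
      then have "sum w0 H - real i - (\<Lambda> * K + real i * \<tau>) \<le> sum w H"
        using pot by (simp add: algebra_simps)
      moreover have "real i * \<tau> \<le> K * N * \<tau>" using iJ \<tau>0 by (intro mult_right_mono)
      moreover have "real i \<le> sum w0 H - 2 * \<omega> * N" using J Suc.prems by linarith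
      ultimately show ?thesis using slack by linarith
    qed
    interpret nibble_step H k w L N \<omega>
    proof unfold_locales
      fix f assume f: "f \<in> H"
      show "0 \<le> w f" by (rule w(1)[OF f])
      have "w0 f * G \<le> K / N * G" using w0(2)[OF f] by (intro mult_right_mono) (auto simp: G_def)
      then show "w f \<le> L / N" using wG[OF f] by (simp add: L_def G_def)
    next
      fix v
      have "wdeg H w v \<le> wdeg H (\<lambda>f. w0 f * G) v" by (rule wdeg_mono) (rule wG)
      also have "\<dots> = wdeg H w0 v * G"
        unfolding wdeg_def sum_distrib_right by (rule sum.cong) auto
      also have "\<dots> \<le> K * G" using deg0 by (intro mult_right_mono) (auto simp: G_def)
      finally show "wdeg H w v \<le> L" by (simp add: L_def G_def)
    next
      have "sum w H \<le> sum w0 H * G" unfolding sum_distrib_right by (rule sum_mono) (rule wG)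
      also have "\<dots> \<le> K * N * G" using total0 by (intro mult_right_mono) (auto simp: G_def)
      finally show "sum w H \<le> L * N" by (simp add: L_def G_def mult.commute mult.left_commute)
    qed (use Wge L om N N_large in auto)
    define lam' where "lam' = (1 + c / N) ^ (J - Suc i)"
    have lam': "1 \<le> lam'" "lam' \<le> \<Lambda>" using lam by (auto simp: lam'_def)
    obtain e where e: "e \<in> H" "w e > 0" and good:
      "lam' * excess H (upd e) - sum (upd e) H \<le> lam' * (1 + c / N) * excess H w - sum w H
        + 1 + \<eta> * real k + (lam' * real k * err + (real k)\<^sup>2 * L / \<omega>) / N"
      using good_edge[OF \<eta> lam'(1)] by (auto simp: c_def)
    have eM: "e \<inter> \<Union>M = {}" using supp e by auto
    have "e \<noteq> {}" using card_edge[OF e(1)] k_pos by auto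
    then have "e \<notin> M" using eM by auto
    have finM: "finite M" using M(1) finite_H finite_subset by blast
    show ?case
    proof (intro exI[of _ "insert e M"] exI[of _ "upd e"] conjI ballI impI)
      show "insert e M \<subseteq> H" using M e by simp
      show "disjoint (insert e M)"
        using M(2) eM by (auto simp: pairwise_insert disjnt_def)
      show "card (insert e M) = Suc i" using \<open>e \<notin> M\<close> finM M by simp
      fix f assume f: "f \<in> H"
      show "0 \<le> upd e f" by (rule upd_nonneg[OF f])
      have "upd e f \<le> w f * (1 + real k / W)" by (rule upd_le[OF f])
      also have "\<dots> \<le> w0 f * (1 + real k / (\<omega> * N)) ^ i * (1 + real k / (\<omega> * N))"
      proof (intro mult_mono w(2) f add_left_mono divide_left_mono)
        show "0 \<le> w0 f * (1 + real k / (\<omega> * N)) ^ i" using w0(1)[OF f] om N by simp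
      qed (use W_ge om N in auto)
      finally show "upd e f \<le> w0 f * (1 + real k / (\<omega> * N)) ^ Suc i" by (simp add: mult_ac)
      assume "upd e f \<noteq> 0"
      then have "f \<inter> e = {}" "w f \<noteq> 0" by (auto simp: upd_def split: if_splits)
      then show "f \<inter> \<Union>(insert e M) = {}" using supp[OF f] by auto
    next
      have "J - i = Suc (J - Suc i)" using Suc.prems by simp
      then have "lam' * (1 + c / N) = (1 + c / N) ^ (J - i)" by (simp add: lam'_def mult.commute)
      moreover have "(lam' * real k * err + (real k)\<^sup>2 * L / \<omega>) / N
          \<le> (\<Lambda> * real k * err + (real k)\<^sup>2 * L / \<omega>) / N"
        using lam' N L om
        by (intro divide_right_mono add_right_mono mult_right_mono) (auto simp: step_error_def)
      ultimately have "lam' * excess H (upd e) - sum (upd e) H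
          \<le> (1 + c / N) ^ (J - i) * excess H w - sum w H + 1 + \<tau>"
      proof -
        have le: "x \<le> y + 1 + (z + b)" if "x \<le> y + 1 + z + a" "a \<le> b" for x y z a b :: real
          using that by linarith
        assume "lam' * (1 + c / N) = (1 + c / N) ^ (J - i)"
          "(lam' * real k * err + (real k)\<^sup>2 * L / \<omega>) / N
            \<le> (\<Lambda> * real k * err + (real k)\<^sup>2 * L / \<omega>) / N"
        then show ?thesis using good unfolding \<tau>_def by (intro le) simp_all
      qed
      then show "(1 + c / N) ^ (J - Suc i) * excess H (upd e) - sum (upd e) H
          \<le> \<Lambda> * K - sum w0 H + real (Suc i) * (1 + \<tau>)"
        using pot unfolding lam'_def by (simp add: algebra_simps)
    qed
  }
qed

text \<open>The weights may violate the vertex constraints of a fractional matching, as long as the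
  squared violations add up to at most a constant \<open>K\<close>, independently of
  \<open>N\<close>. Second moment bounds deliver exactly this.\<close>

lemma near_fractional_matching:
  fixes \<delta> K :: real and k :: nat
  assumes \<delta>: "\<delta> > 0" and K: "K \<ge> 1" and k: "k \<ge> 1"
  shows "\<exists>N0. \<forall>N\<ge>N0. \<forall>(H :: 'v set set) w. linear_hypergraph H k \<and>
    (\<forall>f\<in>H. 0 \<le> w f \<and> w f \<le> K / N) \<and> (\<forall>v. wdeg H w v \<le> K) \<and> excess H w \<le> K \<and> sum w H \<le> K * N
    \<longrightarrow> (\<exists>M\<subseteq>H. disjoint M \<and> real (card M) \<ge> sum w H - \<delta> * N)"
proof -
  \<comment> \<open>The budget \<open>\<delta> * N\<close> has to cover the weight
    \<open>2 * \<omega> * N\<close> left by the process and the rounding of \<open>J\<close>; each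
    gets at most, respectively at least, \<open>\<delta> / 2 * N\<close>, and
    \<open>N \<ge> 2 / \<delta>\<close> makes the latter at least 1.\<close>
  define \<omega> where "\<omega> = min 1 (\<delta> / 4)"
  \<comment> \<open>Over \<open>K * N\<close> steps the losses \<open>\<eta> * k\<close> add up to
    \<open>\<omega> * N / 2\<close>. The last entry of \<open>N0\<close> reserves the other half of
    the slack for the errors that do not grow with \<open>N\<close>.\<close>
  define \<eta> where "\<eta> = \<omega> / (2 * real k * K)"
  define L where "L = K * exp (real k * K / \<omega>)"
  define c where "c = (2 * L + L / (4 * \<eta>)) / \<omega>"
  define \<Lambda> where "\<Lambda> = exp (c * K)"
  define D where "D = \<Lambda> * real k * step_error k L \<omega> + (real k)\<^sup>2 * L / \<omega>"
  define N0 where "N0 = Max {1, 2 / \<delta>, 4 * real k * L / \<omega>, 2 * (\<Lambda> * K + K * D) / \<omega>}"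
  have om: "0 < \<omega>" "\<omega> \<le> 1" "4 * \<omega> \<le> \<delta>" using \<delta> by (auto simp: \<omega>_def)
  have \<eta>: "0 < \<eta>" using om k K by (simp add: \<eta>_def)
  show ?thesis
  proof (intro exI[of _ N0] allI impI)
    fix N :: real and H :: "'v set set" and w
    assume "N \<ge> N0"
    then have N: "N \<ge> 1" "N \<ge> 2 / \<delta>" "N \<ge> 4 * real k * L / \<omega>" "N \<ge> 2 * (\<Lambda> * K + K * D) / \<omega>"
      by (simp_all add: N0_def)
    assume hyp: "linear_hypergraph H k \<and>
      (\<forall>f\<in>H. 0 \<le> w f \<and> w f \<le> K / N) \<and> (\<forall>v. wdeg H w v \<le> K) \<and> excess H w \<le> K \<and> sum w H \<le> K * N"
    then have H: "linear_hypergraph H k" and w: "\<And>f. f \<in> H \<Longrightarrow> 0 \<le> w f"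
      "\<And>f. f \<in> H \<Longrightarrow> w f \<le> K / N" "\<And>v. wdeg H w v \<le> K" "excess H w \<le> K" "sum w H \<le> K * N"
      by blast+
    show "\<exists>M\<subseteq>H. disjoint M \<and> real (card M) \<ge> sum w H - \<delta> * N"
    proof (cases "sum w H - \<delta> * N \<le> 0")
      case True
      then show ?thesis by (intro exI[of _ "{}"]) auto
    next
      case False
      define J where "J = nat \<lceil>sum w H - \<delta> * N\<rceil>"
      have J: "real J \<ge> sum w H - \<delta> * N" "real J < sum w H - \<delta> * N + 1"
        using False unfolding J_def by linarith+
      have "1 \<le> (\<delta> / 2) * N" using N(2) \<delta> by (simp add: field_simps)
      also have "\<dots> \<le> (\<delta> - 2 * \<omega>) * N" using om N(1) by (intro mult_right_mono) auto
      finally have J2: "real J \<le> sum w H - 2 * \<omega> * N" using J by (simp add: algebra_simps)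
      have "4 * real k * L \<le> \<omega> * N" using N(3) om by (simp add: field_simps)
      moreover have "\<Lambda> * K + K * N * (\<eta> * real k + D / N) \<le> \<omega> * N"
      proof -
        have eq: "K * N * (\<eta> * real k + D / N) = \<omega> * N / 2 + K * D"
          using N(1) K k by (simp add: \<eta>_def field_simps)
        have "\<Lambda> * K + K * D \<le> \<omega> * N / 2" using N(4) om by (simp add: field_simps)
        then show ?thesis unfolding eq by linarith
      qed
      ultimately have "\<exists>M\<subseteq>H. disjoint M \<and> card M = J"
        using linear_hypergraph.nibble_process[OF H K om(1,2) \<eta> _ _ _ w J2 order_refl] N(1)
        unfolding L_def[symmetric] c_def[symmetric] \<Lambda>_def[symmetric] D_def[symmetric] by auto
      then show ?thesis using J(1) by auto
    qed
  qed
qed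

section \<open>Random subsets of a finite set\<close>

text \<open>The expectation of \<open>F R\<close> when each element of \<open>C\<close> enters
  \<open>R\<close> independently with probability \<open>\<gamma>\<close>, as a finite sum.\<close>

definition subset_mean :: "real \<Rightarrow> 'c set \<Rightarrow> ('c set \<Rightarrow> real) \<Rightarrow> real" where
  "subset_mean \<gamma> C F = (\<Sum>R\<in>Pow C. \<gamma> ^ card R * (1 - \<gamma>) ^ card (C - R) * F R)"

text \<open>Plays the part of measurability with respect to the coordinates in \<open>X\<close>;
  functions determined on disjoint sets of coordinates are independent.\<close>

definition determined_on :: "'c set \<Rightarrow> 'c set \<Rightarrow> ('c set \<Rightarrow> real) \<Rightarrow> bool" where
  "determined_on C X F \<longleftrightarrow> (\<forall>R\<subseteq>C. F R = F (R \<inter> X))"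

lemma subset_mean_cong: "(\<And>R. R \<subseteq> C \<Longrightarrow> F R = G R) \<Longrightarrow> subset_mean \<gamma> C F = subset_mean \<gamma> C G"
  unfolding subset_mean_def by (rule sum.cong) auto

lemma subset_mean_cmult: "subset_mean \<gamma> C (\<lambda>R. x * F R) = x * subset_mean \<gamma> C F"
  unfolding subset_mean_def sum_distrib_left by (rule sum.cong) auto

lemma subset_mean_add: "subset_mean \<gamma> C (\<lambda>R. F R + G R) = subset_mean \<gamma> C F + subset_mean \<gamma> C G"
  unfolding subset_mean_def by (simp add: distrib_left sum.distrib)

lemma subset_mean_sum: "subset_mean \<gamma> C (\<lambda>R. \<Sum>i\<in>I. F i R) = (\<Sum>i\<in>I. subset_mean \<gamma> C (F i))"
  unfolding subset_mean_def sum_distrib_left by (rule sum.swap)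

lemma determined_on_mult:
  "determined_on C X F \<Longrightarrow> determined_on C X G \<Longrightarrow> determined_on C X (\<lambda>R. F R * G R)"
  by (simp add: determined_on_def)

lemma determined_on_const: "determined_on C X (\<lambda>_. x)"
  by (simp add: determined_on_def)

lemma determined_on_mono:
  assumes "determined_on C X F" "X \<subseteq> Y" shows "determined_on C Y F"
  unfolding determined_on_def
proof (intro allI impI)
  fix R assume "R \<subseteq> C"
  then have "F R = F (R \<inter> X)" "F (R \<inter> Y) = F (R \<inter> Y \<inter> X)"
    using assms(1)[unfolded determined_on_def, rule_format] by (blast, metis le_infI1)
  moreover have "R \<inter> Y \<inter> X = R \<inter> X" using assms(2) by blast
  ultimately show "F R = F (R \<inter> Y)" by simp
qed

locale random_subset =
  fixes C :: "'c set" and \<gamma> :: real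
  assumes finite_C: "finite C" and \<gamma>: "0 < \<gamma>" "\<gamma> < 1"
begin

abbreviation "\<E> \<equiv> subset_mean \<gamma> C"

lemma subset_mean_mono:
  assumes "\<And>R. R \<subseteq> C \<Longrightarrow> F R \<le> G R" shows "\<E> F \<le> \<E> G"
  unfolding subset_mean_def
proof (rule sum_mono)
  fix R assume "R \<in> Pow C"
  then show "\<gamma> ^ card R * (1 - \<gamma>) ^ card (C - R) * F R \<le> \<gamma> ^ card R * (1 - \<gamma>) ^ card (C - R) * G R"
    using assms \<gamma> by (intro mult_left_mono) auto
qed

text \<open>A random subset of \<open>C\<close> amounts to independent random subsets of
  \<open>X\<close> and of \<open>C - X\<close>, since the weight of \<open>R1 \<union> R2\<close> is
  the product of their weights.\<close>

lemma subset_mean_split: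
  assumes X: "X \<subseteq> C" and F: "determined_on C X F" and G: "determined_on C (C - X) G"
  shows "\<E> (\<lambda>R. F R * G R) = subset_mean \<gamma> X F * subset_mean \<gamma> (C - X) G"
proof -
  let ?Y = "C - X"
  have "subset_mean \<gamma> X F * subset_mean \<gamma> ?Y G
      = (\<Sum>(R1, R2)\<in>Pow X \<times> Pow ?Y. (\<gamma> ^ card R1 * (1 - \<gamma>) ^ card (X - R1) * F R1) *
          (\<gamma> ^ card R2 * (1 - \<gamma>) ^ card (?Y - R2) * G R2))"
    unfolding subset_mean_def sum_product sum.cartesian_product ..
  also have "\<dots> = (\<Sum>R\<in>Pow C. \<gamma> ^ card R * (1 - \<gamma>) ^ card (C - R) * (F R * G R))"
  proof (rule sum.reindex_bij_witness[of _ "\<lambda>R. (R \<inter> X, R \<inter> ?Y)" "\<lambda>(R1, R2). R1 \<union> R2"])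
    fix P assume P: "P \<in> Pow X \<times> Pow ?Y"
    obtain R1 R2 where R: "P = (R1, R2)" "R1 \<subseteq> X" "R2 \<subseteq> ?Y" using P by auto
    have fin: "finite X" "finite ?Y" "finite R1" "finite R2"
      using finite_C X finite_subset[of X C] finite_subset[of R1 X] finite_subset[of R2 ?Y] R by auto
    have "card (R1 \<union> R2) = card R1 + card R2" using R fin by (intro card_Un_disjoint) auto
    moreover have "card (C - (R1 \<union> R2)) = card (X - R1) + card (?Y - R2)"
    proof -
      have "C - (R1 \<union> R2) = (X - R1) \<union> (?Y - R2)" using R X by blast
      then show ?thesis using fin by (simp add: card_Un_disjoint disjoint_iff)
    qed
    moreover have "F (R1 \<union> R2) = F R1"
    proof -
      have "R1 \<union> R2 \<subseteq> C" "(R1 \<union> R2) \<inter> X = R1" using R X by auto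
      then show ?thesis using F[unfolded determined_on_def, rule_format, of "R1 \<union> R2"] by simp
    qed
    moreover have "G (R1 \<union> R2) = G R2"
    proof -
      have "R1 \<union> R2 \<subseteq> C" "(R1 \<union> R2) \<inter> ?Y = R2" using R X by auto
      then show ?thesis using G[unfolded determined_on_def, rule_format, of "R1 \<union> R2"] by simp
    qed
    ultimately show "\<gamma> ^ card (case P of (R1, R2) \<Rightarrow> R1 \<union> R2) *
        (1 - \<gamma>) ^ card (C - (case P of (R1, R2) \<Rightarrow> R1 \<union> R2)) *
        (F (case P of (R1, R2) \<Rightarrow> R1 \<union> R2) * G (case P of (R1, R2) \<Rightarrow> R1 \<union> R2)) =
        (case P of (R1, R2) \<Rightarrow> \<gamma> ^ card R1 * (1 - \<gamma>) ^ card (X - R1) * F R1 *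
          (\<gamma> ^ card R2 * (1 - \<gamma>) ^ card (?Y - R2) * G R2))"
      by (simp add: R power_add)
  qed (use X in auto)
  finally show ?thesis by (simp add: subset_mean_def)
qed

end

lemma subset_mean_1:
  assumes "finite C" shows "subset_mean \<gamma> C (\<lambda>_. 1) = 1"
  using assms
proof (induction C)
  case empty
  then show ?case by (simp add: subset_mean_def)
next
  case (insert c C)
  have "subset_mean \<gamma> (insert c C) (\<lambda>_. 1)
      = (\<Sum>R\<in>Pow C. \<gamma> ^ card R * (1 - \<gamma>) ^ card (insert c C - R))
      + (\<Sum>R\<in>insert c ` Pow C. \<gamma> ^ card R * (1 - \<gamma>) ^ card (insert c C - R))"
    unfolding subset_mean_def Pow_insert using insert by (subst sum.union_disjoint) auto
  also have "(\<Sum>R\<in>Pow C. \<gamma> ^ card R * (1 - \<gamma>) ^ card (insert c C - R))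
      = (1 - \<gamma>) * subset_mean \<gamma> C (\<lambda>_. 1)"
    unfolding subset_mean_def sum_distrib_left
  proof (rule sum.cong[OF refl])
    fix R assume "R \<in> Pow C"
    then have "insert c C - R = insert c (C - R)" using insert.hyps by auto
    then show "\<gamma> ^ card R * (1 - \<gamma>) ^ card (insert c C - R)
        = (1 - \<gamma>) * (\<gamma> ^ card R * (1 - \<gamma>) ^ card (C - R) * 1)"
      using insert.hyps by simp
  qed
  also have "(\<Sum>R\<in>insert c ` Pow C. \<gamma> ^ card R * (1 - \<gamma>) ^ card (insert c C - R))
      = \<gamma> * subset_mean \<gamma> C (\<lambda>_. 1)"
  proof -
    have "inj_on (insert c) (Pow C)" using insert.hyps by (auto simp: inj_on_def)
    then show ?thesis
      unfolding subset_mean_def sum_distrib_left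
    proof (subst sum.reindex, assumption, intro sum.cong refl)
      fix R assume R: "R \<in> Pow C"
      then have "insert c C - insert c R = C - R" "finite R" "c \<notin> R"
        using insert.hyps finite_subset[of R C] by auto
      then show "((\<lambda>R. \<gamma> ^ card R * (1 - \<gamma>) ^ card (insert c C - R)) \<circ> insert c) R
          = \<gamma> * (\<gamma> ^ card R * (1 - \<gamma>) ^ card (C - R) * 1)"
        by simp
    qed
  qed
  finally show ?case by (simp add: insert.IH)
qed

context random_subset
begin

lemma subset_mean_const: "\<E> (\<lambda>_. x) = x"
  using subset_mean_cmult[of \<gamma> C x "\<lambda>_. 1"] subset_mean_1[OF finite_C] by simp

lemma subset_mean_restrict:
  assumes X: "X \<subseteq> C" and F: "determined_on C X F"
  shows "\<E> F = subset_mean \<gamma> X F"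
  using subset_mean_split[OF X F determined_on_const[of C "C - X" 1]] finite_C
  by (simp add: subset_mean_1)

lemma subset_mean_indep:
  assumes X: "X \<subseteq> C" and F: "determined_on C X F" and G: "determined_on C (C - X) G"
  shows "\<E> (\<lambda>R. F R * G R) = \<E> F * \<E> G"
  using subset_mean_split[OF assms] subset_mean_restrict[OF X F] subset_mean_restrict[OF _ G] by simp

lemma determined_contains: "S \<subseteq> X \<Longrightarrow> determined_on C X (\<lambda>R. h (S \<subseteq> R))"
  unfolding determined_on_def
proof (intro allI impI)
  fix R assume "S \<subseteq> X"
  then have "(S \<subseteq> R \<inter> X) = (S \<subseteq> R)" by blast
  then show "h (S \<subseteq> R) = h (S \<subseteq> R \<inter> X)" by simp
qed

lemma determined_avoids: "S \<subseteq> X \<Longrightarrow> determined_on C X (\<lambda>R. h (S \<inter> R = {}))"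
  unfolding determined_on_def
proof (intro allI impI)
  fix R assume "S \<subseteq> X"
  then have "S \<inter> (R \<inter> X) = S \<inter> R" by blast
  then show "h (S \<inter> R = {}) = h (S \<inter> (R \<inter> X) = {})" by simp
qed

lemma subset_mean_contains:
  assumes "S \<subseteq> C" shows "\<E> (\<lambda>R. of_bool (S \<subseteq> R)) = \<gamma> ^ card S"
  using finite_subset[OF assms finite_C] assms
proof (induction S)
  case empty
  then show ?case using subset_mean_const[of 1] by simp
next
  case (insert s S)
  have "\<E> (\<lambda>R. of_bool (insert s S \<subseteq> R)) = \<E> (\<lambda>R. of_bool ({s} \<subseteq> R) * of_bool (S \<subseteq> R))"
    by (rule subset_mean_cong) auto
  also have "\<dots> = \<E> (\<lambda>R. of_bool ({s} \<subseteq> R)) * \<E> (\<lambda>R. of_bool (S \<subseteq> R))"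
    using insert by (intro subset_mean_indep[of "{s}"] determined_contains) auto
  also have "\<E> (\<lambda>R. of_bool ({s} \<subseteq> R)) = subset_mean \<gamma> {s} (\<lambda>R. of_bool ({s} \<subseteq> R))"
    using insert by (intro subset_mean_restrict determined_contains) auto
  also have "\<dots> = \<gamma>" by (simp add: subset_mean_def Pow_insert)
  finally show ?case using insert by simp
qed

lemma subset_mean_avoids:
  assumes "S \<subseteq> C" shows "\<E> (\<lambda>R. of_bool (S \<inter> R = {})) = (1 - \<gamma>) ^ card S"
  using finite_subset[OF assms finite_C] assms
proof (induction S)
  case empty
  then show ?case using subset_mean_const[of 1] by simp
next
  case (insert s S)
  have "\<E> (\<lambda>R. of_bool (insert s S \<inter> R = {}))
      = \<E> (\<lambda>R. of_bool ({s} \<inter> R = {}) * of_bool (S \<inter> R = {}))"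
    by (rule subset_mean_cong) auto
  also have "\<dots> = \<E> (\<lambda>R. of_bool ({s} \<inter> R = {})) * \<E> (\<lambda>R. of_bool (S \<inter> R = {}))"
    using insert by (intro subset_mean_indep[of "{s}"] determined_avoids) auto
  also have "\<E> (\<lambda>R. of_bool ({s} \<inter> R = {})) = subset_mean \<gamma> {s} (\<lambda>R. of_bool ({s} \<inter> R = {}))"
    using insert by (intro subset_mean_restrict determined_avoids) auto
  also have "\<dots> = 1 - \<gamma>" by (simp add: subset_mean_def Pow_insert)
  finally show ?case using insert by simp
qed

lemma subset_mean_prod:
  assumes "finite J" and "\<And>j. j \<in> J \<Longrightarrow> X j \<subseteq> C" and "disjoint_family_on X J"
    and "\<And>j. j \<in> J \<Longrightarrow> determined_on C (X j) (F j)"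
  shows "\<E> (\<lambda>R. \<Prod>j\<in>J. F j R) = (\<Prod>j\<in>J. \<E> (F j))"
  using assms
proof (induction J)
  case empty
  then show ?case by (simp add: subset_mean_const)
next
  case (insert i J)
  have "determined_on C (C - X i) (\<lambda>R. \<Prod>j\<in>J. F j R)"
    unfolding determined_on_def
  proof (intro allI impI prod.cong refl)
    fix R j assume R: "R \<subseteq> C" and j: "j \<in> J"
    have "determined_on C (C - X i) (F j)"
    proof (rule determined_on_mono)
      show "determined_on C (X j) (F j)" using insert.prems j by simp
      show "X j \<subseteq> C - X i"
      proof -
        have "i \<noteq> j" using insert.hyps j by blast
        then have "X i \<inter> X j = {}" using insert.prems(2) j by (simp add: disjoint_family_on_def)
        moreover have "X j \<subseteq> C" using insert.prems(1) j by simp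
        ultimately show ?thesis by blast
      qed
    qed
    then show "F j R = F j (R \<inter> (C - X i))" using R unfolding determined_on_def by blast
  qed
  then have "\<E> (\<lambda>R. F i R * (\<Prod>j\<in>J. F j R)) = \<E> (F i) * \<E> (\<lambda>R. \<Prod>j\<in>J. F j R)"
    using insert.prems by (intro subset_mean_indep[of "X i"]) auto
  moreover have "\<E> (\<lambda>R. \<Prod>j\<in>J. F j R) = (\<Prod>j\<in>J. \<E> (F j))"
    using insert.prems by (intro insert.IH) (auto simp: disjoint_family_on_def)
  ultimately show ?case using insert.hyps by simp
qed

text \<open>Mixed products vanish in the mean, being independent and centred, and each square is at
  most 1.\<close>

lemma subset_mean_variance:
  assumes J: "finite J" and X: "\<And>j. j \<in> J \<Longrightarrow> X j \<subseteq> C" and disj: "disjoint_family_on X J"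
    and F: "\<And>j. j \<in> J \<Longrightarrow> determined_on C (X j) (F j)"
    and mean0: "\<And>j. j \<in> J \<Longrightarrow> \<E> (F j) = 0"
    and bound: "\<And>j R. j \<in> J \<Longrightarrow> R \<subseteq> C \<Longrightarrow> \<bar>F j R\<bar> \<le> 1"
  shows "\<E> (\<lambda>R. (\<Sum>j\<in>J. F j R)\<^sup>2) \<le> card J"
proof -
  have "\<E> (\<lambda>R. (\<Sum>j\<in>J. F j R)\<^sup>2) = (\<Sum>i\<in>J. \<Sum>j\<in>J. \<E> (\<lambda>R. F i R * F j R))"
    by (simp add: power2_eq_square sum_product subset_mean_sum)
  also have "\<dots> \<le> (\<Sum>i\<in>J. \<Sum>j\<in>J. if i = j then 1 else 0)"
  proof (intro sum_mono)
    fix i j assume ij: "i \<in> J" "j \<in> J"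
    show "\<E> (\<lambda>R. F i R * F j R) \<le> (if i = j then 1 else 0)"
    proof (cases "i = j")
      case True
      have "\<E> (\<lambda>R. F i R * F j R) \<le> \<E> (\<lambda>_. 1)"
      proof (rule subset_mean_mono)
        fix R assume "R \<subseteq> C"
        then have "\<bar>F j R\<bar> \<le> 1" using bound ij by simp
        then show "F i R * F j R \<le> 1"
          using True abs_square_le_1[of "F j R"] by (simp add: power2_eq_square)
      qed
      then show ?thesis using True subset_mean_const[of 1] by simp
    next
      case False
      then have "X j \<subseteq> C - X i" using X[OF ij(2)] disj ij unfolding disjoint_family_on_def by blast
      then have "\<E> (\<lambda>R. F i R * F j R) = \<E> (F i) * \<E> (F j)"
        using ij by (intro subset_mean_indep[OF X[OF ij(1)] F] determined_on_mono[OF F]) auto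
      then show ?thesis using mean0 ij False by simp
    qed
  qed
  also have "\<dots> = card J" using J by simp
  finally show ?thesis .
qed

text \<open>As \<open>0 < \<gamma> < 1\<close>, every subset has positive weight; if all values
  exceeded the mean, the mean would exceed itself.\<close>

lemma subset_mean_attained: "\<exists>R\<subseteq>C. F R \<le> \<E> F"
proof (rule ccontr)
  assume none: "\<not> (\<exists>R\<subseteq>C. F R \<le> \<E> F)"
  define x where "x = \<E> F"
  have less: "x < F R" if "R \<subseteq> C" for R
    using none that unfolding x_def by (meson not_le)
  have "\<E> (\<lambda>_. x) < \<E> F"
    unfolding subset_mean_def
  proof (rule sum_strict_mono)
    show "finite (Pow C)" "Pow C \<noteq> {}" using finite_C by auto
    fix R assume "R \<in> Pow C"
    then show "\<gamma> ^ card R * (1 - \<gamma>) ^ card (C - R) * x < \<gamma> ^ card R * (1 - \<gamma>) ^ card (C - R) * F R"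
      using less[of R] \<gamma> by (intro mult_strict_left_mono) auto
  qed
  then show False by (simp add: subset_mean_const x_def)
qed

end

section \<open>Properly coloured bipartite graphs\<close>

text \<open>An edge is an ordered pair, so the component tells the side of an end, and exchanging
  the sides is just the converse relation.\<close>

locale proper_pairs =
  fixes A :: "'a set" and B :: "'b set" and G :: "('a \<times> 'b) set" and \<chi> :: "'a \<times> 'b \<Rightarrow> 'c set"
    and t n :: nat
  assumes finite_A: "finite A" and finite_B: "finite B"
    and card_A: "card A = n" and card_B: "card B = n"
    and G_sub: "G \<subseteq> A \<times> B"
    and finite_colours: "e \<in> G \<Longrightarrow> finite (\<chi> e)" and card_colours: "e \<in> G \<Longrightarrow> card (\<chi> e) = t"
    and proper: "e \<in> G \<Longrightarrow> f \<in> G \<Longrightarrow> e \<noteq> f \<Longrightarrow> fst e = fst f \<or> snd e = snd f \<Longrightarrow> \<chi> e \<inter> \<chi> f = {}"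

text \<open>The setting is symmetric; through this instance each statement about \<open>A\<close>
  yields its mirror image for \<open>B\<close>.\<close>

lemma (in proper_pairs) converse_proper_pairs:
  "proper_pairs B A (G\<inverse>) (\<lambda>e. \<chi> (prod.swap e)) t n"
proof
  fix e f assume "e \<in> G\<inverse>" "f \<in> G\<inverse>" "e \<noteq> f" "fst e = fst f \<or> snd e = snd f"
  then show "\<chi> (prod.swap e) \<inter> \<chi> (prod.swap f) = {}"
    by (intro proper) auto
next
  show "G\<inverse> \<subseteq> B \<times> A" using G_sub by auto
  fix e assume "e \<in> G\<inverse>"
  then have "prod.swap e \<in> G" by auto
  then show "finite (\<chi> (prod.swap e))" "card (\<chi> (prod.swap e)) = t"
    using finite_colours card_colours by blast+
qed (use finite_A finite_B card_A card_B in blast)+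

context proper_pairs
begin

definition "C = \<Union>(\<chi> ` G)"

lemma finite_G: "finite G"
  using G_sub finite_A finite_B finite_subset by blast

lemma finite_C: "finite C"
  unfolding C_def using finite_G finite_colours by blast

lemma colours_sub: "e \<in> G \<Longrightarrow> \<chi> e \<subseteq> C"
  by (auto simp: C_def)

text \<open>A colour class is a matching, because different edges at a vertex share no
  colour.\<close>

lemma card_colour_class: "card {e \<in> G. c \<in> \<chi> e} \<le> n"
proof -
  have "inj_on fst {e \<in> G. c \<in> \<chi> e}"
  proof (intro inj_onI, rule ccontr)
    fix e f assume ef: "e \<in> {e \<in> G. c \<in> \<chi> e}" "f \<in> {e \<in> G. c \<in> \<chi> e}" "fst e = fst f" "e \<noteq> f"
    then have "\<chi> e \<inter> \<chi> f = {}" by (intro proper) auto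
    then show False using ef by blast
  qed
  moreover have "fst ` {e \<in> G. c \<in> \<chi> e} \<subseteq> A" using G_sub by auto
  ultimately show ?thesis using card_inj_on_le finite_A card_A by blast
qed

lemma card_meeting_colours:
  assumes "finite P" shows "card {e \<in> G. \<chi> e \<inter> P \<noteq> {}} \<le> n * card P"
proof -
  have "{e \<in> G. \<chi> e \<inter> P \<noteq> {}} = (\<Union>c\<in>P. {e \<in> G. c \<in> \<chi> e})" by blast
  then have "card {e \<in> G. \<chi> e \<inter> P \<noteq> {}} \<le> (\<Sum>c\<in>P. card {e \<in> G. c \<in> \<chi> e})"
    by (simp only: card_UN_le[OF assms])
  also have "\<dots> \<le> (\<Sum>c\<in>P. n)" by (rule sum_mono) (rule card_colour_class)
  finally show ?thesis by (simp add: mult.commute)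
qed

text \<open>The colour sets at \<open>a\<close> are pairwise disjoint, so different edges meet
  \<open>P\<close> in different colours.\<close>

lemma card_meeting_colours_at:
  assumes "finite P" shows "card {b. (a, b) \<in> G \<and> \<chi> (a, b) \<inter> P \<noteq> {}} \<le> card P"
proof -
  define T where "T = {b. (a, b) \<in> G \<and> \<chi> (a, b) \<inter> P \<noteq> {}}"
  define pick where "pick b = (SOME c. c \<in> \<chi> (a, b) \<inter> P)" for b
  have pick: "pick b \<in> \<chi> (a, b) \<inter> P" if "b \<in> T" for b
    unfolding pick_def by (rule someI_ex) (use that in \<open>auto simp: T_def\<close>)
  have "inj_on pick T"
  proof (rule inj_onI, rule ccontr)
    fix b b' assume b: "b \<in> T" "b' \<in> T" "pick b = pick b'" "b \<noteq> b'"
    then have "\<chi> (a, b) \<inter> \<chi> (a, b') = {}" by (intro proper) (auto simp: T_def)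
    then show False using pick[of b] pick[of b'] b by auto
  qed
  moreover have "pick ` T \<subseteq> P" using pick by blast
  ultimately show ?thesis using card_inj_on_le[OF _ _ assms] by (simp add: T_def)
qed

lemma disjoint_at: "disjoint_family_on (\<lambda>b. \<chi> (a, b)) {b. (a, b) \<in> G}"
  using proper by (auto simp: disjoint_family_on_def)

lemma finite_right: "finite {b. (a, b) \<in> G}" and card_right: "card {b. (a, b) \<in> G} \<le> n"
proof -
  have sub: "{b. (a, b) \<in> G} \<subseteq> B" using G_sub by auto
  then show "finite {b. (a, b) \<in> G}" using finite_B finite_subset by blast
  show "card {b. (a, b) \<in> G} \<le> n" using card_mono[OF finite_B sub] card_B by simp
qed

lemma edges_leaving_A:
  fixes x :: real
  assumes S: "S \<subseteq> A" and finT: "finite T" and x: "\<And>a. a \<in> A \<Longrightarrow> x + card T \<le> card {b. (a, b) \<in> G}"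
  shows "real (card S) * x \<le> real (card (G \<inter> S \<times> (B - T)))"
proof -
  have finS: "finite S" by (rule finite_subset[OF S finite_A])
  have eq: "G \<inter> S \<times> (B - T) = (SIGMA a:S. {b. (a, b) \<in> G} - T)" using G_sub by auto
  have "real (card S) * x \<le> (\<Sum>a\<in>S. real (card ({b. (a, b) \<in> G} - T)))"
  proof -
    have "x \<le> real (card ({b. (a, b) \<in> G} - T))" if "a \<in> S" for a
    proof -
      have "card {b. (a, b) \<in> G} - card T \<le> card ({b. (a, b) \<in> G} - T)"
        by (rule diff_card_le_card_Diff[OF finT])
      then show ?thesis using x[of a] that S by force
    qed
    then show ?thesis using sum_mono[of S "\<lambda>_. x"] by simp
  qed
  also have "\<dots> = real (card (G \<inter> S \<times> (B - T)))"
    unfolding eq using finS finite_right by (subst card_SigmaI) auto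
  finally show ?thesis .
qed

lemma edges_leaving_B:
  fixes x :: real
  assumes T: "T \<subseteq> B" and finS: "finite S" and x: "\<And>b. b \<in> B \<Longrightarrow> x + card S \<le> card {a. (a, b) \<in> G}"
  shows "real (card T) * x \<le> real (card (G \<inter> (A - S) \<times> T))"
proof -
  interpret conv: proper_pairs B A "G\<inverse>" "\<lambda>e. \<chi> (prod.swap e)" t n by (rule converse_proper_pairs)
  have "G\<inverse> \<inter> T \<times> (A - S) = (G \<inter> (A - S) \<times> T)\<inverse>" by blast
  then show ?thesis using conv.edges_leaving_A[OF T finS, of x] x by simp
qed

text \<open>If \<open>d\<close> were small, two sets of about \<open>(1 - \<alpha>) * d\<close>
  vertices would fall under \<open>dense\<close> although there are fewer than
  \<open>(\<alpha> * n)\<^sup>2\<close> pairs between them, too few for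
  \<open>\<alpha> * n\<^sup>2\<close> edges.\<close>

lemma degree_linear:
  fixes \<alpha> \<epsilon> d :: real
  assumes \<alpha>: "0 < \<alpha>" "\<alpha> < 1" and \<epsilon>: "0 < \<epsilon>" "\<epsilon> \<le> \<alpha>" and n: "n \<ge> 1" "2 / \<alpha> \<le> real n"
    and degA: "\<And>a. a \<in> A \<Longrightarrow> (1 - \<epsilon>) * d \<le> card {b. (a, b) \<in> G} \<and> card {b. (a, b) \<in> G} \<le> (1 + \<epsilon>) * d"
    and dense: "\<And>S T. S \<subseteq> A \<Longrightarrow> T \<subseteq> B \<Longrightarrow> (1 - \<alpha>) * d \<le> card S \<Longrightarrow> (1 - \<alpha>) * d \<le> card T \<Longrightarrow>
      \<alpha> * (real n)\<^sup>2 \<le> card (G \<inter> S \<times> T)"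
  shows "d \<ge> \<alpha> * real n / 2"
proof (rule ccontr)
  assume "\<not> ?thesis"
  then have small: "d < \<alpha> * real n / 2" by simp
  have "A \<noteq> {}" using n card_A by auto
  then obtain a where a: "a \<in> A" by blast
  \<comment> \<open>The window for the degree of \<open>a\<close> is not empty, which forces
    \<open>d \<ge> 0\<close>.\<close>
  have "(1 - \<epsilon>) * d \<le> (1 + \<epsilon>) * d" using degA[OF a] by linarith
  then have "0 \<le> 2 * \<epsilon> * d" by (simp add: algebra_simps)
  then have d0: "0 \<le> d" using \<epsilon> by (simp add: zero_le_mult_iff)
  define k where "k = nat \<lceil>(1 - \<alpha>) * d\<rceil>"
  have k: "(1 - \<alpha>) * d \<le> real k" "real k < (1 - \<alpha>) * d + 1"
    using d0 \<alpha> mult_nonneg_nonneg[of "1 - \<alpha>" d] unfolding k_def by linarith+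
  have card_G: "card {b. (a, b) \<in> G} \<le> n"
    using card_mono[OF finite_B, of "{b. (a, b) \<in> G}"] G_sub card_B by auto
  have "(1 - \<alpha>) * d \<le> (1 - \<epsilon>) * d" using \<epsilon> d0 by (intro mult_right_mono) auto
  then have "(1 - \<alpha>) * d \<le> real n" using degA[OF a] card_G by linarith
  then have kn: "k \<le> n" unfolding k_def by linarith
  obtain S where S: "S \<subseteq> A" "card S = k"
    using obtain_subset_with_card_n[of k A] kn card_A by blast
  obtain T where T: "T \<subseteq> B" "card T = k"
    using obtain_subset_with_card_n[of k B] kn card_B by blast
  have fin: "finite S" "finite T"
    using finite_subset[OF S(1) finite_A] finite_subset[OF T(1) finite_B] by blast+
  have "\<alpha> * (real n)\<^sup>2 \<le> card (G \<inter> S \<times> T)" using S T k by (intro dense) auto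
  also have "\<dots> \<le> real (card (S \<times> T))" using fin by (intro of_nat_mono card_mono) auto
  also have "\<dots> = real k * real k" using S T by (simp add: card_cartesian_product)
  also have "\<dots> < (\<alpha> * real n) * (\<alpha> * real n)"
  proof -
    have "(1 - \<alpha>) * d \<le> 1 * d" using \<alpha> d0 by (intro mult_right_mono) auto
    moreover have "1 \<le> \<alpha> * real n / 2" using n(2) \<alpha> by (simp add: field_simps)
    ultimately have "real k < \<alpha> * real n" using k small by linarith
    then show ?thesis by (intro mult_strict_mono') auto
  qed
  also have "\<dots> = \<alpha> * (\<alpha> * (real n)\<^sup>2)" by (simp add: power2_eq_square)
  also have "\<dots> \<le> \<alpha> * (1 * (real n)\<^sup>2)" using \<alpha> by (intro mult_left_mono mult_right_mono) auto
  finally show False by simp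
qed

end

section \<open>Reserving a random set of colours\<close>

text \<open>Cauchy-Schwarz twice, over the vertices of \<open>T\<close> and then over the pairs in
  \<open>S \<times> S\<close>, enlarging the ranges to \<open>B\<close> and \<open>A\<close> once
  the terms are squares. The double sum on the right is the weighted count of 4-cycles (the fourth
  power of the box norm of \<open>h\<close>). It does not depend on \<open>S\<close> and
  \<open>T\<close>, so one bound serves all pairs of sets and no union bound is needed.\<close>

lemma discrepancy_power4:
  fixes h :: "'a \<times> 'b \<Rightarrow> real"
  assumes A: "finite A" "card A \<le> n" and B: "finite B" "card B \<le> n" and S: "S \<subseteq> A" and T: "T \<subseteq> B"
  shows "(\<Sum>a\<in>S. \<Sum>b\<in>T. h (a, b)) ^ 4
    \<le> real n ^ 4 * (\<Sum>a\<in>A. \<Sum>a'\<in>A. (\<Sum>b\<in>B. h (a, b) * h (a', b))\<^sup>2)"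
proof -
  define y where "y b = (\<Sum>a\<in>S. h (a, b))" for b
  define cod where "cod a a' = (\<Sum>b\<in>B. h (a, b) * h (a', b))" for a a'
  define Q where "Q = (\<Sum>a\<in>A. \<Sum>a'\<in>A. (cod a a')\<^sup>2)"
  have fin: "finite S" "finite T" using S T A B finite_subset by auto
  have card: "card S \<le> n" "card T \<le> n" using S T A B card_mono le_trans by blast+
  have sq: "(\<Sum>b\<in>B. (y b)\<^sup>2) = (\<Sum>p\<in>S \<times> S. case p of (a, a') \<Rightarrow> cod a a')"
  proof -
    have "(\<Sum>b\<in>B. (y b)\<^sup>2) = (\<Sum>b\<in>B. \<Sum>p\<in>S \<times> S. case p of (a, a') \<Rightarrow> h (a, b) * h (a', b))"
      by (simp add: y_def power2_eq_square sum_product sum.cartesian_product)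
    also have "\<dots> = (\<Sum>p\<in>S \<times> S. \<Sum>b\<in>B. case p of (a, a') \<Rightarrow> h (a, b) * h (a', b))"
      by (rule sum.swap)
    finally show ?thesis by (simp add: cod_def case_prod_unfold)
  qed
  have "(\<Sum>p\<in>S \<times> S. case p of (a, a') \<Rightarrow> cod a a')\<^sup>2
      \<le> (\<Sum>p\<in>S \<times> S. (case p of (a, a') \<Rightarrow> cod a a')\<^sup>2) * card (S \<times> S)"
    by (rule sum_squared_le_sum_of_squares)
  also have "\<dots> \<le> Q * (real n)\<^sup>2"
  proof (rule mult_mono)
    have "(\<Sum>p\<in>S \<times> S. (case p of (a, a') \<Rightarrow> cod a a')\<^sup>2)
        \<le> (\<Sum>p\<in>A \<times> A. (case p of (a, a') \<Rightarrow> cod a a')\<^sup>2)"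
      using A S by (intro sum_mono2) auto
    then show "(\<Sum>p\<in>S \<times> S. (case p of (a, a') \<Rightarrow> cod a a')\<^sup>2) \<le> Q"
      by (simp add: Q_def sum.cartesian_product case_prod_unfold)
    have "real (card S) * real (card S) \<le> real n * real n" using card by (intro mult_mono) auto
    then show "real (card (S \<times> S)) \<le> (real n)\<^sup>2"
      by (simp add: card_cartesian_product power2_eq_square)
  qed (auto simp: Q_def intro!: sum_nonneg)
  finally have cod_le: "(\<Sum>b\<in>B. (y b)\<^sup>2)\<^sup>2 \<le> Q * (real n)\<^sup>2" by (simp add: sq)
  have "(\<Sum>b\<in>T. y b)\<^sup>2 \<le> (\<Sum>b\<in>T. (y b)\<^sup>2) * card T"
    by (rule sum_squared_le_sum_of_squares)
  also have "\<dots> \<le> (\<Sum>b\<in>B. (y b)\<^sup>2) * n"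
    using B T card by (intro mult_mono sum_mono2) (auto intro!: sum_nonneg)
  finally have "((\<Sum>b\<in>T. y b)\<^sup>2)\<^sup>2 \<le> ((\<Sum>b\<in>B. (y b)\<^sup>2) * n)\<^sup>2"
    by (rule power_mono) simp
  also have "\<dots> = (\<Sum>b\<in>B. (y b)\<^sup>2)\<^sup>2 * (real n)\<^sup>2" by (simp add: power_mult_distrib)
  also have "\<dots> \<le> Q * (real n)\<^sup>2 * (real n)\<^sup>2" using cod_le by (intro mult_right_mono) auto
  also have "\<dots> = real n ^ 4 * Q" by (simp add: power2_eq_square power4_eq_xxxx)
  finally have "(\<Sum>b\<in>T. y b) ^ 4 \<le> real n ^ 4 * Q"
    by (simp add: power2_eq_square power4_eq_xxxx mult.assoc)
  moreover have "(\<Sum>b\<in>T. y b) = (\<Sum>a\<in>S. \<Sum>b\<in>T. h (a, b))" unfolding y_def by (rule sum.swap)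
  ultimately show ?thesis by (simp add: Q_def cod_def)
qed

section \<open>Moments of the reserved colours\<close>

context proper_pairs
begin

text \<open>With \<open>p\<close> the probability that all colours of an edge lie in
  \<open>R\<close>, this has mean 0; being 0 off \<open>G\<close>, it can be summed over all of
  \<open>A \<times> B\<close>.\<close>

definition "centred_contains p R e = (if e \<in> G then of_bool (\<chi> e \<subseteq> R) - p else (0::real))"
definition "centred_avoids q R e = (if e \<in> G then of_bool (\<chi> e \<inter> R = {}) - q else (0::real))"
text \<open>With the square expanded, this is the sum over all closed walks \<open>a b a' b'\<close>
  of the product of the four centred indicators.\<close>

definition "cycle_sum p R
  = (\<Sum>a\<in>A. \<Sum>a'\<in>A. (\<Sum>b\<in>B. centred_contains p R (a, b) * centred_contains p R (a', b))\<^sup>2)"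

end

locale random_colours = proper_pairs A B G \<chi> t n
  for A :: "'a set" and B :: "'b set" and G and \<chi> :: "'a \<times> 'b \<Rightarrow> 'c set" and t n +
  fixes \<gamma> :: real
  assumes \<gamma>: "0 < \<gamma>" "\<gamma> < 1"
begin

sublocale random_subset C \<gamma>
  by unfold_locales (use finite_C \<gamma> in auto)

definition "p = \<gamma> ^ t"
definition "q = (1 - \<gamma>) ^ t"

lemma p: "0 < p" "p \<le> 1" and q: "0 < q" "q \<le> 1"
  using \<gamma> by (auto simp: p_def q_def power_le_one)

lemma mean_centred_contains: "\<E> (\<lambda>R. centred_contains p R e) = 0"
proof (cases "e \<in> G")
  case True
  have "\<E> (\<lambda>R. of_bool (\<chi> e \<subseteq> R) + - p) = 0"
    unfolding subset_mean_add subset_mean_const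
    using True by (simp add: subset_mean_contains colours_sub card_colours p_def)
  then show ?thesis using True by (simp add: centred_contains_def)
qed (simp add: centred_contains_def subset_mean_const)

lemma mean_centred_avoids: "\<E> (\<lambda>R. centred_avoids q R e) = 0"
proof (cases "e \<in> G")
  case True
  have "\<E> (\<lambda>R. of_bool (\<chi> e \<inter> R = {}) + - q) = 0"
    unfolding subset_mean_add subset_mean_const
    using True by (simp add: subset_mean_avoids colours_sub card_colours q_def)
  then show ?thesis using True by (simp add: centred_avoids_def)
qed (simp add: centred_avoids_def subset_mean_const)

lemma determined_centred_contains:
  "(e \<in> G \<Longrightarrow> \<chi> e \<subseteq> X) \<Longrightarrow> determined_on C X (\<lambda>R. centred_contains p R e)"
  unfolding centred_contains_def
  using determined_contains[where h = "\<lambda>x. of_bool x - p"] determined_on_const[of C X 0]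
  by (cases "e \<in> G") simp_all

lemma determined_centred_avoids:
  "(e \<in> G \<Longrightarrow> \<chi> e \<subseteq> X) \<Longrightarrow> determined_on C X (\<lambda>R. centred_avoids q R e)"
  unfolding centred_avoids_def
  using determined_avoids[where h = "\<lambda>x. of_bool x - q"] determined_on_const[of C X 0]
  by (cases "e \<in> G") simp_all

lemma abs_centred: "\<bar>centred_contains p R e\<bar> \<le> 1" "\<bar>centred_avoids q R e\<bar> \<le> 1"
  using p q by (auto simp: centred_contains_def centred_avoids_def)

text \<open>In a proper 4-cycle the edge \<open>(a, b)\<close> shares an end, hence no colour, with
  \<open>(a', b)\<close> and \<open>(a, b')\<close>. Unless it shares a colour with the opposite
  edge \<open>(a', b')\<close>, its factor is independent of the other three and has mean 0. In all
  exceptional cases the trivial bound 1 is used.\<close>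

lemma four_cycle_mean:
  "\<E> (\<lambda>R. centred_contains p R (a, b) * centred_contains p R (a', b) *
      (centred_contains p R (a, b') * centred_contains p R (a', b')))
   \<le> of_bool (a = a') + of_bool (b = b') +
      of_bool ((a, b) \<in> G \<and> (a', b') \<in> G \<and> \<chi> (a', b') \<inter> \<chi> (a, b) \<noteq> {})"
proof -
  let ?w = "\<lambda>R. centred_contains p R"
  have le1: "\<E> (\<lambda>R. ?w R (a, b) * ?w R (a', b) * (?w R (a, b') * ?w R (a', b'))) \<le> 1"
  proof -
    have "\<E> (\<lambda>R. ?w R (a, b) * ?w R (a', b) * (?w R (a, b') * ?w R (a', b'))) \<le> \<E> (\<lambda>_. 1)"
    proof (rule subset_mean_mono)
      fix R
      have "\<bar>?w R (a, b) * ?w R (a', b) * (?w R (a, b') * ?w R (a', b'))\<bar> \<le> 1"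
        unfolding abs_mult by (intro mult_le_one abs_centred mult_nonneg_nonneg) auto
      then show "?w R (a, b) * ?w R (a', b) * (?w R (a, b') * ?w R (a', b')) \<le> 1" by linarith
    qed
    then show ?thesis by (simp add: subset_mean_const)
  qed
  show ?thesis
  proof (cases "a = a' \<or> b = b' \<or> (a, b) \<in> G \<and> (a', b') \<in> G \<and> \<chi> (a', b') \<inter> \<chi> (a, b) \<noteq> {}")
    case True
    then have "1 \<le> of_bool (a = a') + of_bool (b = b') +
      (of_bool ((a, b) \<in> G \<and> (a', b') \<in> G \<and> \<chi> (a', b') \<inter> \<chi> (a, b) \<noteq> {}) :: real)" by auto
    then show ?thesis using le1 by linarith
  next
    case False
    have "\<E> (\<lambda>R. ?w R (a, b) * (?w R (a', b) * (?w R (a, b') * ?w R (a', b')))) = 0"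
    proof (cases "(a, b) \<in> G")
      case True
      have "\<chi> (a', b) \<subseteq> C - \<chi> (a, b)" if "(a', b) \<in> G"
        using proper[OF that True] False colours_sub[OF that] by auto
      moreover have "\<chi> (a, b') \<subseteq> C - \<chi> (a, b)" if "(a, b') \<in> G"
        using proper[OF that True] False colours_sub[OF that] by auto
      moreover have "\<chi> (a', b') \<subseteq> C - \<chi> (a, b)" if "(a', b') \<in> G"
        using True False colours_sub[OF that] that by auto
      ultimately show ?thesis
        using colours_sub[OF True]
        by (subst subset_mean_indep[of "\<chi> (a, b)"])
           (auto intro!: determined_on_mult determined_centred_contains simp: mean_centred_contains)
    next
      case False
      then show ?thesis by (simp add: centred_contains_def subset_mean_const)
    qed
    then show ?thesis by (simp add: mult.assoc)
  qed
qed

text \<open>Degenerate cycles contribute \<open>n ^ 3\<close> for \<open>a = a'\<close> and as much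
  for \<open>b = b'\<close>. For opposite edges with a common colour there are at most
  \<open>n\<^sup>2\<close> choices of the first and \<open>n * t\<close> of the second. This saves a
  factor \<open>n\<close> over the trivial \<open>n ^ 4\<close>.\<close>

lemma mean_cycle_sum: "\<E> (cycle_sum p) \<le> (real t + 2) * real n ^ 3"
proof -
  define I where "I e e' = (of_bool (e \<in> G \<and> e' \<in> G \<and> \<chi> e' \<inter> \<chi> e \<noteq> {}) :: real)" for e e'
  have "\<E> (cycle_sum p) = (\<Sum>a\<in>A. \<Sum>a'\<in>A. \<Sum>b\<in>B. \<Sum>b'\<in>B.
      \<E> (\<lambda>R. centred_contains p R (a, b) * centred_contains p R (a', b) *
      (centred_contains p R (a, b') * centred_contains p R (a', b'))))"
    unfolding cycle_sum_def[abs_def] power2_eq_square sum_product subset_mean_sum ..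
  also have "\<dots> \<le> (\<Sum>a\<in>A. \<Sum>a'\<in>A. \<Sum>b\<in>B. \<Sum>b'\<in>B.
      of_bool (a = a') + of_bool (b = b') + I (a, b) (a', b'))"
    unfolding I_def by (intro sum_mono four_cycle_mean)
  also have "\<dots> = 2 * real n ^ 3 + (\<Sum>a\<in>A. \<Sum>a'\<in>A. \<Sum>b\<in>B. \<Sum>b'\<in>B. I (a, b) (a', b'))"
  proof -
    have "(\<Sum>b'\<in>B. of_bool (b = b')) = (1::real)" if "b \<in> B" for b
      using finite_B that by (simp add: of_bool_def)
    moreover have "(\<Sum>a'\<in>A. of_bool (a = a')) = (1::real)" if "a \<in> A" for a
      using finite_A that by (simp add: of_bool_def)
    ultimately show ?thesis
      by (simp add: sum.distrib card_A card_B power3_eq_cube flip: sum_distrib_left)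
  qed
  also have "(\<Sum>a\<in>A. \<Sum>a'\<in>A. \<Sum>b\<in>B. \<Sum>b'\<in>B. I (a, b) (a', b'))
      = (\<Sum>a\<in>A. \<Sum>b\<in>B. \<Sum>a'\<in>A. \<Sum>b'\<in>B. I (a, b) (a', b'))"
    by (rule sum.cong[OF refl]) (rule sum.swap)
  also have "\<dots> = (\<Sum>e\<in>A \<times> B. \<Sum>e'\<in>A \<times> B. I e e')"
  proof -
    define J where "J e = (\<Sum>e'\<in>A \<times> B. I e e')" for e
    have "(\<Sum>a'\<in>A. \<Sum>b'\<in>B. I e (a', b')) = J e" for e
      by (simp add: J_def sum.cartesian_product)
    then show ?thesis by (simp add: sum.cartesian_product flip: J_def)
  qed
  also have "\<dots> \<le> (\<Sum>e\<in>A \<times> B. real (n * t))"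
  proof (rule sum_mono)
    fix e
    show "(\<Sum>e'\<in>A \<times> B. I e e') \<le> real (n * t)"
    proof (cases "e \<in> G")
      case True
      have "(\<Sum>e'\<in>A \<times> B. I e e') = (\<Sum>e'\<in>A \<times> B. of_bool (e' \<in> {e' \<in> G. \<chi> e' \<inter> \<chi> e \<noteq> {}}))"
        using True by (intro sum.cong) (auto simp: I_def)
      also have "\<dots> = real (card ({e' \<in> G. \<chi> e' \<inter> \<chi> e \<noteq> {}}))"
      proof -
        have "A \<times> B \<inter> {e' \<in> G. \<chi> e' \<inter> \<chi> e \<noteq> {}} = {e' \<in> G. \<chi> e' \<inter> \<chi> e \<noteq> {}}" using G_sub by blast
        then show ?thesis using finite_A finite_B by (simp add: of_bool_def sum.If_cases Int_def)
      qed
      also have "\<dots> \<le> real (n * t)"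
        using card_meeting_colours[OF finite_colours[OF True]] card_colours[OF True]
        by (simp flip: of_nat_mult)
      finally show ?thesis .
    next
      case False
      then show ?thesis by (simp add: I_def)
    qed
  qed
  also have "2 * real n ^ 3 + (\<Sum>e\<in>A \<times> B. real (n * t)) = (real t + 2) * real n ^ 3"
    by (simp add: card_cartesian_product card_A card_B power3_eq_cube algebra_simps)
  finally show ?thesis by simp
qed

definition "left_deviation R = (\<Sum>a\<in>A. (\<Sum>b\<in>B. centred_avoids q R (a, b))\<^sup>2)"
text \<open>An exponential-moment substitute for counting the vertices with at most \<open>x\<close>
  reserved edges: such a vertex alone contributes at least 1.\<close>

definition "left_deficit x R = (\<Sum>a\<in>A. exp x * (1/2) ^ card {b. (a, b) \<in> G \<and> \<chi> (a, b) \<subseteq> R})"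

lemma mean_left_deviation: "\<E> left_deviation \<le> (real n)\<^sup>2"
proof -
  have "\<E> (\<lambda>R. (\<Sum>b\<in>B. centred_avoids q R (a, b))\<^sup>2) \<le> real n" for a
  proof -
    have "(\<Sum>b\<in>B. centred_avoids q R (a, b)) = (\<Sum>b\<in>{b. (a, b) \<in> G}. centred_avoids q R (a, b))" for R
      using G_sub finite_B by (intro sum.mono_neutral_right) (auto simp: centred_avoids_def)
    then have "\<E> (\<lambda>R. (\<Sum>b\<in>B. centred_avoids q R (a, b))\<^sup>2) \<le> card {b. (a, b) \<in> G}"
      using subset_mean_variance[where J = "{b. (a, b) \<in> G}" and X = "\<lambda>b. \<chi> (a, b)"
          and F = "\<lambda>b R. centred_avoids q R (a, b)"]
      by (simp add: finite_right colours_sub disjoint_at determined_centred_avoids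
          mean_centred_avoids abs_centred)
    then show ?thesis using card_right[of a] by linarith
  qed
  then have "(\<Sum>a\<in>A. \<E> (\<lambda>R. (\<Sum>b\<in>B. centred_avoids q R (a, b))\<^sup>2)) \<le> (\<Sum>a\<in>A. real n)"
    by (rule sum_mono)
  then show ?thesis
    by (simp add: left_deviation_def[abs_def] subset_mean_sum card_A power2_eq_square)
qed

text \<open>The colour sets at \<open>a\<close> are disjoint, so the mean of the power of 1/2
  factors into \<open>1 - p / 2\<close> for each edge and is at most
  \<open>exp (- (p * m / 2))\<close>. Taking half of this exponent for \<open>x\<close> leaves the
  other half as decay.\<close>

lemma mean_left_deficit:
  assumes m: "\<And>a. a \<in> A \<Longrightarrow> m \<le> real (card {b. (a, b) \<in> G})"
  shows "\<E> (left_deficit (p * m / 4)) \<le> real n * exp (- (p * m / 4))"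
proof -
  have "\<E> (\<lambda>R. (1/2) ^ card {b. (a, b) \<in> G \<and> \<chi> (a, b) \<subseteq> R}) \<le> exp (- (p * m / 2))"
    if a: "a \<in> A" for a
  proof -
    let ?J = "{b. (a, b) \<in> G}"
    have pow: "(1/2 :: real) ^ card {b. (a, b) \<in> G \<and> \<chi> (a, b) \<subseteq> R} = (\<Prod>b\<in>?J. 1 + (- 1/2) * of_bool (\<chi> (a, b) \<subseteq> R))"
      for R :: "'c set"
    proof -
      have "(\<Prod>b\<in>?J. 1 + (- 1/2) * of_bool (\<chi> (a, b) \<subseteq> R)) = (\<Prod>b\<in>?J. if \<chi> (a, b) \<subseteq> R then 1/2 else (1::real))"
        by (rule prod.cong) auto
      also have "\<dots> = (1/2) ^ card (?J \<inter> {b. \<chi> (a, b) \<subseteq> R})"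
        using finite_right[of a] by (simp add: prod.If_cases)
      also have "?J \<inter> {b. \<chi> (a, b) \<subseteq> R} = {b. (a, b) \<in> G \<and> \<chi> (a, b) \<subseteq> R}" by blast
      finally show ?thesis by simp
    qed
    have "\<E> (\<lambda>R. \<Prod>b\<in>?J. 1 + (- 1/2) * of_bool (\<chi> (a, b) \<subseteq> R))
        = (\<Prod>b\<in>?J. \<E> (\<lambda>R. 1 + (- 1/2) * of_bool (\<chi> (a, b) \<subseteq> R)))"
      by (rule subset_mean_prod[where X = "\<lambda>b. \<chi> (a, b)"])
         (auto intro: determined_contains[where h = "\<lambda>x. 1 - of_bool x / 2"]
           simp: finite_right colours_sub disjoint_at)
    also have "\<dots> = (\<Prod>b\<in>?J. 1 + (- (p / 2)))"
      by (rule prod.cong[OF refl], unfold subset_mean_add subset_mean_cmult)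
         (simp add: subset_mean_const subset_mean_contains colours_sub card_colours p_def)
    also have "\<dots> = (1 + (- (p / 2))) ^ card ?J" by simp
    also have "\<dots> \<le> exp (- (p / 2)) ^ card ?J"
      using p by (intro power_mono exp_ge_add_one_self) auto
    also have "\<dots> = exp (real (card ?J) * (- (p / 2)))" by (rule exp_of_nat_mult[symmetric])
    also have "\<dots> \<le> exp (- (p * m / 2))"
      using m[OF a] p mult_right_mono[of m "real (card ?J)" "p / 2"] by (simp add: algebra_simps)
    finally show ?thesis by (simp add: pow)
  qed
  then have "(\<Sum>a\<in>A. exp (p * m / 4) * \<E> (\<lambda>R. (1/2) ^ card {b. (a, b) \<in> G \<and> \<chi> (a, b) \<subseteq> R}))
      \<le> (\<Sum>a\<in>A. exp (p * m / 4) * exp (- (p * m / 2)))"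
    by (intro sum_mono mult_left_mono) auto
  also have "\<dots> = real n * exp (- (p * m / 4))"
    by (simp add: card_A flip: exp_add)
  finally show ?thesis
    by (simp add: left_deficit_def[abs_def] subset_mean_sum subset_mean_cmult)
qed

text \<open>If the count were at most \<open>x\<close>, then 2 to that count would be at most
  \<open>exp x\<close>, and the summand of \<open>a\<close> would already reach 1.\<close>

lemma left_deficit_less_1:
  assumes "left_deficit x R < 1" "a \<in> A"
  shows "x < real (card {b. (a, b) \<in> G \<and> \<chi> (a, b) \<subseteq> R})"
proof (rule ccontr)
  let ?c = "card {b. (a, b) \<in> G \<and> \<chi> (a, b) \<subseteq> R}"
  assume "\<not> ?thesis"
  then have le: "exp (real ?c) \<le> exp x" by simp
  have "(2::real) ^ ?c \<le> exp 1 ^ ?c"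
    using exp_ge_add_one_self[of 1] by (intro power_mono) auto
  also have "\<dots> = exp (real ?c)" using exp_of_nat_mult[of ?c "1::real"] by simp
  also note le
  finally have "2 ^ ?c \<le> exp x" .
  then have "1 \<le> exp x * (1/2) ^ ?c" by (simp add: field_simps)
  also have "\<dots> \<le> left_deficit x R"
    unfolding left_deficit_def using assms finite_A
    by (intro member_le_sum[of a A "\<lambda>a. exp x * (1/2) ^ card {b. (a, b) \<in> G \<and> \<chi> (a, b) \<subseteq> R}"]) auto
  finally show False using assms by simp
qed

end

lemma (in random_colours) converse_random_colours:
  "random_colours B A (G\<inverse>) (\<lambda>e. \<chi> (prod.swap e)) t n \<gamma>"
proof -
  interpret conv: proper_pairs B A "G\<inverse>" "\<lambda>e. \<chi> (prod.swap e)" t n by (rule converse_proper_pairs)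
  show ?thesis by unfold_locales (rule \<gamma>)+
qed

lemma (in random_colours) exists_colour_set:
  assumes n: "n \<ge> 1"
    and degA: "\<And>a. a \<in> A \<Longrightarrow> m \<le> real (card {b. (a, b) \<in> G})"
    and degB: "\<And>b. b \<in> B \<Longrightarrow> m \<le> real (card {a. (a, b) \<in> G})"
    and small: "8 * real n * exp (- (p * m / 4)) \<le> 1"
  obtains R where "cycle_sum p R \<le> 4 * (real t + 2) * real n ^ 3"
    "(\<Sum>a\<in>A. (\<Sum>b\<in>B. centred_avoids q R (a, b))\<^sup>2) \<le> 8 * (real n)\<^sup>2"
    "(\<Sum>b\<in>B. (\<Sum>a\<in>A. centred_avoids q R (a, b))\<^sup>2) \<le> 8 * (real n)\<^sup>2"
    "\<And>a. a \<in> A \<Longrightarrow> p * m / 4 < real (card {b. (a, b) \<in> G \<and> \<chi> (a, b) \<subseteq> R})"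
    "\<And>b. b \<in> B \<Longrightarrow> p * m / 4 < real (card {a. (a, b) \<in> G \<and> \<chi> (a, b) \<subseteq> R})"
proof -
  interpret conv: random_colours B A "G\<inverse>" "\<lambda>e. \<chi> (prod.swap e)" t n \<gamma>
    by (rule converse_random_colours)
  \<comment> \<open>Both orientations have the same colours, so their means refer to the same random
    set.\<close>
  have C_eq: "conv.C = C" unfolding conv.C_def C_def by (auto simp: image_iff)
  define x where "x = p * m / 4"
  define u where "u = 4 * (real t + 2) * real n ^ 3"
  have u: "u > 0" using n by (simp add: u_def)
  define y1 where "y1 = 1 / u"
  define y2 where "y2 = 1 / (8 * (real n)\<^sup>2)"
  have y: "y1 > 0" "y2 > 0" using n u by (simp_all add: y1_def y2_def)
  \<comment> \<open>The scales give mean at most 1/4 to each of the three groups: cycles, deviations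
    and deficits. Some \<open>R\<close> attains at most 3/4, and as no summand is negative, all
    requirements hold for it together.\<close>
  define F where "F R = y1 * cycle_sum p R + y2 * (left_deviation R + conv.left_deviation R)
    + (left_deficit x R + conv.left_deficit x R)" for R
  have conv_dev: "conv.left_deviation R = (\<Sum>b\<in>B. (\<Sum>a\<in>A. centred_avoids q R (a, b))\<^sup>2)" for R
    by (simp add: conv.left_deviation_def conv.centred_avoids_def centred_avoids_def cong: if_cong)
  have "\<E> F = y1 * \<E> (cycle_sum p) + y2 * (\<E> left_deviation + \<E> conv.left_deviation)
    + (\<E> (left_deficit x) + \<E> (conv.left_deficit x))"
    unfolding F_def[abs_def] subset_mean_add subset_mean_cmult ..
  also have "\<dots> \<le> y1 * ((real t + 2) * real n ^ 3) + y2 * ((real n)\<^sup>2 + (real n)\<^sup>2)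
    + (real n * exp (- x) + real n * exp (- x))"
  proof (intro add_mono mult_left_mono)
    show "\<E> (conv.left_deficit x) \<le> real n * exp (- x)"
      using conv.mean_left_deficit[of m, unfolded C_eq] degB unfolding x_def by simp
    show "\<E> (left_deficit x) \<le> real n * exp (- x)"
      using mean_left_deficit[OF degA] unfolding x_def by simp
    show "\<E> conv.left_deviation \<le> (real n)\<^sup>2" by (rule conv.mean_left_deviation[unfolded C_eq])
  qed (use y mean_cycle_sum mean_left_deviation in simp_all)
  also have "\<dots> \<le> 3 / 4"
  proof -
    have "y1 * ((real t + 2) * real n ^ 3) = 1 / 4"
      using u by (simp add: y1_def u_def field_simps)
    moreover have "y2 * ((real n)\<^sup>2 + (real n)\<^sup>2) = 1 / 4"
      using n by (simp add: y2_def field_simps)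
    ultimately show ?thesis using small unfolding x_def by simp
  qed
  finally have "\<E> F \<le> 3 / 4" .
  then obtain R where R: "R \<subseteq> C" "F R \<le> 3 / 4"
    using subset_mean_attained[of F] order_trans by blast
  have nonneg: "0 \<le> cycle_sum p R" "0 \<le> left_deviation R" "0 \<le> conv.left_deviation R"
    "0 \<le> left_deficit x R" "0 \<le> conv.left_deficit x R"
    by (auto simp: cycle_sum_def left_deviation_def conv.left_deviation_def left_deficit_def
        conv.left_deficit_def intro!: sum_nonneg)
  have "y1 * cycle_sum p R \<ge> 0" "y2 * (left_deviation R + conv.left_deviation R) \<ge> 0"
    using nonneg y by simp_all
  then have parts: "y1 * cycle_sum p R \<le> 1"
    "y2 * (left_deviation R + conv.left_deviation R) \<le> 1"
    "left_deficit x R < 1" "conv.left_deficit x R < 1"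
    using R(2) nonneg unfolding F_def by linarith+
  show ?thesis
  proof (rule that)
    show "cycle_sum p R \<le> 4 * (real t + 2) * real n ^ 3"
      unfolding u_def[symmetric] using parts(1) u by (simp add: y1_def field_simps)
    have "left_deviation R + conv.left_deviation R \<le> 8 * (real n)\<^sup>2"
      using parts(2) n by (simp add: y2_def field_simps)
    then show "(\<Sum>a\<in>A. (\<Sum>b\<in>B. centred_avoids q R (a, b))\<^sup>2) \<le> 8 * (real n)\<^sup>2"
      "(\<Sum>b\<in>B. (\<Sum>a\<in>A. centred_avoids q R (a, b))\<^sup>2) \<le> 8 * (real n)\<^sup>2"
      using nonneg unfolding conv_dev by (auto simp: left_deviation_def)
    show "p * m / 4 < real (card {b. (a, b) \<in> G \<and> \<chi> (a, b) \<subseteq> R})" if "a \<in> A" for a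
      using left_deficit_less_1[OF parts(3) that] by (simp add: x_def)
    show "p * m / 4 < real (card {a. (a, b) \<in> G \<and> \<chi> (a, b) \<subseteq> R})" if "b \<in> B" for b
      using conv.left_deficit_less_1[OF parts(4) that] by (simp add: x_def)
  qed
qed

section \<open>Augmenting a rainbow matching with reserved colours\<close>

context proper_pairs
begin

text \<open>\<open>S\<close> consists of the partners in \<open>M\<close> of the neighbours of
  \<open>a\<close>, and \<open>T\<close> of the vertices reached from \<open>a\<close> along
  \<open>F\<close>, \<open>M\<close>, \<open>F\<close> in at least \<open>r\<close>
  colour-compatible ways. If \<open>T\<close> were smaller than \<open>\<tau>\<close>, at least
  \<open>\<beta>\<close> edges of \<open>F\<close> would run from \<open>S\<close> to
  \<open>B - T\<close>, which is more than can be accounted for.\<close>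

lemma robust_reach:
  fixes s r \<tau> \<beta> :: real
  assumes F: "F \<subseteq> G" and M: "M \<subseteq> A \<times> B" "inj_on fst M" "inj_on snd M"
    and deg: "s \<le> real (card {b. (a, b) \<in> F}) - (real n - real (card M))"
    and expand: "\<And>S T. S \<subseteq> A \<Longrightarrow> T \<subseteq> B \<Longrightarrow> s \<le> card S \<Longrightarrow> card T < \<tau> \<Longrightarrow>
      \<beta> \<le> card (F \<inter> S \<times> (B - T))"
    and \<beta>: "real n * r + (real n - real (card M)) * n + t * n < \<beta>" and r: "r \<ge> 0"
  obtains T where "T \<subseteq> snd ` M" "\<tau> \<le> card T"
    "\<And>b2. b2 \<in> T \<Longrightarrow> r \<le> card {e \<in> M. (a, snd e) \<in> F \<and> (fst e, b2) \<in> F \<and> \<chi> (a, snd e) \<inter> \<chi> (fst e, b2) = {}}"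
proof -
  define Z where "Z b2 = {e \<in> M. (a, snd e) \<in> F \<and> (fst e, b2) \<in> F \<and> \<chi> (a, snd e) \<inter> \<chi> (fst e, b2) = {}}" for b2
  define S where "S = fst ` {e \<in> M. (a, snd e) \<in> F}"
  define T where "T = {b2 \<in> snd ` M. r \<le> card (Z b2)}"
  have finM: "finite M" using M(1) finite_A finite_B finite_subset by blast
  have SA: "S \<subseteq> A" using M(1) by (auto simp: S_def)
  have TB: "T \<subseteq> B" using M(1) by (auto simp: T_def)
  have cov: "card (snd ` M) = card M" by (rule card_image[OF M(3)])
  have uncov: "real (card (B - snd ` M)) = real n - card M"
  proof -
    have "snd ` M \<subseteq> B" using M(1) by auto
    then have "card (B - snd ` M) = n - card M" "card M \<le> n"
      using finite_B card_B cov card_mono[OF finite_B, of "snd ` M"]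
      by (auto simp: card_Diff_subset finite_subset)
    then show ?thesis by simp
  qed
  have cardS: "s \<le> card S"
  proof -
    let ?N = "{b. (a, b) \<in> F}"
    have NB: "?N \<subseteq> B" using F G_sub by auto
    have "card S = card {e \<in> M. (a, snd e) \<in> F}"
      unfolding S_def by (rule card_image) (use M(2) in \<open>auto simp: inj_on_def\<close>)
    also have "\<dots> = card (snd ` {e \<in> M. (a, snd e) \<in> F})"
      by (rule card_image[symmetric]) (use M(3) in \<open>auto simp: inj_on_def\<close>)
    also have "snd ` {e \<in> M. (a, snd e) \<in> F} = ?N \<inter> snd ` M" by force
    finally have 1: "card S = card (?N \<inter> snd ` M)" .
    have "?N \<subseteq> (?N \<inter> snd ` M) \<union> (B - snd ` M)" using NB by blast
    then have "card ?N \<le> card ((?N \<inter> snd ` M) \<union> (B - snd ` M))"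
      using finM finite_B by (intro card_mono) auto
    also have "\<dots> \<le> card (?N \<inter> snd ` M) + card (B - snd ` M)" by (rule card_Un_le)
    finally show ?thesis using deg uncov 1 by linarith
  qed
  have "\<tau> \<le> card T"
  proof (rule ccontr)
    assume "\<not> \<tau> \<le> card T"
    then have "\<beta> \<le> card (F \<inter> S \<times> (B - T))" by (intro expand SA TB cardS) auto
    also have "\<dots> \<le> real n * r + (real n - card M) * n + t * n"
    proof -
      have "\<exists>g. \<forall>a1\<in>S. (a1, g a1) \<in> M \<and> (a, g a1) \<in> F"
        by (rule bchoice) (auto simp: S_def)
      then obtain g where g: "\<And>a1. a1 \<in> S \<Longrightarrow> (a1, g a1) \<in> M \<and> (a, g a1) \<in> F" by blast
      \<comment> \<open>An edge from \<open>S\<close> to \<open>B - T\<close> completes a route to a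
        covered vertex outside \<open>T\<close> (\<open>U1\<close>, fewer than \<open>r\<close> per
        vertex), or ends in an uncovered vertex (\<open>U2\<close>), or clashes in colour with the
        edge that leads from \<open>a\<close> to its start (\<open>U3\<close>, at most
        \<open>t\<close> per vertex of \<open>S\<close>).\<close>
      define U1 where "U1 = (\<Union>b2\<in>snd ` M - T. (\<lambda>e. (fst e, b2)) ` Z b2)"
      define U2 where "U2 = A \<times> (B - snd ` M)"
      define U3 where "U3 = (\<Union>a1\<in>S. Pair a1 ` {b2. (a1, b2) \<in> G \<and> \<chi> (a1, b2) \<inter> \<chi> (a, g a1) \<noteq> {}})"
      have "F \<inter> S \<times> (B - T) \<subseteq> U1 \<union> U2 \<union> U3"
      proof
        fix e assume e: "e \<in> F \<inter> S \<times> (B - T)"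
        obtain a1 b2 where e_eq: "e = (a1, b2)" by force
        show "e \<in> U1 \<union> U2 \<union> U3"
        proof (cases "b2 \<in> snd ` M \<and> \<chi> (a1, b2) \<inter> \<chi> (a, g a1) = {}")
          case True
          then have "(a1, g a1) \<in> Z b2" using e g[of a1] by (auto simp: e_eq Z_def)
          then have "e \<in> (\<lambda>e. (fst e, b2)) ` Z b2" by (force simp: e_eq)
          then show ?thesis using e True by (auto simp: e_eq U1_def)
        next
          case False
          then consider "b2 \<notin> snd ` M" | "\<chi> (a1, b2) \<inter> \<chi> (a, g a1) \<noteq> {}" by blast
          then show ?thesis
          proof cases
            case 1
            then show ?thesis using e SA by (auto simp: e_eq U2_def)
          next
            case 2
            then have "e \<in> Pair a1 ` {b2. (a1, b2) \<in> G \<and> \<chi> (a1, b2) \<inter> \<chi> (a, g a1) \<noteq> {}}"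
              using e F by (auto simp: e_eq)
            then show ?thesis using e by (auto simp: e_eq U3_def)
          qed
        qed
      qed
      moreover have finU: "finite U1" "finite U2" "finite U3"
      proof -
        have fin: "finite (A \<times> B)" using finite_A finite_B by simp
        have "U1 \<subseteq> A \<times> B" using M(1) by (auto simp: U1_def Z_def)
        then show "finite U1" using fin by (rule finite_subset)
        have "U3 \<subseteq> A \<times> B" using G_sub by (auto simp: U3_def)
        then show "finite U3" using fin by (rule finite_subset)
        show "finite U2" using finite_A finite_B by (simp add: U2_def)
      qed
      ultimately have "card (F \<inter> S \<times> (B - T)) \<le> card (U1 \<union> U2 \<union> U3)"
        by (intro card_mono) auto
      also have "\<dots> \<le> card (U1 \<union> U2) + card U3" by (rule card_Un_le)
      also have "\<dots> \<le> card U1 + card U2 + card U3" using card_Un_le by (intro add_right_mono)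
      finally have le: "card (F \<inter> S \<times> (B - T)) \<le> card U1 + card U2 + card U3" .
      have U1: "real (card U1) \<le> real n * r"
      proof -
        have "card U1 \<le> (\<Sum>b2\<in>snd ` M - T. card ((\<lambda>e. (fst e, b2)) ` Z b2))"
          unfolding U1_def using finM by (intro card_UN_le) auto
        then have "real (card U1) \<le> (\<Sum>b2\<in>snd ` M - T. real (card ((\<lambda>e. (fst e, b2)) ` Z b2)))"
          unfolding of_nat_sum[symmetric] by (simp only: of_nat_le_iff)
        also have "\<dots> \<le> (\<Sum>b2\<in>snd ` M - T. r)"
        proof (rule sum_mono)
          fix b2 assume "b2 \<in> snd ` M - T"
          then have "card (Z b2) < r" by (auto simp: T_def)
          moreover have "card ((\<lambda>e. (fst e, b2)) ` Z b2) \<le> card (Z b2)"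
            using finM by (intro card_image_le) (simp add: Z_def)
          ultimately show "real (card ((\<lambda>e. (fst e, b2)) ` Z b2)) \<le> r" by linarith
        qed
        also have "\<dots> \<le> real n * r"
        proof -
          have "snd ` M - T \<subseteq> B" using M(1) by auto
          then have "card (snd ` M - T) \<le> n" using card_mono[OF finite_B, of "snd ` M - T"] card_B by simp
          then show ?thesis using r by (simp add: mult_right_mono)
        qed
        finally show ?thesis .
      qed
      have U2: "real (card U2) = (real n - card M) * n"
        using uncov by (simp add: U2_def card_cartesian_product card_A)
      have U3: "card U3 \<le> t * n"
      proof -
        have finS: "finite S" by (rule finite_subset[OF SA finite_A])
        have "card U3 \<le> (\<Sum>a1\<in>S. card (Pair a1 ` {b2. (a1, b2) \<in> G \<and> \<chi> (a1, b2) \<inter> \<chi> (a, g a1) \<noteq> {}}))"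
          unfolding U3_def by (rule card_UN_le[OF finS])
        also have "\<dots> \<le> (\<Sum>a1\<in>S. t)"
        proof (rule sum_mono)
          fix a1 assume a1: "a1 \<in> S"
          then have inG: "(a, g a1) \<in> G" using g F by blast
          have "card (Pair a1 ` {b2. (a1, b2) \<in> G \<and> \<chi> (a1, b2) \<inter> \<chi> (a, g a1) \<noteq> {}})
              = card {b2. (a1, b2) \<in> G \<and> \<chi> (a1, b2) \<inter> \<chi> (a, g a1) \<noteq> {}}"
            by (rule card_image) (auto simp: inj_on_def)
          also have "\<dots> \<le> card (\<chi> (a, g a1))"
            by (rule card_meeting_colours_at[OF finite_colours[OF inG]])
          also have "\<dots> = t" by (rule card_colours[OF inG])
          finally show "card (Pair a1 ` {b2. (a1, b2) \<in> G \<and> \<chi> (a1, b2) \<inter> \<chi> (a, g a1) \<noteq> {}}) \<le> t" .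
        qed
        also have "\<dots> \<le> t * n" using card_mono[OF finite_A SA] card_A by simp
        finally show ?thesis .
      qed
      have "real (card (F \<inter> S \<times> (B - T))) \<le> card U1 + card U2 + card U3" using le by linarith
      moreover have "real (card U3) \<le> t * n" using U3 by (simp only: of_nat_mult[symmetric] of_nat_le_iff)
      ultimately show ?thesis using U1 U2 by linarith
    qed
    finally show False using \<beta> by linarith
  qed
  moreover have "T \<subseteq> snd ` M" by (auto simp: T_def)
  moreover have Z_large: "r \<le> card (Z b2)" if "b2 \<in> T" for b2 using that by (simp add: T_def)
  ultimately show ?thesis using that[of T] Z_large[unfolded Z_def] by blast
qed

text \<open>By properness, the colours in \<open>X\<close> exclude at most \<open>card X\<close> of
  the candidates through the edge at \<open>a\<close> and at most as many through the edge at
  \<open>b2\<close>; \<open>Y\<close> holds the matching edges that must not be reused.\<close>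

lemma avoiding_step:
  assumes F: "F \<subseteq> G" and M: "inj_on fst M" "inj_on snd M" "finite M"
    and r: "r \<le> real (card {e \<in> M. (a, snd e) \<in> F \<and> (fst e, b2) \<in> F \<and> \<chi> (a, snd e) \<inter> \<chi> (fst e, b2) = {}})"
    and X: "finite X" and Y: "finite Y" and large: "2 * real (card X) + real (card Y) < r"
  obtains a1 b1 where "(a1, b1) \<in> M" "(a1, b1) \<notin> Y" "(a, b1) \<in> F" "(a1, b2) \<in> F"
    "\<chi> (a, b1) \<inter> \<chi> (a1, b2) = {}" "\<chi> (a, b1) \<inter> X = {}" "\<chi> (a1, b2) \<inter> X = {}"
proof -
  interpret conv: proper_pairs B A "G\<inverse>" "\<lambda>e. \<chi> (prod.swap e)" t n by (rule converse_proper_pairs)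
  define Z where "Z = {e \<in> M. (a, snd e) \<in> F \<and> (fst e, b2) \<in> F \<and> \<chi> (a, snd e) \<inter> \<chi> (fst e, b2) = {}}"
  define Z1 where "Z1 = {e \<in> Z. \<chi> (a, snd e) \<inter> X \<noteq> {}}"
  define Z2 where "Z2 = {e \<in> Z. \<chi> (fst e, b2) \<inter> X \<noteq> {}}"
  have fin: "finite Z" "finite Z1" "finite Z2" using M(3) by (auto simp: Z_def Z1_def Z2_def)
  have Z1: "card Z1 \<le> card X"
  proof -
    have "card Z1 = card (snd ` Z1)"
      by (rule card_image[symmetric]) (use M(2) in \<open>auto simp: inj_on_def Z1_def Z_def\<close>)
    also have "\<dots> \<le> card {b. (a, b) \<in> G \<and> \<chi> (a, b) \<inter> X \<noteq> {}}"
    proof (rule card_mono)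
      show "finite {b. (a, b) \<in> G \<and> \<chi> (a, b) \<inter> X \<noteq> {}}"
        by (rule finite_subset[OF _ finite_B]) (use G_sub in auto)
    qed (use F in \<open>auto simp: Z1_def Z_def\<close>)
    also have "\<dots> \<le> card X" by (rule card_meeting_colours_at[OF X])
    finally show ?thesis .
  qed
  have Z2: "card Z2 \<le> card X"
  proof -
    have "card Z2 = card (fst ` Z2)"
      by (rule card_image[symmetric]) (use M(1) in \<open>auto simp: inj_on_def Z2_def Z_def\<close>)
    also have "\<dots> \<le> card {a1. (b2, a1) \<in> G\<inverse> \<and> \<chi> (prod.swap (b2, a1)) \<inter> X \<noteq> {}}"
    proof (rule card_mono)
      show "finite {a1. (b2, a1) \<in> G\<inverse> \<and> \<chi> (prod.swap (b2, a1)) \<inter> X \<noteq> {}}"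
        by (rule finite_subset[OF _ finite_A]) (use G_sub in auto)
    qed (use F in \<open>auto simp: Z2_def Z_def\<close>)
    also have "\<dots> \<le> card X" by (rule conv.card_meeting_colours_at[OF X])
    finally show ?thesis .
  qed
  have "\<not> Z \<subseteq> Z1 \<union> Z2 \<union> Y"
  proof
    assume "Z \<subseteq> Z1 \<union> Z2 \<union> Y"
    then have "card Z \<le> card (Z1 \<union> Z2 \<union> Y)" using fin Y by (intro card_mono) auto
    also have "\<dots> \<le> card Z1 + card Z2 + card Y"
      using card_Un_le[of "Z1 \<union> Z2" Y] card_Un_le[of Z1 Z2] by linarith
    finally show False using r large Z1 Z2 unfolding Z_def[symmetric] by linarith
  qed
  then obtain e where "e \<in> Z" "e \<notin> Z1" "e \<notin> Z2" "e \<notin> Y" by blast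
  then show ?thesis by (intro that[of "fst e" "snd e"]) (auto simp: Z_def Z1_def Z2_def)
qed

definition rainbow_pairs :: "('a \<times> 'b) set \<Rightarrow> bool" where
  "rainbow_pairs M \<longleftrightarrow> M \<subseteq> G \<and>
    (\<forall>e\<in>M. \<forall>f\<in>M. e \<noteq> f \<longrightarrow> fst e \<noteq> fst f \<and> snd e \<noteq> snd f \<and> \<chi> e \<inter> \<chi> f = {})"

lemma rainbow_pairs_inj: "rainbow_pairs M \<Longrightarrow> inj_on fst M" "rainbow_pairs M \<Longrightarrow> inj_on snd M"
  unfolding rainbow_pairs_def inj_on_def by blast+

lemma rainbow_pairs_subset: "rainbow_pairs M \<Longrightarrow> N \<subseteq> M \<Longrightarrow> rainbow_pairs N"
  unfolding rainbow_pairs_def by blast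

lemma rainbow_pairs_insert:
  assumes "rainbow_pairs M" "(a, b) \<in> G" "a \<notin> fst ` M" "b \<notin> snd ` M" "\<And>f. f \<in> M \<Longrightarrow> \<chi> (a, b) \<inter> \<chi> f = {}"
  shows "rainbow_pairs (insert (a, b) M)"
  unfolding rainbow_pairs_def
proof (intro conjI ballI impI)
  show "insert (a, b) M \<subseteq> G" using assms by (auto simp: rainbow_pairs_def)
  fix e f assume "e \<in> insert (a, b) M" "f \<in> insert (a, b) M" "e \<noteq> f"
  then consider "e \<in> M" "f \<in> M" | "e = (a, b)" "f \<in> M" | "f = (a, b)" "e \<in> M" by blast
  then have "fst e \<noteq> fst f \<and> snd e \<noteq> snd f \<and> \<chi> e \<inter> \<chi> f = {}"
  proof cases
    case 1
    then show ?thesis using assms(1) \<open>e \<noteq> f\<close> unfolding rainbow_pairs_def by blast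
  next
    case 2
    then show ?thesis using assms(3,4) assms(5)[of f] by force
  next
    case 3
    then show ?thesis using assms(3,4) assms(5)[of e] by force
  qed
  then show "fst e \<noteq> fst f" "snd e \<noteq> snd f" "\<chi> e \<inter> \<chi> f = {}" by blast+
qed

text \<open>The middle edge is fixed before the two halves of the path, which are then chosen one
  after the other so as to avoid everything in use. The bound \<open>6 * t + 3\<close> belongs to
  the second half: it avoids the colours of three edges, at most \<open>3 * t\<close> and each
  counted twice by \<open>avoiding_step\<close>, and three matching edges.\<close>

lemma augment:
  fixes s r \<tau> \<beta> :: real
  assumes t: "t \<ge> 1" and M: "rainbow_pairs M" and F: "F \<subseteq> G"
    and fresh: "\<And>e f. e \<in> F \<Longrightarrow> f \<in> M \<Longrightarrow> \<chi> e \<inter> \<chi> f = {}"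
    and less: "card M < n"
    and degA: "\<And>a. a \<in> A \<Longrightarrow> s \<le> real (card {b. (a, b) \<in> F}) - (real n - real (card M))"
    and degB: "\<And>b. b \<in> B \<Longrightarrow> s \<le> real (card {a. (a, b) \<in> F}) - (real n - real (card M))"
    and expandA: "\<And>S T. S \<subseteq> A \<Longrightarrow> T \<subseteq> B \<Longrightarrow> s \<le> card S \<Longrightarrow> card T < \<tau> \<Longrightarrow>
      \<beta> \<le> card (F \<inter> S \<times> (B - T))"
    and expandB: "\<And>S T. S \<subseteq> A \<Longrightarrow> T \<subseteq> B \<Longrightarrow> s \<le> card T \<Longrightarrow> card S < \<tau> \<Longrightarrow>
      \<beta> \<le> card (F \<inter> (A - S) \<times> T)"
    and dense: "\<And>S T. S \<subseteq> A \<Longrightarrow> T \<subseteq> B \<Longrightarrow> \<tau> \<le> card S \<Longrightarrow> \<tau> \<le> card T \<Longrightarrow> F \<inter> S \<times> T \<noteq> {}"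
    and \<beta>: "real n * r + (real n - real (card M)) * n + t * n < \<beta>" and r: "r > 6 * t + 3"
  obtains M' N where "rainbow_pairs M'" "card M' = card M + 1" "N \<subseteq> F" "card N \<le> 5" "finite N"
    "M' \<subseteq> M \<union> N"
proof -
  interpret conv: proper_pairs B A "G\<inverse>" "\<lambda>e. \<chi> (prod.swap e)" t n by (rule converse_proper_pairs)
  have MG: "M \<subseteq> G" using M by (simp add: rainbow_pairs_def)
  have finM: "finite M" using MG finite_G finite_subset by blast
  note inj = rainbow_pairs_inj[OF M]
  have "card (fst ` M) < card A" "card (snd ` M) < card B"
    using less card_image[OF inj(1)] card_image[OF inj(2)] card_A card_B by simp_all
  then have "\<not> A \<subseteq> fst ` M" "\<not> B \<subseteq> snd ` M"
    using card_mono[of "fst ` M" A] card_mono[of "snd ` M" B] finM by auto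
  then obtain a b where ab: "a \<in> A" "a \<notin> fst ` M" "b \<in> B" "b \<notin> snd ` M" by blast
  have r0: "r \<ge> 0" using r by simp
  have MAB: "M \<subseteq> A \<times> B" using MG G_sub by blast
  obtain T where T: "T \<subseteq> snd ` M" "\<tau> \<le> card T" and
    T_reach: "\<And>b2. b2 \<in> T \<Longrightarrow> r \<le> card {e \<in> M. (a, snd e) \<in> F \<and> (fst e, b2) \<in> F \<and> \<chi> (a, snd e) \<inter> \<chi> (fst e, b2) = {}}"
    using robust_reach[OF F MAB inj degA[OF ab(1)] expandA \<beta> r0] by blast
  have card_conv: "card (M\<inverse>) = card M" by simp
  have unique: "x = x' \<longleftrightarrow> y = y'" if "(x, y) \<in> M" "(x', y') \<in> M" for x y x' y'
    using inj_onD[OF inj(1) _ that] inj_onD[OF inj(2) _ that] by auto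
  have conv_inj: "inj_on fst (M\<inverse>)" "inj_on snd (M\<inverse>)"
  proof -
    have "e = f" if "e \<in> M\<inverse>" "f \<in> M\<inverse>" "fst e = fst f \<or> snd e = snd f" for e f
    proof -
      have "(snd e, fst e) \<in> M" "(snd f, fst f) \<in> M" using that by auto
      then show ?thesis using unique[of "snd e" "fst e" "snd f" "fst f"] that(3) by (simp add: prod_eq_iff)
    qed
    then show "inj_on fst (M\<inverse>)" "inj_on snd (M\<inverse>)" by (auto intro!: inj_onI)
  qed
  have conv_expand: "\<beta> \<le> card (F\<inverse> \<inter> T \<times> (A - S))"
    if "T \<subseteq> B" "S \<subseteq> A" "s \<le> card T" "card S < \<tau>" for S T
  proof -
    have "F\<inverse> \<inter> T \<times> (A - S) = (F \<inter> (A - S) \<times> T)\<inverse>" by blast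
    then show ?thesis using expandB[OF that(2,1,3,4)] by simp
  qed
  have conv_deg: "s \<le> real (card {a. (b, a) \<in> F\<inverse>}) - (real n - real (card (M\<inverse>)))"
    using degB[OF ab(3)] by simp
  obtain T' where T': "T' \<subseteq> snd ` (M\<inverse>)" "\<tau> \<le> card T'" and
    T'_reach: "\<And>a3. a3 \<in> T' \<Longrightarrow> r \<le> card {e \<in> M\<inverse>. (b, snd e) \<in> F\<inverse> \<and> (fst e, a3) \<in> F\<inverse> \<and>
      \<chi> (prod.swap (b, snd e)) \<inter> \<chi> (prod.swap (fst e, a3)) = {}}"
    using conv.robust_reach[of "F\<inverse>" "M\<inverse>" s b \<tau> \<beta> r, OF _ _ conv_inj conv_deg conv_expand _ r0]
      F MAB \<beta> by (auto simp: card_conv)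
  \<comment> \<open>Crossing the matching: \<open>S2\<close> holds the partners of vertices reached
    from \<open>a\<close>, and \<open>T2\<close> those of vertices reached from
    \<open>b\<close>.\<close>
  define S2 where "S2 = fst ` {e \<in> M. snd e \<in> T}"
  define T2 where "T2 = snd ` {e \<in> M. fst e \<in> T'}"
  have "card S2 = card {e \<in> M. snd e \<in> T}"
    unfolding S2_def by (rule card_image) (use inj in \<open>auto simp: inj_on_def\<close>)
  also have "\<dots> = card (snd ` {e \<in> M. snd e \<in> T})"
    by (rule card_image[symmetric]) (use inj in \<open>auto simp: inj_on_def\<close>)
  also have "snd ` {e \<in> M. snd e \<in> T} = T" using T(1) by auto
  finally have S2: "\<tau> \<le> card S2" using T by simp
  have "card T2 = card {e \<in> M. fst e \<in> T'}"
    unfolding T2_def by (rule card_image) (use inj in \<open>auto simp: inj_on_def\<close>)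
  also have "\<dots> = card (fst ` {e \<in> M. fst e \<in> T'})"
    by (rule card_image[symmetric]) (use inj in \<open>auto simp: inj_on_def\<close>)
  also have "fst ` {e \<in> M. fst e \<in> T'} = T'" using T'(1) by force
  finally have T2: "\<tau> \<le> card T2" using T' by simp
  have "S2 \<subseteq> A" "T2 \<subseteq> B" using MAB by (auto simp: S2_def T2_def)
  then obtain a2 b3 where e3: "(a2, b3) \<in> F" "a2 \<in> S2" "b3 \<in> T2" using dense S2 T2 by blast
  obtain b2 where b2: "(a2, b2) \<in> M" "b2 \<in> T" using e3(2) by (auto simp: S2_def)
  obtain a3 where a3: "(a3, b3) \<in> M" "a3 \<in> T'" using e3(3) by (auto simp: T2_def)
  have card_F: "finite (\<chi> e)" "card (\<chi> e) = t" if "e \<in> F" for e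
    using that F finite_colours card_colours by blast+
  \<comment> \<open>A colour set of size \<open>t \<ge> 1\<close> is not disjoint from itself, so
    freshness separates \<open>F\<close> from \<open>M\<close>.\<close>
  have FM: "e \<notin> M" if "e \<in> F" for e
    using fresh[OF that] card_F[OF that] t by (metis Int_absorb card.empty not_one_le_zero)
  obtain a1 b1 where e1: "(a1, b1) \<in> M" "(a1, b1) \<notin> {(a2, b2), (a3, b3)}" "(a, b1) \<in> F" "(a1, b2) \<in> F"
    "\<chi> (a, b1) \<inter> \<chi> (a1, b2) = {}" "\<chi> (a, b1) \<inter> \<chi> (a2, b3) = {}" "\<chi> (a1, b2) \<inter> \<chi> (a2, b3) = {}"
  proof (rule avoiding_step[OF F inj finM T_reach[OF b2(2)]])
    show "2 * real (card (\<chi> (a2, b3))) + real (card {(a2, b2), (a3, b3)}) < r"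
    proof -
      have "card {(a2, b2), (a3, b3)} \<le> 2" by (simp add: card_insert_if)
      then show ?thesis using card_F[OF e3(1)] r by simp
    qed
  qed (use card_F e3 in auto)
  define X where "X = \<chi> (a2, b3) \<union> \<chi> (a, b1) \<union> \<chi> (a1, b2)"
  have X: "finite X" "card X \<le> 3 * t"
  proof -
    show "finite X" using card_F e3(1) e1(3,4) by (simp add: X_def)
    have "card X \<le> card (\<chi> (a2, b3)) + card (\<chi> (a, b1)) + card (\<chi> (a1, b2))"
      unfolding X_def using card_Un_le[of "\<chi> (a2, b3) \<union> \<chi> (a, b1)" "\<chi> (a1, b2)"]
        card_Un_le[of "\<chi> (a2, b3)" "\<chi> (a, b1)"] by linarith
    then show "card X \<le> 3 * t" using card_F e3(1) e1(3,4) by simp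
  qed
  \<comment> \<open>The pairs are reversed because the second half is found in the converse
    graph.\<close>
  define Y where "Y = {(b1, a1), (b2, a2), (b3, a3)}"
  have Y: "finite Y" "card Y \<le> 3" by (auto simp: Y_def card_insert_if)
  obtain b4 a4 where e4: "(b4, a4) \<in> M\<inverse>" "(b4, a4) \<notin> Y" "(b, a4) \<in> F\<inverse>" "(b4, a3) \<in> F\<inverse>"
    "\<chi> (prod.swap (b, a4)) \<inter> \<chi> (prod.swap (b4, a3)) = {}" "\<chi> (prod.swap (b, a4)) \<inter> X = {}"
    "\<chi> (prod.swap (b4, a3)) \<inter> X = {}"
  proof (rule conv.avoiding_step[of "F\<inverse>" "M\<inverse>", OF _ conv_inj _ T'_reach[OF a3(2)] X(1) Y(1)])
    have "real (card X) \<le> 3 * t" "real (card Y) \<le> 3" using X Y by simp_all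
    then show "2 * real (card X) + real (card Y) < r" using r by linarith
  qed (use F finM in auto)

  have m4: "(a4, b4) \<in> M" using e4 by simp
  \<comment> \<open>Otherwise the middle edge would be the matching edge at
    \<open>b3\<close>.\<close>
  have distinct23: "a2 \<noteq> a3"
    using FM[OF e3(1)] a3(1) by blast
  have distinctA: "a1 \<noteq> a2" "a1 \<noteq> a3" "a4 \<noteq> a1" "a4 \<noteq> a2" "a4 \<noteq> a3"
    using unique[OF e1(1) b2(1)] unique[OF e1(1) a3(1)] unique[OF m4 e1(1)]
      unique[OF m4 b2(1)] unique[OF m4 a3(1)] e1(2) e4(2) by (auto simp: Y_def)
  have distinctB: "b1 \<noteq> b2" "b1 \<noteq> b3" "b4 \<noteq> b1" "b4 \<noteq> b2" "b4 \<noteq> b3" "b2 \<noteq> b3"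
    using unique[OF e1(1) b2(1)] unique[OF e1(1) a3(1)] unique[OF m4 e1(1)] unique[OF m4 b2(1)]
      unique[OF m4 a3(1)] unique[OF b2(1) a3(1)] distinctA distinct23 by simp_all
  have newA: "a \<noteq> a1" "a \<noteq> a2" "a \<noteq> a3" "a \<noteq> a4" using ab(2) e1(1) b2(1) a3(1) m4 by force+
  have newB: "b \<noteq> b1" "b \<noteq> b2" "b \<noteq> b3" "b \<noteq> b4" using ab(4) e1(1) b2(1) a3(1) m4 by force+
  define M0 where "M0 = M - {(a1, b1), (a2, b2), (a3, b3), (a4, b4)}"
  have M0: "rainbow_pairs M0" by (rule rainbow_pairs_subset[OF M]) (auto simp: M0_def)
  have removed: "x \<notin> fst ` M0 \<and> y \<notin> snd ` M0" if "(x, y) \<in> M" "(x, y) \<notin> M0" for x y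
  proof -
    have "x \<noteq> x' \<and> y \<noteq> y'" if "(x', y') \<in> M0" for x' y'
    proof -
      have "(x', y') \<in> M" "(x, y) \<noteq> (x', y')" using that \<open>(x, y) \<notin> M0\<close> by (auto simp: M0_def)
      then show ?thesis using unique[OF \<open>(x, y) \<in> M\<close> \<open>(x', y') \<in> M\<close>] by blast
    qed
    then show ?thesis by force
  qed
  have M0_fst: "a \<notin> fst ` M0" "a1 \<notin> fst ` M0" "a2 \<notin> fst ` M0" "a3 \<notin> fst ` M0" "a4 \<notin> fst ` M0"
    using ab(2) removed[OF e1(1)] removed[OF b2(1)] removed[OF a3(1)] removed[OF m4]
    by (auto simp: M0_def)
  have M0_snd: "b \<notin> snd ` M0" "b1 \<notin> snd ` M0" "b2 \<notin> snd ` M0" "b3 \<notin> snd ` M0" "b4 \<notin> snd ` M0"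
    using ab(4) removed[OF e1(1)] removed[OF b2(1)] removed[OF a3(1)] removed[OF m4]
    by (auto simp: M0_def)
  have F_edges: "(a, b1) \<in> F" "(a1, b2) \<in> F" "(a2, b3) \<in> F" "(a3, b4) \<in> F" "(a4, b) \<in> F"
    using e1 e3 e4 by auto
  have fresh0: "\<chi> e \<inter> \<chi> f = {}" if "e \<in> F" "f \<in> M0" for e f
    using fresh that by (auto simp: M0_def)
  have cols: "\<chi> (a, b1) \<inter> \<chi> (a1, b2) = {}" "\<chi> (a2, b3) \<inter> \<chi> (a, b1) = {}" "\<chi> (a2, b3) \<inter> \<chi> (a1, b2) = {}"
    "\<chi> (a3, b4) \<inter> \<chi> (a, b1) = {}" "\<chi> (a3, b4) \<inter> \<chi> (a1, b2) = {}" "\<chi> (a3, b4) \<inter> \<chi> (a2, b3) = {}"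
    "\<chi> (a4, b) \<inter> \<chi> (a, b1) = {}" "\<chi> (a4, b) \<inter> \<chi> (a1, b2) = {}" "\<chi> (a4, b) \<inter> \<chi> (a2, b3) = {}"
    "\<chi> (a4, b) \<inter> \<chi> (a3, b4) = {}"
    using e1(5-7) e4(5-7) by (auto simp: X_def)
  define M1 where "M1 = insert (a1, b2) M0"
  define M2 where "M2 = insert (a, b1) M1"
  define M3 where "M3 = insert (a2, b3) M2"
  define M4 where "M4 = insert (a3, b4) M3"
  define M5 where "M5 = insert (a4, b) M4"
  have inG: "(a, b1) \<in> G" "(a1, b2) \<in> G" "(a2, b3) \<in> G" "(a3, b4) \<in> G" "(a4, b) \<in> G"
    using F_edges F by auto
  have "rainbow_pairs M1" unfolding M1_def
    by (rule rainbow_pairs_insert[OF M0]) (use inG M0_fst M0_snd fresh0 F_edges in auto)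
  then have "rainbow_pairs M2" unfolding M2_def
  proof (rule rainbow_pairs_insert)
    show "\<chi> (a, b1) \<inter> \<chi> f = {}" if "f \<in> M1" for f
      using that fresh0[OF F_edges(1), of f] cols by (auto simp: M1_def)
  qed (use inG M0_fst M0_snd newA distinctB in \<open>auto simp: M1_def\<close>)
  then have "rainbow_pairs M3" unfolding M3_def
  proof (rule rainbow_pairs_insert)
    show "\<chi> (a2, b3) \<inter> \<chi> f = {}" if "f \<in> M2" for f
      using that fresh0[OF F_edges(3), of f] cols by (auto simp: M1_def M2_def)
  qed (use inG M0_fst M0_snd newA distinctA distinctB in \<open>auto simp: M1_def M2_def\<close>)
  then have "rainbow_pairs M4" unfolding M4_def
  proof (rule rainbow_pairs_insert)
    show "\<chi> (a3, b4) \<inter> \<chi> f = {}" if "f \<in> M3" for f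
      using that fresh0[OF F_edges(4), of f] cols by (auto simp: M1_def M2_def M3_def)
  qed (use inG M0_fst M0_snd newA distinct23 distinctA distinctB in
      \<open>auto simp: M1_def M2_def M3_def\<close>)
  then have M5: "rainbow_pairs M5" unfolding M5_def
  proof (rule rainbow_pairs_insert)
    show "\<chi> (a4, b) \<inter> \<chi> f = {}" if "f \<in> M4" for f
      using that fresh0[OF F_edges(5), of f] cols by (auto simp: M1_def M2_def M3_def M4_def)
  qed (use inG M0_fst M0_snd newA newB distinctA distinctB in
      \<open>auto simp: M1_def M2_def M3_def M4_def\<close>)
  show ?thesis
  proof (rule that[OF M5])
    let ?N = "{(a, b1), (a1, b2), (a2, b3), (a3, b4), (a4, b)}"
    show "?N \<subseteq> F" using F_edges by blast
    show "finite ?N" by simp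
    show "card ?N \<le> 5" by (simp add: card_insert_if)
    show "M5 \<subseteq> M \<union> ?N" by (auto simp: M0_def M1_def M2_def M3_def M4_def M5_def)
    have "card M0 = card M - 4"
      unfolding M0_def using e1(1) b2(1) a3(1) m4 distinct23 distinctA
      by (subst card_Diff_subset) auto
    moreover have "4 \<le> card M"
    proof -
      have "card {(a1, b1), (a2, b2), (a3, b3), (a4, b4)} \<le> card M"
        using e1(1) b2(1) a3(1) m4 by (intro card_mono finM) auto
      then show ?thesis using distinct23 distinctA by simp
    qed
    moreover have "card M5 = card M0 + 5"
    proof -
      have "finite M0" using finM by (simp add: M0_def)
      moreover have "(a, b1) \<notin> M0" "(a1, b2) \<notin> M0" "(a2, b3) \<notin> M0" "(a3, b4) \<notin> M0" "(a4, b) \<notin> M0"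
        using M0_fst by force+
      ultimately show ?thesis
        unfolding M5_def M4_def M3_def M2_def M1_def
        using newA distinct23 distinctA by simp
    qed
    ultimately show "card M5 = card M + 1" by simp
  qed
qed

text \<open>There are \<open>u\<close> augmentations, and each of them uses up at most \<open>5 t\<close> colours of \<open>R\<close>; in total this costs
  at most \<open>5 t u\<close> of every degree and \<open>5 t u n\<close> of every edge count.\<close>

lemma perfect_from_near_perfect:
  fixes s r \<tau> \<beta> :: real and R :: "'c set" and M0 :: "('a \<times> 'b) set"
  defines "GR \<equiv> {e \<in> G. \<chi> e \<subseteq> R}" and "u \<equiv> n - card M0"
  assumes t: "t \<ge> 1" and M0: "rainbow_pairs M0" "\<And>e. e \<in> M0 \<Longrightarrow> \<chi> e \<inter> R = {}"
    and degA: "\<And>a. a \<in> A \<Longrightarrow> s + real u + 5 * real t * real u \<le> real (card {b. (a, b) \<in> GR})"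
    and degB: "\<And>b. b \<in> B \<Longrightarrow> s + real u + 5 * real t * real u \<le> real (card {a. (a, b) \<in> GR})"
    and expandA: "\<And>S T. S \<subseteq> A \<Longrightarrow> T \<subseteq> B \<Longrightarrow> s \<le> card S \<Longrightarrow> card T < \<tau> \<Longrightarrow>
      \<beta> + 5 * real t * real u * real n \<le> card (GR \<inter> S \<times> (B - T))"
    and expandB: "\<And>S T. S \<subseteq> A \<Longrightarrow> T \<subseteq> B \<Longrightarrow> s \<le> card T \<Longrightarrow> card S < \<tau> \<Longrightarrow>
      \<beta> + 5 * real t * real u * real n \<le> card (GR \<inter> (A - S) \<times> T)"
    and dense: "\<And>S T. S \<subseteq> A \<Longrightarrow> T \<subseteq> B \<Longrightarrow> \<tau> \<le> card S \<Longrightarrow> \<tau> \<le> card T \<Longrightarrow>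
      5 * real t * real u * real n < card (GR \<inter> S \<times> T)"
    and \<beta>: "real n * r + real u * n + t * n < \<beta>" and r: "r > 6 * t + 3"
  shows "\<exists>M. rainbow_pairs M \<and> card M = n"
proof -
  interpret conv: proper_pairs B A "G\<inverse>" "\<lambda>e. \<chi> (prod.swap e)" t n by (rule converse_proper_pairs)
  have card_le: "card M \<le> n" if "rainbow_pairs M" for M
  proof -
    have "fst ` M \<subseteq> A" using that G_sub by (auto simp: rainbow_pairs_def)
    then show ?thesis using card_mono[OF finite_A] card_image[OF rainbow_pairs_inj(1)[OF that]] card_A by metis
  qed
  \<comment> \<open>Only the colours of \<open>R\<close> in use are tracked: \<open>M0\<close> uses
    none, the at most five new edges bring at most \<open>5 * t\<close>, and edges that leave bring
    none.\<close>
  have "j \<le> u \<Longrightarrow> \<exists>M. rainbow_pairs M \<and> card M = card M0 + j \<and> card (R \<inter> \<Union>(\<chi> ` M)) \<le> 5 * t * j" for j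
  proof (induction j)
    case 0
    have "R \<inter> \<Union>(\<chi> ` M0) = {}" using M0(2) by blast
    then show ?case using M0(1) by (intro exI[of _ M0]) simp
  next
    case (Suc j)
    then obtain M where M: "rainbow_pairs M" "card M = card M0 + j" "card (R \<inter> \<Union>(\<chi> ` M)) \<le> 5 * t * j"
      by (metis Suc_leD)
    define P where "P = R \<inter> \<Union>(\<chi> ` M)"
    define F where "F = {e \<in> GR. \<chi> e \<inter> P = {}}"
    have MG: "M \<subseteq> G" using M(1) by (simp add: rainbow_pairs_def)
    have P: "finite P" "real (card P) \<le> 5 * real t * real u"
    proof -
      have "P \<subseteq> C" using MG by (auto simp: P_def C_def)
      then show "finite P" using finite_C by (rule finite_subset)
      have "5 * t * j \<le> 5 * t * u" using Suc.prems by (intro mult_le_mono) auto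
      then have "card P \<le> 5 * t * u" using M(3) unfolding P_def by linarith
      then have "real (card P) \<le> real (5 * t * u)" by (simp only: of_nat_le_iff)
      then show "real (card P) \<le> 5 * real t * real u" by simp
    qed
    have GR: "GR \<subseteq> G" by (auto simp: GR_def)
    have finGR: "finite GR" using GR finite_G by (rule finite_subset)
    have FG: "F \<subseteq> G" using GR by (auto simp: F_def)
    have lost: "real (card (GR \<inter> Q)) - 5 * real t * real u * real n \<le> real (card (F \<inter> Q))" for Q
    proof -
      have "card (GR \<inter> Q) \<le> card ((F \<inter> Q) \<union> {e \<in> G. \<chi> e \<inter> P \<noteq> {}})"
        using finite_G finGR GR by (intro card_mono) (auto simp: F_def)
      also have "\<dots> \<le> card (F \<inter> Q) + card {e \<in> G. \<chi> e \<inter> P \<noteq> {}}" by (rule card_Un_le)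
      also have "\<dots> \<le> card (F \<inter> Q) + n * card P" using card_meeting_colours[OF P(1)] by simp
      finally have "real (card (GR \<inter> Q)) \<le> real (card (F \<inter> Q) + n * card P)" by (simp only: of_nat_le_iff)
      moreover have "real n * real (card P) \<le> real n * (5 * real t * real u)"
        using P(2) by (intro mult_left_mono) auto
      ultimately show ?thesis by (simp add: algebra_simps)
    qed
    have lostA: "real (card {b. (a, b) \<in> GR}) - 5 * real t * real u \<le> real (card {b. (a, b) \<in> F})" for a
    proof -
      have "card {b. (a, b) \<in> GR} \<le> card ({b. (a, b) \<in> F} \<union> {b. (a, b) \<in> G \<and> \<chi> (a, b) \<inter> P \<noteq> {}})"
      proof (rule card_mono)
        show "finite ({b. (a, b) \<in> F} \<union> {b. (a, b) \<in> G \<and> \<chi> (a, b) \<inter> P \<noteq> {}})"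
          by (rule finite_subset[OF _ finite_B]) (use FG G_sub in auto)
      qed (use GR in \<open>auto simp: F_def\<close>)
      also have "\<dots> \<le> card {b. (a, b) \<in> F} + card {b. (a, b) \<in> G \<and> \<chi> (a, b) \<inter> P \<noteq> {}}"
        by (rule card_Un_le)
      also have "\<dots> \<le> card {b. (a, b) \<in> F} + card P" using card_meeting_colours_at[OF P(1)] by simp
      finally show ?thesis using P(2) by linarith
    qed
    have lostB: "real (card {a. (a, b) \<in> GR}) - 5 * real t * real u \<le> real (card {a. (a, b) \<in> F})" for b
    proof -
      have "card {a. (a, b) \<in> GR} \<le> card ({a. (a, b) \<in> F} \<union> {a. (b, a) \<in> G\<inverse> \<and> \<chi> (prod.swap (b, a)) \<inter> P \<noteq> {}})"
      proof (rule card_mono)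
        show "finite ({a. (a, b) \<in> F} \<union> {a. (b, a) \<in> G\<inverse> \<and> \<chi> (prod.swap (b, a)) \<inter> P \<noteq> {}})"
          by (rule finite_subset[OF _ finite_A]) (use FG G_sub in auto)
      qed (use GR in \<open>auto simp: F_def\<close>)
      also have "\<dots> \<le> card {a. (a, b) \<in> F} + card {a. (b, a) \<in> G\<inverse> \<and> \<chi> (prod.swap (b, a)) \<inter> P \<noteq> {}}"
        by (rule card_Un_le)
      also have "\<dots> \<le> card {a. (a, b) \<in> F} + card P"
        by (rule add_left_mono) (rule conv.card_meeting_colours_at[OF P(1)])
      finally show ?thesis using P(2) by linarith
    qed
    have l: "real n - real (card M) \<le> real u" using M(2) by (simp add: u_def)
    obtain M' N where M': "rainbow_pairs M'" "card M' = card M + 1" "N \<subseteq> F" "card N \<le> 5" "finite N"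
      "M' \<subseteq> M \<union> N"
    proof (rule augment[OF t M(1) FG, of s \<tau> \<beta> r])
      show "\<chi> e \<inter> \<chi> f = {}" if "e \<in> F" "f \<in> M" for e f
        using that by (auto simp: F_def GR_def P_def)
      show "card M < n" using Suc.prems M(2) by (simp add: u_def)
      show "s \<le> real (card {b. (a, b) \<in> F}) - (real n - real (card M))" if "a \<in> A" for a
        using degA[OF that] lostA[of a] l by linarith
      show "s \<le> real (card {a. (a, b) \<in> F}) - (real n - real (card M))" if "b \<in> B" for b
        using degB[OF that] lostB[of b] l by linarith
      show "\<beta> \<le> card (F \<inter> S \<times> (B - T))" if "S \<subseteq> A" "T \<subseteq> B" "s \<le> card S" "card T < \<tau>" for S T
        using expandA[OF that] lost[of "S \<times> (B - T)"] by linarith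
      show "\<beta> \<le> card (F \<inter> (A - S) \<times> T)" if "S \<subseteq> A" "T \<subseteq> B" "s \<le> card T" "card S < \<tau>" for S T
        using expandB[OF that] lost[of "(A - S) \<times> T"] by linarith
      show "F \<inter> S \<times> T \<noteq> {}" if "S \<subseteq> A" "T \<subseteq> B" "\<tau> \<le> card S" "\<tau> \<le> card T" for S T
      proof
        assume "F \<inter> S \<times> T = {}"
        then show False using dense[OF that] lost[of "S \<times> T"] by simp
      qed
      have "(real n - real (card M)) * n \<le> real u * n" using l by (intro mult_right_mono) auto
      then show "real n * r + (real n - real (card M)) * n + t * n < \<beta>" using \<beta> by linarith
      show "r > 6 * t + 3" by (rule r)
    qed
    have "card (R \<inter> \<Union>(\<chi> ` M')) \<le> 5 * t * Suc j"
    proof -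
      have N: "finite (\<chi> e)" "card (\<chi> e) = t" if "e \<in> N" for e
        using that M'(3) FG finite_colours card_colours by blast+
      have "card (R \<inter> \<Union>(\<chi> ` M')) \<le> card (P \<union> \<Union>(\<chi> ` N))"
        using M'(5,6) N(1) P(1) by (intro card_mono) (auto simp: P_def)
      also have "\<dots> \<le> card P + card (\<Union>(\<chi> ` N))" by (rule card_Un_le)
      also have "card (\<Union>(\<chi> ` N)) \<le> (\<Sum>e\<in>N. card (\<chi> e))" by (rule card_UN_le[OF M'(5)])
      also have "\<dots> = card N * t" using N(2) by simp
      also have "\<dots> \<le> 5 * t" using M'(4) by (rule mult_le_mono1)
      finally show ?thesis using M(3) by (simp add: P_def)
    qed
    then show ?case using M'(1,2) M(2) by (intro exI[of _ M']) simp
  qed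
  from this[OF order_refl] obtain M where "rainbow_pairs M" "card M = card M0 + u" by blast
  then show ?thesis using card_le[OF M0(1)] by (auto simp: u_def)
qed

end

section \<open>A near-perfect rainbow matching without reserved colours\<close>

context proper_pairs
begin

text \<open>The disjoint sum keeps sides and colours apart, so two hyperedges are disjoint exactly
  when their edges share neither an end nor a colour.\<close>

definition hyperedge :: "'a \<times> 'b \<Rightarrow> ('a + 'b + 'c) set" where
  "hyperedge e = {Inl (fst e), Inr (Inl (snd e))} \<union> (\<lambda>c. Inr (Inr c)) ` \<chi> e"

lemma in_hyperedge:
  "Inl a \<in> hyperedge e \<longleftrightarrow> fst e = a" "Inr (Inl b) \<in> hyperedge e \<longleftrightarrow> snd e = b"
  "Inr (Inr c) \<in> hyperedge e \<longleftrightarrow> c \<in> \<chi> e"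
  by (auto simp: hyperedge_def)

lemma inj_hyperedge: "inj hyperedge"
proof (rule injI)
  fix e f assume "hyperedge e = hyperedge f"
  then have "Inl (fst e) \<in> hyperedge f" "Inr (Inl (snd e)) \<in> hyperedge f"
    by (metis in_hyperedge(1), metis in_hyperedge(2))
  then show "e = f" by (simp add: in_hyperedge prod_eq_iff)
qed

lemma sum_hyperedge: "(\<Sum>f\<in>hyperedge ` F. h f) = (\<Sum>e\<in>F. h (hyperedge e))"
  by (subst sum.reindex) (auto intro: inj_on_subset[OF inj_hyperedge])

text \<open>Two edges with a common end share no colour, by properness, and not the other end; two
  edges without a common end can share colours only, and at most one by \<open>lin\<close>.\<close>

lemma linear_hypergraph_hyperedge:
  assumes lin: "\<And>e f. e \<in> G \<Longrightarrow> f \<in> G \<Longrightarrow> e \<noteq> f \<Longrightarrow> card (\<chi> e \<inter> \<chi> f) \<le> 1"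
    and F: "F \<subseteq> G"
  shows "linear_hypergraph (hyperedge ` F) (t + 2)"
proof
  show "finite (hyperedge ` F)" using F finite_G finite_subset by blast
  show "1 \<le> t + 2" by simp
  fix x assume "x \<in> hyperedge ` F"
  then obtain e where e: "e \<in> F" "x = hyperedge e" by blast
  then have fin: "finite (\<chi> e)" "card (\<chi> e) = t" using F finite_colours card_colours by blast+
  then show "finite x" by (simp add: e hyperedge_def)
  have "card ((\<lambda>c. Inr (Inr c) :: 'a + 'b + 'c) ` \<chi> e) = t"
    using fin by (subst card_image) (auto simp: inj_on_def)
  then show "card x = t + 2"
    using fin unfolding e(2) hyperedge_def by (subst card_Un_disjoint) auto
  fix y assume "y \<in> hyperedge ` F" "x \<noteq> y"
  then obtain f where f: "f \<in> F" "y = hyperedge f" and ne: "e \<noteq> f" using e by blast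
  have eG: "e \<in> G" "f \<in> G" using e f F by auto
  show "card (x \<inter> y) \<le> 1"
  proof (cases "fst e = fst f \<or> snd e = snd f")
    case True
    then have "\<chi> e \<inter> \<chi> f = {}" using proper eG ne by blast
    moreover have "fst e \<noteq> fst f \<or> snd e \<noteq> snd f" using ne by (auto simp: prod_eq_iff)
    ultimately have "x \<inter> y \<subseteq> {Inl (fst e)} \<or> x \<inter> y \<subseteq> {Inr (Inl (snd e))}"
      by (auto simp: e f hyperedge_def)
    then show ?thesis using card_mono[of "{_}" "x \<inter> y"] by fastforce
  next
    case False
    then have "x \<inter> y = (\<lambda>c. Inr (Inr c)) ` (\<chi> e \<inter> \<chi> f)" by (auto simp: e f hyperedge_def)
    then show ?thesis using lin[OF eG ne] card_image_le[of "\<chi> e \<inter> \<chi> f"] fin by (auto intro: le_trans)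
  qed
qed

lemma wdeg_hyperedge:
  assumes F: "F \<subseteq> G"
  shows "wdeg (hyperedge ` F) (\<lambda>_. w) (Inl a) = w * real (card {b. (a, b) \<in> F})"
    and "wdeg (hyperedge ` F) (\<lambda>_. w) (Inr (Inl b)) = w * real (card {a. (a, b) \<in> F})"
    and "wdeg (hyperedge ` F) (\<lambda>_. w) (Inr (Inr c)) = w * real (card {e \<in> F. c \<in> \<chi> e})"
proof -
  have finF: "finite F" using F finite_G by (rule finite_subset)
  have count: "(\<Sum>e\<in>F. if Q e then w else 0) = w * real (card {e \<in> F. Q e})" for Q
    using finF by (simp add: sum.If_cases Int_def mult.commute)
  have "card {e \<in> F. fst e = a} = card {b. (a, b) \<in> F}"
    by (rule bij_betw_same_card[of snd]) (force simp: bij_betw_def inj_on_def)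
  then show "wdeg (hyperedge ` F) (\<lambda>_. w) (Inl a) = w * real (card {b. (a, b) \<in> F})"
    by (simp add: wdeg_def sum_hyperedge in_hyperedge count)
  have "card {e \<in> F. snd e = b} = card {a. (a, b) \<in> F}"
    by (rule bij_betw_same_card[of fst]) (force simp: bij_betw_def inj_on_def)
  then show "wdeg (hyperedge ` F) (\<lambda>_. w) (Inr (Inl b)) = w * real (card {a. (a, b) \<in> F})"
    by (simp add: wdeg_def sum_hyperedge in_hyperedge count)
  show "wdeg (hyperedge ` F) (\<lambda>_. w) (Inr (Inr c)) = w * real (card {e \<in> F. c \<in> \<chi> e})"
    by (simp add: wdeg_def sum_hyperedge in_hyperedge count)
qed

text \<open>Colours have weighted degree at most 1 and contribute nothing, so no deviation estimate
  is called for at them.\<close>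

lemma excess_hyperedge:
  assumes F: "F \<subseteq> G" and c: "\<And>c. w * real (card {e \<in> F. c \<in> \<chi> e}) \<le> 1"
  shows "excess (hyperedge ` F) (\<lambda>_. w)
    \<le> (\<Sum>a\<in>A. (max 0 (w * real (card {b. (a, b) \<in> F}) - 1))\<^sup>2)
    + (\<Sum>b\<in>B. (max 0 (w * real (card {a. (a, b) \<in> F}) - 1))\<^sup>2)"
proof -
  define h where "h v = (max 0 (wdeg (hyperedge ` F) (\<lambda>_. w) v - 1))\<^sup>2" for v
  define V :: "('a + 'b + 'c) set" where "V = Inl ` A \<union> (\<lambda>b. Inr (Inl b)) ` B \<union> (\<lambda>c. Inr (Inr c)) ` C"
  have "\<Union>(hyperedge ` F) \<subseteq> V"
    using F G_sub colours_sub by (fastforce simp: V_def hyperedge_def)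
  then have "excess (hyperedge ` F) (\<lambda>_. w) \<le> sum h V"
    unfolding excess_def h_def using finite_A finite_B finite_C by (intro sum_mono2) (auto simp: V_def)
  also have "\<dots> = (\<Sum>a\<in>A. h (Inl a)) + (\<Sum>b\<in>B. h (Inr (Inl b))) + (\<Sum>c\<in>C. h (Inr (Inr c)))"
  proof -
    have "sum h V = sum h (Inl ` A \<union> (\<lambda>b. Inr (Inl b)) ` B) + sum h ((\<lambda>c. Inr (Inr c)) ` C)"
      unfolding V_def using finite_A finite_B finite_C by (intro sum.union_disjoint) auto
    also have "sum h (Inl ` A \<union> (\<lambda>b. Inr (Inl b)) ` B) = sum h (Inl ` A) + sum h ((\<lambda>b. Inr (Inl b)) ` B)"
      using finite_A finite_B by (intro sum.union_disjoint) auto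
    finally show ?thesis by (simp add: sum.reindex inj_on_def)
  qed
  also have "(\<Sum>c\<in>C. h (Inr (Inr c))) = 0"
    using c by (intro sum.neutral) (simp add: h_def wdeg_hyperedge[OF F])
  finally show ?thesis by (simp add: h_def wdeg_hyperedge[OF F])
qed

lemma rainbow_pairs_of_hypermatching:
  assumes M: "M \<subseteq> hyperedge ` F" "disjoint M" and F: "F \<subseteq> G"
  obtains M' where "M' \<subseteq> F" "rainbow_pairs M'" "card M' = card M"
proof -
  obtain M' where M': "M' \<subseteq> F" "M = hyperedge ` M'" using M(1) by (meson subset_imageE)
  have "rainbow_pairs M'"
    unfolding rainbow_pairs_def
  proof (intro conjI ballI impI)
    show "M' \<subseteq> G" using M' F by blast
    fix e f assume "e \<in> M'" "f \<in> M'" "e \<noteq> f"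
    then have "hyperedge e \<inter> hyperedge f = {}"
      using M(2) inj_hyperedge unfolding M'(2) pairwise_def disjnt_def by (metis image_eqI injD)
    then show "fst e \<noteq> fst f" "snd e \<noteq> snd f" "\<chi> e \<inter> \<chi> f = {}" by (auto simp: hyperedge_def)
  qed
  moreover have "card M' = card M"
    unfolding M'(2) by (rule card_image[symmetric]) (rule inj_on_subset[OF inj_hyperedge], simp)
  ultimately show ?thesis using that M'(1) by blast
qed

end

section \<open>Consequences for a good set of reserved colours\<close>

context random_colours
begin

text \<open>By \<open>discrepancy_power4\<close> the fourth power of the discrepancy is of order
  \<open>n ^ 7\<close>, hence below \<open>(\<eta> * n\<^sup>2) ^ 4\<close> for large
  \<open>n\<close>, with the same \<open>R\<close> for all \<open>S\<close> and
  \<open>T\<close>.\<close>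

lemma reserved_edges:
  assumes cyc: "cycle_sum p R \<le> 4 * (real t + 2) * real n ^ 3"
    and \<eta>: "\<eta> > 0" and n: "4 * (real t + 2) / \<eta> ^ 4 \<le> real n" and S: "S \<subseteq> A" and T: "T \<subseteq> B"
  shows "p * real (card (G \<inter> S \<times> T)) - \<eta> * (real n)\<^sup>2 \<le> real (card ({e \<in> G. \<chi> e \<subseteq> R} \<inter> S \<times> T))"
proof -
  define x where "x = (\<Sum>a\<in>S. \<Sum>b\<in>T. centred_contains p R (a, b))"
  have fin: "finite (S \<times> T)" using S T finite_A finite_B finite_subset by (metis finite_cartesian_product)
  have "x = (\<Sum>e\<in>S \<times> T. centred_contains p R e)" by (simp add: x_def sum.cartesian_product)
  also have "\<dots> = (\<Sum>e\<in>S \<times> T. (if e \<in> {e \<in> G. \<chi> e \<subseteq> R} then 1 else 0) - p * (if e \<in> G then 1 else 0))"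
    by (rule sum.cong) (auto simp: centred_contains_def)
  also have "\<dots> = real (card ({e \<in> G. \<chi> e \<subseteq> R} \<inter> S \<times> T)) - p * real (card (G \<inter> S \<times> T))"
    unfolding sum_subtractf sum_distrib_left[symmetric]
    using fin sum.inter_restrict[OF fin, of "\<lambda>_. 1::real" G]
      sum.inter_restrict[OF fin, of "\<lambda>_. 1::real" "{e \<in> G. \<chi> e \<subseteq> R}"]
    by (simp add: Int_commute)
  finally have x: "x = real (card ({e \<in> G. \<chi> e \<subseteq> R} \<inter> S \<times> T)) - p * real (card (G \<inter> S \<times> T))" .
  have "\<bar>x\<bar> ^ 4 = x ^ 4" by simp
  also have "\<dots> \<le> real n ^ 4 * cycle_sum p R"
    unfolding x_def cycle_sum_def
    by (rule discrepancy_power4) (use finite_A finite_B card_A card_B S T in auto)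
  also have "\<dots> \<le> real n ^ 4 * (4 * (real t + 2) * real n ^ 3)"
    using cyc by (intro mult_left_mono) auto
  also have "\<dots> \<le> real n ^ 4 * (real n * \<eta> ^ 4 * real n ^ 3)"
    using n \<eta> by (intro mult_left_mono mult_right_mono) (auto simp: field_simps)
  also have "\<dots> = (\<eta> * (real n)\<^sup>2) ^ 4"
    by (simp add: power_mult_distrib power2_eq_square power4_eq_xxxx power3_eq_cube)
  finally have "\<bar>x\<bar> \<le> \<eta> * (real n)\<^sup>2"
    using \<eta> by (subst (asm) power_mono_iff) auto
  then show ?thesis using x by linarith
qed

lemma sum_centred_avoids:
  "(\<Sum>b\<in>B. centred_avoids q R (a, b))
    = real (card {b. (a, b) \<in> {e \<in> G. \<chi> e \<inter> R = {}}}) - q * real (card {b. (a, b) \<in> G})"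
  "(\<Sum>a\<in>A. centred_avoids q R (a, b))
    = real (card {a. (a, b) \<in> {e \<in> G. \<chi> e \<inter> R = {}}}) - q * real (card {a. (a, b) \<in> G})"
proof -
  have gen: "(\<Sum>y\<in>Y. centred_avoids q R (f y))
    = real (card {y. f y \<in> {e \<in> G. \<chi> e \<inter> R = {}}}) - q * real (card {y. f y \<in> G})"
    if Y: "finite Y" and sub: "\<And>y. f y \<in> G \<Longrightarrow> y \<in> Y" for Y :: "'z set" and f
  proof -
    have "(\<Sum>y\<in>Y. centred_avoids q R (f y))
      = (\<Sum>y\<in>Y. (if y \<in> {y. f y \<in> {e \<in> G. \<chi> e \<inter> R = {}}} then 1 else 0) - q * (if y \<in> {y. f y \<in> G} then 1 else 0))"
      by (rule sum.cong) (auto simp: centred_avoids_def)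
    also have "\<dots> = real (card (Y \<inter> {y. f y \<in> {e \<in> G. \<chi> e \<inter> R = {}}})) - q * real (card (Y \<inter> {y. f y \<in> G}))"
      unfolding sum_subtractf sum_distrib_left[symmetric] sum.inter_restrict[OF Y, symmetric] by simp
    also have "Y \<inter> {y. f y \<in> {e \<in> G. \<chi> e \<inter> R = {}}} = {y. f y \<in> {e \<in> G. \<chi> e \<inter> R = {}}}" using sub by auto
    also have "Y \<inter> {y. f y \<in> G} = {y. f y \<in> G}" using sub by auto
    finally show ?thesis .
  qed
  show "(\<Sum>b\<in>B. centred_avoids q R (a, b))
    = real (card {b. (a, b) \<in> {e \<in> G. \<chi> e \<inter> R = {}}}) - q * real (card {b. (a, b) \<in> G})"
    by (rule gen[OF finite_B]) (use G_sub in auto)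
  show "(\<Sum>a\<in>A. centred_avoids q R (a, b))
    = real (card {a. (a, b) \<in> {e \<in> G. \<chi> e \<inter> R = {}}}) - q * real (card {a. (a, b) \<in> G})"
    by (rule gen[OF finite_A]) (use G_sub in auto)
qed

text \<open>All hyperedges get weight \<open>1 / D\<close>, where \<open>D\<close> is the largest
  possible mean degree of a vertex after the reservation. Colours stay within \<open>D\<close> even
  if none of their edges is lost, so excess arises only from deviations at vertices; it is at most
  \<open>16 * n\<^sup>2 / D\<^sup>2\<close>, a constant because \<open>D \<ge> D0 * n\<close>.
  Almost regularity makes the total weight nearly \<open>n\<close>.\<close>

lemma near_perfect_rainbow:
  fixes \<delta> \<epsilon> d D0 K D :: real and R :: "'c set"
  defines "D \<equiv> q * ((1 + \<epsilon>) * d)"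
  assumes nibble: "\<And>(H :: ('a + 'b + 'c) set set) w. \<lbrakk>linear_hypergraph H (t + 2); \<And>f. f \<in> H \<Longrightarrow> 0 \<le> w f;
      \<And>f. f \<in> H \<Longrightarrow> w f \<le> K / real n; \<And>v. wdeg H w v \<le> K; excess H w \<le> K; sum w H \<le> K * real n\<rbrakk>
      \<Longrightarrow> \<exists>M\<subseteq>H. disjoint M \<and> real (card M) \<ge> sum w H - \<delta> / 2 * real n"
    and lin: "\<And>e f. e \<in> G \<Longrightarrow> f \<in> G \<Longrightarrow> e \<noteq> f \<Longrightarrow> card (\<chi> e \<inter> \<chi> f) \<le> 1"
    and n: "n \<ge> 1" "128 / (D0\<^sup>2 * \<delta>\<^sup>2) \<le> real n" and \<delta>: "\<delta> > 0" and \<epsilon>: "0 < \<epsilon>" "8 * \<epsilon> \<le> \<delta>" "\<epsilon> \<le> 1"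
    and d: "d > 0"
    and degA: "\<And>a. a \<in> A \<Longrightarrow> (1 - \<epsilon>) * d \<le> card {b. (a, b) \<in> G} \<and> card {b. (a, b) \<in> G} \<le> (1 + \<epsilon>) * d"
    and degB: "\<And>b. b \<in> B \<Longrightarrow> (1 - \<epsilon>) * d \<le> card {a. (a, b) \<in> G} \<and> card {a. (a, b) \<in> G} \<le> (1 + \<epsilon>) * d"
    and degC: "\<And>c. card {e \<in> G. c \<in> \<chi> e} \<le> D"
    and D0: "D0 > 0" "D0 * real n \<le> D" and K: "1 \<le> K" "1 / q \<le> K" "1 / D0 \<le> K" "16 / D0\<^sup>2 \<le> K"
    and devA: "(\<Sum>a\<in>A. (\<Sum>b\<in>B. centred_avoids q R (a, b))\<^sup>2) \<le> 8 * (real n)\<^sup>2"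
    and devB: "(\<Sum>b\<in>B. (\<Sum>a\<in>A. centred_avoids q R (a, b))\<^sup>2) \<le> 8 * (real n)\<^sup>2"
  obtains M where "rainbow_pairs M" "\<And>e. e \<in> M \<Longrightarrow> \<chi> e \<inter> R = {}" "real n - \<delta> * real n \<le> real (card M)"
proof -
  define F where "F = {e \<in> G. \<chi> e \<inter> R = {}}"
  define w where "w = 1 / D"
  define H where "H = hyperedge ` F"
  have F: "F \<subseteq> G" by (auto simp: F_def)
  have finF: "finite F" using F finite_G by (rule finite_subset)
  have n0: "real n > 0" using n by simp
  have Dn: "0 < D0 * real n" using D0 n0 by simp
  then have D: "D > 0" using D0 by linarith
  have w: "w > 0" using D by (simp add: w_def)
  define devA' where "devA' a = (\<Sum>b\<in>B. centred_avoids q R (a, b))" for a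
  define devB' where "devB' b = (\<Sum>a\<in>A. centred_avoids q R (a, b))" for b
  have dA: "real (card {b. (a, b) \<in> F}) = q * real (card {b. (a, b) \<in> G}) + devA' a" for a
    using sum_centred_avoids(1)[of R a] by (simp add: devA'_def F_def)
  have dB: "real (card {a. (a, b) \<in> F}) = q * real (card {a. (a, b) \<in> G}) + devB' b" for b
    using sum_centred_avoids(2)[of R b] by (simp add: devB'_def F_def)
  have sq: "(max 0 (w * y - 1))\<^sup>2 \<le> x\<^sup>2 / D\<^sup>2" if "y \<le> D + x" for x y
  proof -
    have "w * y - 1 = (y - D) / D" using D by (simp add: w_def diff_divide_distrib)
    also have "\<dots> \<le> x / D" using that D by (intro divide_right_mono) auto
    finally have "w * y - 1 \<le> x / D" .
    then have "max 0 (w * y - 1) \<le> \<bar>x / D\<bar>"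
      using abs_ge_self[of "x / D"] by (intro max.boundedI abs_ge_zero) (rule order_trans)
    then have "(max 0 (w * y - 1))\<^sup>2 \<le> \<bar>x / D\<bar>\<^sup>2" by (intro power_mono) auto
    then show ?thesis by (simp add: power_divide)
  qed
  have qmult: "q * y \<le> D" if "y \<le> (1 + \<epsilon>) * d" for y
    unfolding D_def using that q by (intro mult_left_mono) auto
  have colF: "w * real (card {e \<in> F. c \<in> \<chi> e}) \<le> 1" for c
  proof -
    have "card {e \<in> F. c \<in> \<chi> e} \<le> card {e \<in> G. c \<in> \<chi> e}"
      using F finite_G by (intro card_mono) auto
    then have "real (card {e \<in> F. c \<in> \<chi> e}) \<le> D" using degC[of c] by linarith
    then show ?thesis using D by (simp add: w_def)
  qed
  have Dd: "D / q = (1 + \<epsilon>) * d" using q by (simp add: D_def)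
  have wq: "w * y \<le> K" if "y \<le> (1 + \<epsilon>) * d" for y
  proof -
    have "w * y \<le> w * (D / q)" unfolding Dd using that w by (intro mult_left_mono) auto
    also have "\<dots> = 1 / q" using D by (simp add: w_def)
    finally show ?thesis using K by linarith
  qed
  have degF_A: "card {b. (a, b) \<in> F} \<le> card {b. (a, b) \<in> G}" for a
    using F by (intro card_mono finite_right) auto
  have degF_B: "card {a. (a, b) \<in> F} \<le> card {a. (a, b) \<in> G}" for b
    using F G_sub by (intro card_mono finite_subset[OF _ finite_A]) auto
  have F_AB: "F \<subseteq> A \<times> B" using F G_sub by blast
  have card_F: "card F = (\<Sum>a\<in>A. card {b. (a, b) \<in> F})"
  proof -
    have fin: "finite {b. (a, b) \<in> F}" for a
      by (rule finite_subset[OF _ finite_B]) (use F_AB in auto)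
    have "F = (SIGMA a:A. {b. (a, b) \<in> F})" using F_AB by auto
    then have "card F = card (SIGMA a:A. {b. (a, b) \<in> F})" by simp
    also have "\<dots> = (\<Sum>a\<in>A. card {b. (a, b) \<in> F})" using finite_A fin by (intro card_SigmaI) auto
    finally show ?thesis .
  qed
  have total: "sum (\<lambda>_. w) H = w * real (card F)"
    unfolding H_def sum_hyperedge by (simp add: mult.commute)
  have "\<exists>M\<subseteq>H. disjoint M \<and> real (card M) \<ge> sum (\<lambda>_. w) H - \<delta> / 2 * real n"
  proof (rule nibble)
    show "linear_hypergraph H (t + 2)" unfolding H_def by (rule linear_hypergraph_hyperedge[OF lin F])
    show "0 \<le> w" using w by simp
    have "w \<le> 1 / (D0 * real n)" unfolding w_def using D0 Dn D by (intro divide_left_mono) auto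
    also have "\<dots> = (1 / D0) / real n" by simp
    also have "\<dots> \<le> K / real n" using K by (intro divide_right_mono) auto
    finally show "w \<le> K / real n" .
    show "wdeg H (\<lambda>_. w) v \<le> K" for v
    proof -
      consider a where "v = Inl a" | b where "v = Inr (Inl b)" | c where "v = Inr (Inr c)"
        by (metis sum.exhaust)
      then show ?thesis
      proof cases
        case 1
        have "w * real (card {b. (a, b) \<in> F}) \<le> K"
        proof (cases "a \<in> A")
          case True
          then show ?thesis using degA[of a] degF_A[of a] by (intro wq) linarith
        next
          case False
          then have "{b. (a, b) \<in> F} = {}" using F_AB by auto
          then show ?thesis using K by simp
        qed
        then show ?thesis by (simp add: 1 H_def wdeg_hyperedge[OF F])
      next
        case 2
        have "w * real (card {a. (a, b) \<in> F}) \<le> K"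
        proof (cases "b \<in> B")
          case True
          then show ?thesis using degB[of b] degF_B[of b] by (intro wq) linarith
        next
          case False
          then have "{a. (a, b) \<in> F} = {}" using F_AB by auto
          then show ?thesis using K by simp
        qed
        then show ?thesis by (simp add: 2 H_def wdeg_hyperedge[OF F])
      next
        case 3
        then show ?thesis using colF[of c] K by (simp add: H_def wdeg_hyperedge[OF F])
      qed
    qed
    have "excess H (\<lambda>_. w) \<le> (\<Sum>a\<in>A. (max 0 (w * real (card {b. (a, b) \<in> F}) - 1))\<^sup>2)
      + (\<Sum>b\<in>B. (max 0 (w * real (card {a. (a, b) \<in> F}) - 1))\<^sup>2)"
      unfolding H_def by (rule excess_hyperedge[OF F colF])
    also have "\<dots> \<le> (\<Sum>a\<in>A. (devA' a)\<^sup>2 / D\<^sup>2) + (\<Sum>b\<in>B. (devB' b)\<^sup>2 / D\<^sup>2)"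
      using degA degB qmult by (intro add_mono sum_mono sq) (auto simp: dA dB)
    also have "\<dots> \<le> 16 * (real n)\<^sup>2 / D\<^sup>2"
    proof -
      have "(\<Sum>a\<in>A. (devA' a)\<^sup>2) + (\<Sum>b\<in>B. (devB' b)\<^sup>2) \<le> 16 * (real n)\<^sup>2"
        using devA devB by (simp add: devA'_def devB'_def)
      then show ?thesis
        unfolding sum_divide_distrib[symmetric] add_divide_distrib[symmetric] by (rule divide_right_mono) simp
    qed
    also have "\<dots> \<le> 16 * (real n)\<^sup>2 / (D0 * real n)\<^sup>2"
      using D0 Dn D n0 by (intro divide_left_mono power_mono mult_pos_pos zero_less_power) auto
    also have "\<dots> = 16 / D0\<^sup>2" using n0 by (simp add: power_mult_distrib)
    finally show "excess H (\<lambda>_. w) \<le> K" using K by linarith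
    have "real (card F) \<le> (\<Sum>a\<in>A. (1 + \<epsilon>) * d)"
      unfolding card_F of_nat_sum using degA degF_A by (intro sum_mono) (meson of_nat_mono order_trans)
    then have "w * real (card F) \<le> w * (real n * (D / q))"
      unfolding Dd using w by (intro mult_left_mono) (auto simp: card_A)
    also have "\<dots> = 1 / q * real n" using D by (simp add: w_def)
    also have "\<dots> \<le> K * real n" using K by (intro mult_right_mono) auto
    finally show "sum (\<lambda>_. w) H \<le> K * real n" unfolding total .
  qed
  then obtain M where M: "M \<subseteq> H" "disjoint M" "real (card M) \<ge> w * real (card F) - \<delta> / 2 * real n"
    unfolding total by blast
  obtain M' where M': "M' \<subseteq> F" "rainbow_pairs M'" "card M' = card M"
    using rainbow_pairs_of_hypermatching[OF M(1)[unfolded H_def] M(2) F] by blast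
  \<comment> \<open>Half of the loss \<open>\<delta> * n\<close> occurs here, the other half in the
    nibble.\<close>
  have "w * real (card F) \<ge> real n - \<delta> / 2 * real n"
  proof -
    \<comment> \<open>AM-GM with parameter \<open>\<mu> * n\<close> converts the bound on squared
      deviations into one on plain deviations. The value is such that the linear part, multiplied by
      \<open>w * n\<close>, costs at most \<open>\<delta> / 8 * n\<close>; the quadratic part costs
      no more by the second bound on \<open>n\<close>.\<close>
    define \<mu> where "\<mu> = D0 * \<delta> / 8"
    have \<mu>: "\<mu> > 0" using D0 \<delta> by (simp add: \<mu>_def)
    have "(\<Sum>a\<in>A. q * ((1 - \<epsilon>) * d) - (\<mu> * real n + (devA' a)\<^sup>2 / (4 * \<mu> * real n))) \<le> (\<Sum>a\<in>A. real (card {b. (a, b) \<in> F}))"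
    proof (rule sum_mono)
      fix a assume a: "a \<in> A"
      have "q * ((1 - \<epsilon>) * d) \<le> q * real (card {b. (a, b) \<in> G})"
        using degA[OF a] q by (intro mult_left_mono) auto
      moreover have "- devA' a \<le> \<mu> * real n + (devA' a)\<^sup>2 / (4 * \<mu> * real n)"
      proof -
        have "0 \<le> (2 * \<mu> * real n + devA' a)\<^sup>2" by simp
        then have "- devA' a * (4 * \<mu> * real n) \<le> (\<mu> * real n) * (4 * \<mu> * real n) + (devA' a)\<^sup>2"
          by (simp add: power2_eq_square algebra_simps)
        then show ?thesis using \<mu> n0 by (simp add: field_simps)
      qed
      ultimately show "q * ((1 - \<epsilon>) * d) - (\<mu> * real n + (devA' a)\<^sup>2 / (4 * \<mu> * real n)) \<le> real (card {b. (a, b) \<in> F})"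
        unfolding dA by linarith
    qed
    also have "\<dots> = real (card F)" by (simp add: card_F)
    finally have "real n * (q * ((1 - \<epsilon>) * d)) - (real n * (\<mu> * real n) + (\<Sum>a\<in>A. (devA' a)\<^sup>2) / (4 * \<mu> * real n)) \<le> real (card F)"
      by (simp add: sum_subtractf sum.distrib card_A sum_divide_distrib)
    moreover have "(\<Sum>a\<in>A. (devA' a)\<^sup>2) / (4 * \<mu> * real n) \<le> 8 * (real n)\<^sup>2 / (4 * \<mu> * real n)"
      using devA \<mu> n0 by (intro divide_right_mono) (auto simp: devA'_def)
    moreover have "8 * (real n)\<^sup>2 / (4 * \<mu> * real n) = 2 * real n / \<mu>"
      using \<mu> n0 by (simp add: field_simps power2_eq_square)
    ultimately have cF: "real n * (q * ((1 - \<epsilon>) * d)) - (real n * (\<mu> * real n) + 2 * real n / \<mu>) \<le> real (card F)"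
      by linarith
    have err: "w * (real n * (\<mu> * real n) + 2 * real n / \<mu>) \<le> \<delta> / 4 * real n"
    proof -
      have e0: "0 \<le> real n * (\<mu> * real n) + 2 * real n / \<mu>" using \<mu> n0 by simp
      have "w \<le> 1 / (D0 * real n)" unfolding w_def using D0 Dn D by (intro divide_left_mono) auto
      then have "w * (real n * (\<mu> * real n) + 2 * real n / \<mu>)
          \<le> 1 / (D0 * real n) * (real n * (\<mu> * real n) + 2 * real n / \<mu>)"
        using e0 by (rule mult_right_mono)
      also have "\<dots> = \<delta> / 8 * real n + 16 / (D0\<^sup>2 * \<delta>)"
        using D0 n0 \<delta> by (simp add: \<mu>_def field_simps power2_eq_square)
      also have "16 / (D0\<^sup>2 * \<delta>) \<le> \<delta> / 8 * real n"
        using n(2) D0 \<delta> by (simp add: field_simps power2_eq_square)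
      finally show ?thesis by simp
    qed
    have main: "w * (real n * (q * ((1 - \<epsilon>) * d))) \<ge> real n - \<delta> / 4 * real n"
    proof -
      have "w * (q * ((1 - \<epsilon>) * d)) = (1 - \<epsilon>) / (1 + \<epsilon>)"
        using q d \<epsilon> by (simp add: w_def D_def)
      moreover have "1 - \<delta> / 4 \<le> (1 - \<epsilon>) / (1 + \<epsilon>)"
      proof -
        have "(1 - \<delta> / 4) * (1 + \<epsilon>) \<le> (1 - 2 * \<epsilon>) * (1 + \<epsilon>)"
          using \<epsilon> by (intro mult_right_mono) auto
        also have "\<dots> \<le> 1 - \<epsilon>" using \<epsilon> by (simp add: algebra_simps)
        finally show ?thesis using \<epsilon> by (simp add: field_simps)
      qed
      ultimately have "real n * (1 - \<delta> / 4) \<le> real n * (w * (q * ((1 - \<epsilon>) * d)))"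
        by (intro mult_left_mono) auto
      then show ?thesis by (simp add: algebra_simps)
    qed
    have "w * (real n * (q * ((1 - \<epsilon>) * d)) - (real n * (\<mu> * real n) + 2 * real n / \<mu>)) \<le> w * real (card F)"
      using cF w by (intro mult_left_mono) auto
    then show ?thesis using err main unfolding right_diff_distrib by linarith
  qed
  then have "real n - \<delta> * real n \<le> real (card M')" using M(3) M'(3) by simp
  then show ?thesis using that[OF M'(2)] M'(1) by (auto simp: F_def)
qed

end

section \<open>Perfect rainbow matchings\<close>

context random_colours
begin

text \<open>All the constants depend on \<open>\<alpha>\<close> and \<open>t\<close> only: \<open>\<kappa> = p\<^sup>2 \<alpha>\<^sup>3\<close> is the scale of the density of reserved
  edges that leave a robustly reached set, and the near-perfect matching may miss far fewer vertices.\<close>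

lemma perfect_rainbow_matching:
  fixes \<alpha> \<epsilon> d \<delta> K \<kappa> :: real
  defines "\<kappa> \<equiv> p\<^sup>2 * \<alpha> ^ 3"
  assumes nibble: "\<And>(H :: ('a + 'b + 'c) set set) w. \<lbrakk>linear_hypergraph H (t + 2); \<And>f. f \<in> H \<Longrightarrow> 0 \<le> w f;
      \<And>f. f \<in> H \<Longrightarrow> w f \<le> K / real n; \<And>v. wdeg H w v \<le> K; excess H w \<le> K; sum w H \<le> K * real n\<rbrakk>
      \<Longrightarrow> \<exists>M\<subseteq>H. disjoint M \<and> real (card M) \<ge> sum w H - \<delta> / 2 * real n"
    and t: "t \<ge> 1" and \<alpha>: "0 < \<alpha>" "\<alpha> < 1" and q: "1 - \<alpha> \<le> q"
    and \<delta>: "\<delta> = \<kappa> / (5120 * real t)" and \<epsilon>: "0 < \<epsilon>" "8 * \<epsilon> \<le> \<delta>" "2 * \<epsilon> \<le> \<alpha>"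
    and K: "1 \<le> K" "1 / q \<le> K" "1 / (q * \<alpha> / 2) \<le> K" "16 / (q * \<alpha> / 2)\<^sup>2 \<le> K"
    and n: "n \<ge> 1" "2 / \<alpha> \<le> real n" "128 / ((q * \<alpha> / 2)\<^sup>2 * \<delta>\<^sup>2) \<le> real n"
      "4 * (real t + 2) / (\<kappa> / 256) ^ 4 \<le> real n" "2048 * (6 * real t + 4) / \<kappa> \<le> real n"
      "16 / (p * \<alpha> / 16)\<^sup>2 \<le> real n"
    and lin: "\<And>e f. e \<in> G \<Longrightarrow> f \<in> G \<Longrightarrow> e \<noteq> f \<Longrightarrow> card (\<chi> e \<inter> \<chi> f) \<le> 1"
    and degA: "\<And>a. a \<in> A \<Longrightarrow> (1 - \<epsilon>) * d \<le> card {b. (a, b) \<in> G} \<and> card {b. (a, b) \<in> G} \<le> (1 + \<epsilon>) * d"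
    and degB: "\<And>b. b \<in> B \<Longrightarrow> (1 - \<epsilon>) * d \<le> card {a. (a, b) \<in> G} \<and> card {a. (a, b) \<in> G} \<le> (1 + \<epsilon>) * d"
    and degC: "\<And>c. card {e \<in> G. c \<in> \<chi> e} \<le> (1 - \<alpha>) * d"
    and dense: "\<And>S T. S \<subseteq> A \<Longrightarrow> T \<subseteq> B \<Longrightarrow> (1 - \<alpha>) * d \<le> card S \<Longrightarrow> (1 - \<alpha>) * d \<le> card T \<Longrightarrow>
      \<alpha> * (real n)\<^sup>2 \<le> card (G \<inter> S \<times> T)"
  shows "\<exists>M. rainbow_pairs M \<and> card M = n"
proof -
  have n0: "real n > 0" using n by simp
  have n2: "(real n)\<^sup>2 > 0" using n0 by simp
  have d: "d \<ge> \<alpha> * real n / 2"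
    by (rule degree_linear[OF \<alpha> \<epsilon>(1) _ n(1,2) degA dense]) (use \<epsilon> \<alpha> in auto)
  then have d0: "d > 0" using \<alpha> n0 mult_pos_pos[of \<alpha> "real n"] by linarith
  have \<epsilon>2: "\<epsilon> \<le> 1/2" using \<epsilon> \<alpha> by linarith
  \<comment> \<open>A lower bound for all degrees: \<open>d \<ge> \<alpha> * n / 2\<close>, and
    \<open>\<epsilon> \<le> 1/2\<close> loses at most half of it.\<close>
  define m where "m = \<alpha> * real n / 4"
  have m: "m \<le> (1 - \<epsilon>) * d"
  proof -
    have "1/2 * d \<le> (1 - \<epsilon>) * d" using \<epsilon>2 d0 by (intro mult_right_mono) auto
    then show ?thesis using d unfolding m_def by linarith
  qed
  \<comment> \<open>A quadratic lower bound for the exponential function beats the linear factor;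
    this needs the last of the bounds on \<open>n\<close>.\<close>
  have small: "8 * real n * exp (- (p * m / 4)) \<le> 1"
  proof -
    define x where "x = p * \<alpha> / 16"
    have x: "x > 0" using p \<alpha> by (simp add: x_def)
    have "8 * real n \<le> (x * real n)\<^sup>2 / 2"
    proof -
      have "16 / x\<^sup>2 \<le> real n" using n(6) by (simp add: x_def)
      then have "16 \<le> real n * x\<^sup>2" using x by (simp add: field_simps)
      then have "16 * real n \<le> (real n * x\<^sup>2) * real n" using n0 by (intro mult_right_mono) auto
      then show ?thesis by (simp add: power2_eq_square algebra_simps)
    qed
    also have "\<dots> \<le> exp (x * real n)"
      using exp_lower_Taylor_quadratic[of "x * real n"] mult_pos_pos[OF x n0] by linarith
    finally have "8 * real n \<le> exp (x * real n)" .
    moreover have "p * m / 4 = x * real n" by (simp add: m_def x_def)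
    ultimately show ?thesis by (simp add: exp_minus field_simps)
  qed
  obtain R where cyc: "cycle_sum p R \<le> 4 * (real t + 2) * real n ^ 3"
    and dev: "(\<Sum>a\<in>A. (\<Sum>b\<in>B. centred_avoids q R (a, b))\<^sup>2) \<le> 8 * (real n)\<^sup>2"
      "(\<Sum>b\<in>B. (\<Sum>a\<in>A. centred_avoids q R (a, b))\<^sup>2) \<le> 8 * (real n)\<^sup>2"
    and degR: "\<And>a. a \<in> A \<Longrightarrow> p * m / 4 < real (card {b. (a, b) \<in> G \<and> \<chi> (a, b) \<subseteq> R})"
      "\<And>b. b \<in> B \<Longrightarrow> p * m / 4 < real (card {a. (a, b) \<in> G \<and> \<chi> (a, b) \<subseteq> R})"
  proof (rule exists_colour_set[OF n(1) _ _ small])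
    show "m \<le> real (card {b. (a, b) \<in> G})" if "a \<in> A" for a using degA[OF that] m by linarith
    show "m \<le> real (card {a. (a, b) \<in> G})" if "b \<in> B" for b using degB[OF that] m by linarith
  qed blast
  have q0: "q > 0" using q \<alpha> by linarith
  have kap: "0 < \<kappa>" "\<kappa> \<le> p * \<alpha>"
  proof -
    show "0 < \<kappa>" using p \<alpha> by (simp add: \<kappa>_def)
    have "p * p * (\<alpha> * (\<alpha> * \<alpha>)) \<le> p * 1 * (\<alpha> * (1 * 1))"
      using p \<alpha> by (intro mult_mono mult_nonneg_nonneg) auto
    then show "\<kappa> \<le> p * \<alpha>" by (simp add: \<kappa>_def power2_eq_square power3_eq_cube)
  qed
  have \<delta>0: "\<delta> > 0" using \<delta> kap t by simp
  obtain M0 where M0: "rainbow_pairs M0" "\<And>e. e \<in> M0 \<Longrightarrow> \<chi> e \<inter> R = {}" "real n - \<delta> * real n \<le> real (card M0)"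
  proof (rule near_perfect_rainbow[of K \<delta> "q * \<alpha> / 2" \<epsilon> d R, OF nibble lin n(1,3) \<delta>0 \<epsilon>(1,2) _ d0 degA degB _ _ _ K dev])
    have qd: "q * d \<le> q * ((1 + \<epsilon>) * d)" using q0 d0 \<epsilon> by (intro mult_left_mono) auto
    show "real (card {e \<in> G. c \<in> \<chi> e}) \<le> q * ((1 + \<epsilon>) * d)" for c
      using degC[of c] mult_right_mono[OF q, of d] d0 qd by linarith
    show "q * \<alpha> / 2 * real n \<le> q * ((1 + \<epsilon>) * d)"
      using mult_left_mono[OF d, of q] q0 qd by simp
  qed (use \<epsilon>2 q0 \<alpha> in auto)
  define u where "u = n - card M0"
  have u: "real u \<le> \<delta> * real n" using M0(3) \<delta>0 n0 unfolding u_def by (cases "card M0 \<le> n") auto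
  have tu: "5 * real t * real u \<le> \<kappa> / 1024 * real n"
  proof -
    have "5 * real t * real u \<le> 5 * real t * (\<delta> * real n)" using u by (intro mult_left_mono) auto
    also have "\<dots> = \<kappa> / 1024 * real n" using t by (simp add: \<delta>)
    finally show ?thesis .
  qed
  have u5: "real u \<le> \<kappa> / 5120 * real n"
  proof -
    have "\<kappa> / (5120 * real t) \<le> \<kappa> / (5120 * 1)"
      using t kap by (intro divide_left_mono mult_left_mono) auto
    then have "\<delta> * real n \<le> \<kappa> / 5120 * real n" unfolding \<delta> by (intro mult_right_mono) auto
    then show ?thesis using u by linarith
  qed
  have tun: "5 * real t * real u * real n \<le> \<kappa> / 1024 * (real n)\<^sup>2"
    using mult_right_mono[OF tu, of "real n"] by (simp add: power2_eq_square mult.assoc)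
  define GR where "GR = {e \<in> G. \<chi> e \<subseteq> R}"
  have res: "p * real (card (G \<inter> S \<times> T)) - \<kappa> / 256 * (real n)\<^sup>2 \<le> real (card (GR \<inter> S \<times> T))"
    if "S \<subseteq> A" "T \<subseteq> B" for S T
    unfolding GR_def by (rule reserved_edges[OF cyc _ n(4) that]) (use kap in simp)
  \<comment> \<open>Half of the guaranteed reserved degree
    \<open>p * m / 4 = p * \<alpha> / 16 * n\<close>; the other half pays for uncovered vertices and
    used colours.\<close>
  define s where "s = p * \<alpha> / 32 * real n"
  \<comment> \<open>Every vertex has at least this many neighbours outside a given set of fewer than
    \<open>(1 - \<alpha>) * d\<close> vertices, thanks to
    \<open>2 * \<epsilon> \<le> \<alpha>\<close>.\<close>
  define x where "x = \<alpha> / 2 * d"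
  have x: "x + (1 - \<alpha>) * d \<le> (1 - \<epsilon>) * d"
  proof -
    have "\<epsilon> * d \<le> \<alpha> / 2 * d" using \<epsilon> d0 by (intro mult_right_mono) auto
    then show ?thesis by (simp add: x_def algebra_simps)
  qed
  \<comment> \<open>The origin of \<open>\<kappa>\<close>: one factor \<open>p\<close> comes from
    the reservation and one from \<open>s\<close>; the factors \<open>\<alpha>\<close> come from
    \<open>s\<close>, from the definition of \<open>x\<close>, and from
    \<open>d \<ge> \<alpha> * n / 2\<close>.\<close>
  have sx: "\<kappa> / 128 * (real n)\<^sup>2 \<le> p * (y * x)" if "s \<le> y" for y
  proof -
    have "\<alpha> / 2 * (\<alpha> * real n / 2) \<le> x" unfolding x_def using d \<alpha> by (intro mult_left_mono) auto
    moreover have "0 \<le> s" using p \<alpha> by (simp add: s_def)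
    ultimately have "s * (\<alpha> / 2 * (\<alpha> * real n / 2)) \<le> y * x"
      using that \<alpha> by (intro mult_mono) auto
    then have "p * (s * (\<alpha> / 2 * (\<alpha> * real n / 2))) \<le> p * (y * x)" using p by (intro mult_left_mono) auto
    then show ?thesis by (simp add: s_def \<kappa>_def power2_eq_square power3_eq_cube field_simps)
  qed
  have pan: "s + real u + 5 * real t * real u \<le> p * m / 4"
  proof -
    have "\<kappa> * real n \<le> p * \<alpha> * real n" using kap n0 by (intro mult_right_mono) auto
    moreover have "p * m / 4 = p * \<alpha> * real n / 16" by (simp add: m_def)
    moreover have "s = p * \<alpha> * real n / 32" by (simp add: s_def)
    moreover have "0 \<le> \<kappa> * real n" using kap n0 by simp
    ultimately show ?thesis using tu u5 by linarith
  qed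
  \<comment> \<open>In units of \<open>n\<^sup>2\<close>: from \<open>\<kappa> / 128\<close> the
    discrepancy takes \<open>\<kappa> / 256\<close> and the used colours at most
    \<open>\<kappa> / 1024\<close>, so \<open>\<beta> = \<kappa> / 512\<close> is available. It
    exceeds the sum of \<open>\<kappa> / 2048\<close> for \<open>r\<close>, at most
    \<open>\<kappa> / 5120\<close> for the uncovered vertices and at most
    \<open>\<kappa> / 2048\<close> for colour clashes.\<close>
  show ?thesis
  proof (rule perfect_from_near_perfect[OF t M0(1,2), where s = s and \<tau> = "(1 - \<alpha>) * d"
        and \<beta> = "\<kappa> / 512 * (real n)\<^sup>2" and r = "\<kappa> / 2048 * real n", folded u_def GR_def])
    show "s + real u + 5 * real t * real u \<le> real (card {b. (a, b) \<in> GR})" if "a \<in> A" for a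
      using degR(1)[OF that] pan by (simp add: GR_def)
    show "s + real u + 5 * real t * real u \<le> real (card {a. (a, b) \<in> GR})" if "b \<in> B" for b
      using degR(2)[OF that] pan by (simp add: GR_def)
    show "\<kappa> / 512 * (real n)\<^sup>2 + 5 * real t * real u * real n \<le> real (card (GR \<inter> S \<times> (B - T)))"
      if ST: "S \<subseteq> A" "T \<subseteq> B" "s \<le> real (card S)" "real (card T) < (1 - \<alpha>) * d" for S T
    proof -
      have "real (card S) * x \<le> real (card (G \<inter> S \<times> (B - T)))"
      proof (rule edges_leaving_A[OF ST(1) finite_subset[OF ST(2) finite_B]])
        show "x + real (card T) \<le> real (card {b. (a, b) \<in> G})" if "a \<in> A" for a
          using degA[OF that] x ST(4) by linarith
      qed
      then have "p * (real (card S) * x) \<le> p * real (card (G \<inter> S \<times> (B - T)))"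
        using p by (intro mult_left_mono) auto
      then have "\<kappa> / 128 * (real n)\<^sup>2 - \<kappa> / 256 * (real n)\<^sup>2 \<le> real (card (GR \<inter> S \<times> (B - T)))"
        using sx[OF ST(3)] res[OF ST(1), of "B - T"] by auto
      then show ?thesis using tun mult_pos_pos[OF kap(1) n2] by simp
    qed
    show "\<kappa> / 512 * (real n)\<^sup>2 + 5 * real t * real u * real n \<le> real (card (GR \<inter> (A - S) \<times> T))"
      if ST: "S \<subseteq> A" "T \<subseteq> B" "s \<le> real (card T)" "real (card S) < (1 - \<alpha>) * d" for S T
    proof -
      have "real (card T) * x \<le> real (card (G \<inter> (A - S) \<times> T))"
      proof (rule edges_leaving_B[OF ST(2) finite_subset[OF ST(1) finite_A]])
        show "x + real (card S) \<le> real (card {a. (a, b) \<in> G})" if "b \<in> B" for b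
          using degB[OF that] x ST(4) by linarith
      qed
      then have "p * (real (card T) * x) \<le> p * real (card (G \<inter> (A - S) \<times> T))"
        using p by (intro mult_left_mono) auto
      then have "\<kappa> / 128 * (real n)\<^sup>2 - \<kappa> / 256 * (real n)\<^sup>2 \<le> real (card (GR \<inter> (A - S) \<times> T))"
        using sx[OF ST(3)] res[OF _ ST(2), of "A - S"] by auto
      then show ?thesis using tun mult_pos_pos[OF kap(1) n2] by simp
    qed
    show "5 * real t * real u * real n < real (card (GR \<inter> S \<times> T))"
      if ST: "S \<subseteq> A" "T \<subseteq> B" "(1 - \<alpha>) * d \<le> real (card S)" "(1 - \<alpha>) * d \<le> real (card T)" for S T
    proof -
      have "p * (\<alpha> * (real n)\<^sup>2) \<le> p * real (card (G \<inter> S \<times> T))"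
        using dense[OF ST] p by (intro mult_left_mono) auto
      moreover have "\<kappa> * (real n)\<^sup>2 \<le> p * \<alpha> * (real n)\<^sup>2" using kap by (intro mult_right_mono) auto
      ultimately show ?thesis using res[OF ST(1,2)] tun mult_pos_pos[OF kap(1) n2] by simp
    qed
    have big: "2048 * (6 * real t + 4) \<le> \<kappa> * real n" using n(5) kap by (simp add: field_simps)
    then show "real (6 * t + 3) < \<kappa> / 2048 * real n" by simp
    have "real t \<le> \<kappa> / 2048 * real n" using big by simp
    then have "real t * real n \<le> \<kappa> / 2048 * real n * real n" by (intro mult_right_mono) auto
    moreover have "real u * real n \<le> \<kappa> / 5120 * real n * real n" using u5 by (intro mult_right_mono) auto
    ultimately show "real n * (\<kappa> / 2048 * real n) + real u * real n + real (t * n) < \<kappa> / 512 * (real n)\<^sup>2"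
      using mult_pos_pos[OF kap(1) n2] by (simp add: power2_eq_square algebra_simps)
  qed
qed

end

section \<open>From edges as two-element sets to ordered pairs\<close>

definition edge_of :: "'v \<times> 'v \<Rightarrow> 'v set" where
  "edge_of e = {fst e, snd e}"

definition edge_pairs :: "'v set \<Rightarrow> 'v set \<Rightarrow> 'v set set \<Rightarrow> ('v \<times> 'v) set" where
  "edge_pairs A B E = {e \<in> A \<times> B. edge_of e \<in> E}"

text \<open>With disjoint sides, the set of the two ends determines which end comes first.\<close>

lemma inj_edge_of: "A \<inter> B = {} \<Longrightarrow> inj_on edge_of (A \<times> B)"
  by (rule inj_onI) (auto simp: edge_of_def doubleton_eq_iff)

locale bipartite_coloured =
  fixes A B :: "'v set" and E :: "'v set set" and \<phi> :: "'v set \<Rightarrow> 'c set" and t n :: nat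
  assumes bip: "bipartite_graph A B E" and cardA: "card A = n" and cardB: "card B = n"
    and fold_col: "fold_edge_colouring t E \<phi>" and proper_col: "proper_colouring (A \<union> B) E \<phi>"
    and lin: "linear_colouring E \<phi>"
begin

definition "G = edge_pairs A B E"
definition "\<chi> e = \<phi> (edge_of e)"

lemma disj: "A \<inter> B = {}" and fin: "finite A" "finite B"
  using bip by (auto simp: bipartite_graph_def simple_graph_def)

lemma G_sub: "G \<subseteq> A \<times> B" and edge_in: "e \<in> G \<Longrightarrow> edge_of e \<in> E"
  by (auto simp: G_def edge_pairs_def)

lemma edgeE:
  assumes "x \<in> E" obtains a b where "(a, b) \<in> G" "x = edge_of (a, b)"
proof -
  obtain a b where ab: "a \<in> A" "b \<in> B" "x = edge_of (a, b)"
    using assms bip by (auto simp: bipartite_graph_def edge_of_def)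
  then have "(a, b) \<in> G" using assms by (simp add: G_def edge_pairs_def)
  then show ?thesis using ab that by blast
qed

lemma inj_G: "F \<subseteq> A \<times> B \<Longrightarrow> inj_on edge_of F"
  by (rule inj_on_subset[OF inj_edge_of[OF disj]])

sublocale proper_pairs A B G \<chi> t n
proof
  show "finite A" "finite B" "card A = n" "card B = n" "G \<subseteq> A \<times> B"
    using fin cardA cardB G_sub by auto
  fix e assume e: "e \<in> G"
  show "finite (\<chi> e)" "card (\<chi> e) = t"
    using fold_col edge_in[OF e] by (auto simp: fold_edge_colouring_def \<chi>_def)
  fix f assume f: "f \<in> G" "e \<noteq> f" "fst e = fst f \<or> snd e = snd f"
  have "\<exists>v. v \<in> A \<union> B \<and> v \<in> edge_of e \<and> v \<in> edge_of f"
    using f(3)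
  proof
    assume "fst e = fst f"
    then show ?thesis using G_sub e by (intro exI[of _ "fst e"]) (auto simp: edge_of_def)
  next
    assume "snd e = snd f"
    then show ?thesis using G_sub e by (intro exI[of _ "snd e"]) (auto simp: edge_of_def)
  qed
  then obtain v where v: "v \<in> A \<union> B" "v \<in> edge_of e" "v \<in> edge_of f" by blast
  have "edge_of e \<noteq> edge_of f" using inj_onD[OF inj_G[OF G_sub] _ e f(1)] f(2) by blast
  then show "\<chi> e \<inter> \<chi> f = {}"
    using proper_col v edge_in[OF e] edge_in[OF f(1)]
    by (auto simp: proper_colouring_def disjoint_family_on_def incident_edges_def \<chi>_def)
qed

lemma card_edges:
  assumes "F \<subseteq> G" "X = edge_of ` F" shows "card X = card F"
  unfolding assms(2) by (rule card_image[OF inj_G[OF subset_trans[OF assms(1) G_sub]]])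

lemma vertex_degree_A:
  assumes "a \<in> A" shows "vertex_degree E a = card {b. (a, b) \<in> G}"
proof -
  have "incident_edges E a = edge_of ` Pair a ` {b. (a, b) \<in> G}"
  proof
    show "incident_edges E a \<subseteq> edge_of ` Pair a ` {b. (a, b) \<in> G}"
    proof
      fix x assume "x \<in> incident_edges E a"
      then obtain a' b where e: "(a', b) \<in> G" "x = edge_of (a', b)" "a \<in> edge_of (a', b)"
        using edgeE unfolding incident_edges_def by blast
      have "b \<in> B" using e(1) G_sub by blast
      then have "a' = a" using assms disj e(3) by (auto simp: edge_of_def)
      then show "x \<in> edge_of ` Pair a ` {b. (a, b) \<in> G}" using e by blast
    qed
    have "edge_of (a, b) \<in> incident_edges E a" if "(a, b) \<in> G" for b
      using edge_in[OF that] by (simp add: incident_edges_def edge_of_def)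
    then show "edge_of ` Pair a ` {b. (a, b) \<in> G} \<subseteq> incident_edges E a" by blast
  qed
  then have "vertex_degree E a = card (Pair a ` {b. (a, b) \<in> G})"
    unfolding vertex_degree_def by (intro card_edges) auto
  then show ?thesis by (simp add: card_image inj_on_def)
qed

lemma vertex_degree_B:
  assumes "b \<in> B" shows "vertex_degree E b = card {a. (a, b) \<in> G}"
proof -
  have "incident_edges E b = edge_of ` (\<lambda>a. (a, b)) ` {a. (a, b) \<in> G}"
  proof
    show "incident_edges E b \<subseteq> edge_of ` (\<lambda>a. (a, b)) ` {a. (a, b) \<in> G}"
    proof
      fix x assume "x \<in> incident_edges E b"
      then obtain a b' where e: "(a, b') \<in> G" "x = edge_of (a, b')" "b \<in> edge_of (a, b')"
        using edgeE unfolding incident_edges_def by blast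
      have "a \<in> A" using e(1) G_sub by blast
      then have "b' = b" using assms disj e(3) by (auto simp: edge_of_def)
      then show "x \<in> edge_of ` (\<lambda>a. (a, b)) ` {a. (a, b) \<in> G}" using e by blast
    qed
    have "edge_of (a, b) \<in> incident_edges E b" if "(a, b) \<in> G" for a
      using edge_in[OF that] by (simp add: incident_edges_def edge_of_def)
    then show "edge_of ` (\<lambda>a. (a, b)) ` {a. (a, b) \<in> G} \<subseteq> incident_edges E b" by blast
  qed
  then have "vertex_degree E b = card ((\<lambda>a. (a, b)) ` {a. (a, b) \<in> G})"
    unfolding vertex_degree_def by (intro card_edges) auto
  then show ?thesis by (simp add: card_image inj_on_def)
qed

lemma colour_degree_pairs: "colour_degree E \<phi> c = card {e \<in> G. c \<in> \<chi> e}"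
  unfolding colour_degree_def
proof (rule card_edges)
  show "{e \<in> E. c \<in> \<phi> e} = edge_of ` {e \<in> G. c \<in> \<chi> e}"
    unfolding \<chi>_def using edge_in by (blast elim: edgeE)
qed simp

lemma edges_between_pairs:
  assumes "S \<subseteq> A" "T \<subseteq> B" shows "card (edges_between E S T) = card (G \<inter> S \<times> T)"
proof (rule card_edges)
  show "edges_between E S T = edge_of ` (G \<inter> S \<times> T)"
  proof
    show "edges_between E S T \<subseteq> edge_of ` (G \<inter> S \<times> T)"
    proof
      fix e assume "e \<in> edges_between E S T"
      then obtain x y where "e \<in> E" "x \<in> S" "y \<in> T" "e = edge_of (x, y)"
        by (auto simp: edges_between_def edge_of_def)
      then show "e \<in> edge_of ` (G \<inter> S \<times> T)" using assms by (auto simp: G_def edge_pairs_def)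
    qed
    show "edge_of ` (G \<inter> S \<times> T) \<subseteq> edges_between E S T"
      using edge_in by (fastforce simp: edges_between_def edge_of_def)
  qed
qed simp

text \<open>Linearity read dually: two edges with two common colours would be two edges whose colour
  sets contain the same pair.\<close>

lemma linear_pairs:
  assumes "e \<in> G" "f \<in> G" "e \<noteq> f" shows "card (\<chi> e \<inter> \<chi> f) \<le> 1"
proof (rule ccontr)
  assume "\<not> ?thesis"
  then have "\<exists>c c'. c \<in> \<chi> e \<inter> \<chi> f \<and> c' \<in> \<chi> e \<inter> \<chi> f \<and> c \<noteq> c'"
    using card_le_Suc0_iff_eq[of "\<chi> e \<inter> \<chi> f"] finite_colours[OF assms(1)] by auto
  then obtain c c' where c: "c \<in> \<chi> e \<inter> \<chi> f" "c' \<in> \<chi> e \<inter> \<chi> f" "c \<noteq> c'" by blast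
  \<comment> \<open>Finiteness of \<open>E\<close> has to be established before cardinalities can be
    compared, since \<open>card\<close> is 0 on infinite sets.\<close>
  have "E \<subseteq> edge_of ` G" by (blast elim: edgeE)
  then have "finite E" using finite_G by (rule finite_surj[rotated])
  then have "card {edge_of e, edge_of f} \<le> card {g \<in> E. c \<in> \<phi> g \<and> c' \<in> \<phi> g}"
    using c edge_in assms by (intro card_mono) (auto simp: \<chi>_def)
  also have "\<dots> \<le> 1" using lin c(3) by (simp add: linear_colouring_def)
  finally show False using inj_onD[OF inj_G[OF G_sub], of e f] assms by (auto simp: card_insert_if split: if_splits)
qed

text \<open>A matching of size \<open>n\<close> has \<open>n\<close> different ends on each side and
  so covers both sides.\<close>

lemma perfect_matching_of_pairs:
  assumes M: "rainbow_pairs M" "card M = n"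
  shows "perfect_matching (A \<union> B) E (edge_of ` M) \<and> rainbow \<phi> (edge_of ` M)"
proof -
  have MG: "M \<subseteq> G" using M by (simp add: rainbow_pairs_def)
  have ne: "fst e \<noteq> fst f \<and> snd e \<noteq> snd f \<and> \<chi> e \<inter> \<chi> f = {}" if "e \<in> M" "f \<in> M" "edge_of e \<noteq> edge_of f" for e f
  proof -
    have "e \<noteq> f" using that(3) by auto
    then show ?thesis using M(1) that(1,2) unfolding rainbow_pairs_def by blast
  qed
  have "fst ` M = A"
    using MG G_sub card_image[OF rainbow_pairs_inj(1)[OF M(1)]] M(2) cardA
    by (intro card_subset_eq[OF fin(1)]) auto
  moreover have "snd ` M = B"
    using MG G_sub card_image[OF rainbow_pairs_inj(2)[OF M(1)]] M(2) cardB
    by (intro card_subset_eq[OF fin(2)]) auto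
  moreover have "\<Union>(edge_of ` M) = fst ` M \<union> snd ` M" by (auto simp: edge_of_def)
  ultimately have "\<Union>(edge_of ` M) = A \<union> B" by simp
  moreover have "disjoint (edge_of ` M)"
  proof (rule disjointI)
    fix x y assume "x \<in> edge_of ` M" "y \<in> edge_of ` M" "x \<noteq> y"
    then obtain e f where ef: "e \<in> M" "f \<in> M" "x = edge_of e" "y = edge_of f" "edge_of e \<noteq> edge_of f" by blast
    have "fst e \<in> A" "snd e \<in> B" "fst f \<in> A" "snd f \<in> B" using ef MG G_sub by auto
    then show "x \<inter> y = {}" using ne[OF ef(1,2,5)] disj by (auto simp: ef(3,4) edge_of_def)
  qed
  moreover have "edge_of ` M \<subseteq> E" using MG edge_in by blast
  moreover have "rainbow \<phi> (edge_of ` M)"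
    using ne unfolding rainbow_def disjoint_family_on_def \<chi>_def by blast
  ultimately show ?thesis by (simp add: perfect_matching_def matching_def)
qed

end

theorem lemma2p2:
  fixes \<alpha> :: real and t :: nat
  assumes "\<alpha> > 0" and "t \<ge> 1"
  shows "\<exists>\<epsilon>>0. \<exists>n0::nat. \<forall>n\<ge>n0.
    \<forall>(A::'v set) (B::'v set) (E::'v set set) (\<phi>::'v set \<Rightarrow> 'c set) (d::real).
      bipartite_graph A B E \<and> card A = n \<and> card B = n \<and>
      fold_edge_colouring t E \<phi> \<and> proper_colouring (A \<union> B) E \<phi> \<and> linear_colouring E \<phi> \<and>
      (\<forall>v\<in>A \<union> B. (1 - \<epsilon>) * d \<le> real (vertex_degree E v) \<and>
                 real (vertex_degree E v) \<le> (1 + \<epsilon>) * d) \<and>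
      (\<forall>c. real (colour_degree E \<phi> c) \<le> (1 - \<alpha>) * d) \<and>
      (\<forall>A' B'. A' \<subseteq> A \<and> B' \<subseteq> B \<and>
               real (card A') \<ge> (1 - \<alpha>) * d \<and> real (card B') \<ge> (1 - \<alpha>) * d \<longrightarrow>
               real (card (edges_between E A' B')) \<ge> \<alpha> * (real n)\<^sup>2)
      \<longrightarrow> (\<exists>M. perfect_matching (A \<union> B) E M \<and> rainbow \<phi> M)"
proof (cases "\<alpha> < 1")
  \<comment> \<open>For \<open>\<alpha> \<ge> 1\<close> the threshold
    \<open>(1 - \<alpha>) * d\<close> is at most 0, as the degree window forces
    \<open>d \<ge> 0\<close>. So the density assumption applies to empty sets and contradicts
    \<open>n \<ge> 1\<close>.\<close>
  case False
  show ?thesis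
  proof (rule exI[of _ "1/2"], intro conjI exI[of _ 1] allI impI)
    fix n :: nat and A B :: "'v set" and E and \<phi> :: "'v set \<Rightarrow> 'c set" and d :: real
    assume n: "1 \<le> n"
    assume hyp: "bipartite_graph A B E \<and> card A = n \<and> card B = n \<and>
      fold_edge_colouring t E \<phi> \<and> proper_colouring (A \<union> B) E \<phi> \<and> linear_colouring E \<phi> \<and>
      (\<forall>v\<in>A \<union> B. (1 - 1/2) * d \<le> real (vertex_degree E v) \<and>
                 real (vertex_degree E v) \<le> (1 + 1/2) * d) \<and>
      (\<forall>c. real (colour_degree E \<phi> c) \<le> (1 - \<alpha>) * d) \<and>
      (\<forall>A' B'. A' \<subseteq> A \<and> B' \<subseteq> B \<and>
               real (card A') \<ge> (1 - \<alpha>) * d \<and> real (card B') \<ge> (1 - \<alpha>) * d \<longrightarrow>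
               real (card (edges_between E A' B')) \<ge> \<alpha> * (real n)\<^sup>2)"
    have deg: "(1 - 1/2) * d \<le> real (vertex_degree E v) \<and> real (vertex_degree E v) \<le> (1 + 1/2) * d"
      if "v \<in> A \<union> B" for v using hyp that by blast
    have dense: "\<alpha> * (real n)\<^sup>2 \<le> real (card (edges_between E S T))"
      if "S \<subseteq> A" "T \<subseteq> B" "(1 - \<alpha>) * d \<le> real (card S)" "(1 - \<alpha>) * d \<le> real (card T)" for S T
      using hyp that by blast
    have "card A = n" using hyp by blast
    then have "A \<noteq> {}" using n by auto
    then obtain a where "a \<in> A" by blast
    then have "0 \<le> d" using deg[of a] by simp
    then have "(1 - \<alpha>) * d \<le> 0" using False by (simp add: mult_nonpos_nonneg)
    then have "\<alpha> * (real n)\<^sup>2 \<le> real (card (edges_between E {} {}))" by (intro dense) simp_all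
    moreover have "edges_between E {} {} = {}" by (simp add: edges_between_def)
    ultimately have "\<alpha> * (real n)\<^sup>2 \<le> 0" by simp
    moreover have "\<alpha> * (real n)\<^sup>2 > 0" using assms n by simp
    ultimately show "\<exists>M. perfect_matching (A \<union> B) E M \<and> rainbow \<phi> M" by linarith
  qed simp
next
  case True
  define \<gamma> where "\<gamma> = \<alpha> / real t"
  define p where "p = \<gamma> ^ t"
  define q where "q = (1 - \<gamma>) ^ t"
  define \<kappa> where "\<kappa> = p\<^sup>2 * \<alpha> ^ 3"
  define \<delta> where "\<delta> = \<kappa> / (5120 * real t)"
  \<comment> \<open>A sum of positive terms, so that it dominates each of them: \<open>1 / q\<close>
    bounds vertex degrees and total weight, and with \<open>D0 = q * \<alpha> / 2\<close> the last
    two bound the weights, scaled by \<open>n\<close>, and the excess.\<close>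
  define K where "K = 1 + 1 / q + 1 / (q * \<alpha> / 2) + 16 / (q * \<alpha> / 2)\<^sup>2"
  \<comment> \<open>The first bound makes irregularity cost less than the near-perfect matching may
    miss; the second leaves a surplus of \<open>\<alpha> / 2 * d\<close> neighbours beyond
    \<open>(1 - \<alpha>) * d\<close>.\<close>
  define \<epsilon> where "\<epsilon> = min (\<delta> / 8) (\<alpha> / 2)"
  have "\<alpha> / real t \<le> \<alpha> / 1" using assms by (intro divide_left_mono) auto
  then have \<gamma>: "0 < \<gamma>" "\<gamma> < 1" using assms True by (auto simp: \<gamma>_def)
  have q: "1 - \<alpha> \<le> q"
    using Bernoulli_inequality[of "- \<gamma>" t] \<gamma> assms by (simp add: q_def \<gamma>_def)
  have \<kappa>: "\<kappa> > 0" using \<gamma> assms by (simp add: \<kappa>_def p_def)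
  then have \<delta>: "\<delta> > 0" using assms by (simp add: \<delta>_def)
  have K: "1 \<le> K" "1 / q \<le> K" "1 / (q * \<alpha> / 2) \<le> K" "16 / (q * \<alpha> / 2)\<^sup>2 \<le> K"
  proof -
    have "0 < 1 / q" "0 < 1 / (q * \<alpha> / 2)" "0 < 16 / (q * \<alpha> / 2)\<^sup>2"
      using q True assms by simp_all
    then show "1 \<le> K" "1 / q \<le> K" "1 / (q * \<alpha> / 2) \<le> K" "16 / (q * \<alpha> / 2)\<^sup>2 \<le> K"
      unfolding K_def by linarith+
  qed
  have \<epsilon>: "0 < \<epsilon>" "8 * \<epsilon> \<le> \<delta>" "2 * \<epsilon> \<le> \<alpha>" using \<delta> assms by (auto simp: \<epsilon>_def)
  have \<delta>2: "\<delta> / 2 > 0" and k: "t + 2 \<ge> 1" using \<delta> by simp_all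
  obtain N0 where N0: "\<forall>N\<ge>N0. \<forall>(H :: ('v + 'v + 'c) set set) w. linear_hypergraph H (t + 2) \<and>
      (\<forall>f\<in>H. 0 \<le> w f \<and> w f \<le> K / N) \<and> (\<forall>v. wdeg H w v \<le> K) \<and> excess H w \<le> K \<and> sum w H \<le> K * N
      \<longrightarrow> (\<exists>M\<subseteq>H. disjoint M \<and> real (card M) \<ge> sum w H - \<delta> / 2 * N)"
    using near_fractional_matching[OF \<delta>2 K(1) k] by (elim exE)
  \<comment> \<open>All thresholds depend on \<open>\<alpha>\<close> and \<open>t\<close> only; the
    entry 1 rules out \<open>n = 0\<close>.\<close>
  define S where "S = {1, N0, 2 / \<alpha>, 128 / ((q * \<alpha> / 2)\<^sup>2 * \<delta>\<^sup>2), 4 * (real t + 2) / (\<kappa> / 256) ^ 4,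
      2048 * (6 * real t + 4) / \<kappa>, 16 / (p * \<alpha> / 16)\<^sup>2}"
  have "finite S" by (simp add: S_def)
  show ?thesis
  proof (rule exI[of _ \<epsilon>], intro conjI exI[of _ "nat \<lceil>Max S\<rceil>"] allI impI)
    show "\<epsilon> > 0" by (rule \<epsilon>(1))
    fix n :: nat and A B :: "'v set" and E and \<phi> :: "'v set \<Rightarrow> 'c set" and d :: real
    assume "nat \<lceil>Max S\<rceil> \<le> n"
    then have "Max S \<le> real n" by linarith
    then have large: "y \<le> real n" if "y \<in> S" for y
      using Max_ge[OF \<open>finite S\<close> that] by linarith
    have "1 \<le> real n" by (rule large) (simp add: S_def)
    then have n1: "1 \<le> n" by simp
    have n: "N0 \<le> real n" "2 / \<alpha> \<le> real n" "128 / ((q * \<alpha> / 2)\<^sup>2 * \<delta>\<^sup>2) \<le> real n"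
      "4 * (real t + 2) / (\<kappa> / 256) ^ 4 \<le> real n" "2048 * (6 * real t + 4) / \<kappa> \<le> real n"
      "16 / (p * \<alpha> / 16)\<^sup>2 \<le> real n"
      by (rule large, unfold S_def, blast)+
    assume hyp: "bipartite_graph A B E \<and> card A = n \<and> card B = n \<and>
      fold_edge_colouring t E \<phi> \<and> proper_colouring (A \<union> B) E \<phi> \<and> linear_colouring E \<phi> \<and>
      (\<forall>v\<in>A \<union> B. (1 - \<epsilon>) * d \<le> real (vertex_degree E v) \<and>
                 real (vertex_degree E v) \<le> (1 + \<epsilon>) * d) \<and>
      (\<forall>c. real (colour_degree E \<phi> c) \<le> (1 - \<alpha>) * d) \<and>
      (\<forall>A' B'. A' \<subseteq> A \<and> B' \<subseteq> B \<and>
               real (card A') \<ge> (1 - \<alpha>) * d \<and> real (card B') \<ge> (1 - \<alpha>) * d \<longrightarrow>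
               real (card (edges_between E A' B')) \<ge> \<alpha> * (real n)\<^sup>2)"
    have deg: "(1 - \<epsilon>) * d \<le> real (vertex_degree E v) \<and> real (vertex_degree E v) \<le> (1 + \<epsilon>) * d"
      if "v \<in> A \<union> B" for v using hyp that by blast
    have col: "real (colour_degree E \<phi> c) \<le> (1 - \<alpha>) * d" for c using hyp by blast
    have dense: "\<alpha> * (real n)\<^sup>2 \<le> real (card (edges_between E S T))"
      if "S \<subseteq> A" "T \<subseteq> B" "(1 - \<alpha>) * d \<le> real (card S)" "(1 - \<alpha>) * d \<le> real (card T)" for S T
      using hyp that by blast
    have "bipartite_coloured A B E \<phi> t n" unfolding bipartite_coloured_def using hyp by blast
    then interpret bc: bipartite_coloured A B E \<phi> t n .
    interpret rc: random_colours A B bc.G bc.\<chi> t n \<gamma>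
      by unfold_locales (rule \<gamma>)+
    have nibble: "\<exists>M\<subseteq>H. disjoint M \<and> real (card M) \<ge> sum w H - \<delta> / 2 * real n"
      if "linear_hypergraph H (t + 2)" "\<And>f. f \<in> H \<Longrightarrow> 0 \<le> w f" "\<And>f. f \<in> H \<Longrightarrow> w f \<le> K / real n"
        "\<And>v. wdeg H w v \<le> K" "excess H w \<le> K" "sum w H \<le> K * real n"
      for H :: "('v + 'v + 'c) set set" and w
      using that by (intro N0[rule_format, OF n(1)] conjI ballI allI)
    have pq: "rc.p = p" "rc.q = q" by (simp_all add: rc.p_def rc.q_def p_def q_def)
    have "\<exists>M. bc.rainbow_pairs M \<and> card M = n"
    proof (rule rc.perfect_rainbow_matching[where \<alpha> = \<alpha> and K = K and \<delta> = \<delta> and \<epsilon> = \<epsilon> and d = d,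
          unfolded pq, folded \<kappa>_def, OF nibble assms(2,1) True q \<delta>_def \<epsilon> K n1 n(2-6) bc.linear_pairs])
      show "(1 - \<epsilon>) * d \<le> real (card {b. (a, b) \<in> bc.G}) \<and> real (card {b. (a, b) \<in> bc.G}) \<le> (1 + \<epsilon>) * d"
        if "a \<in> A" for a
        using deg[of a] bc.vertex_degree_A[OF that] that by simp
      show "(1 - \<epsilon>) * d \<le> real (card {a. (a, b) \<in> bc.G}) \<and> real (card {a. (a, b) \<in> bc.G}) \<le> (1 + \<epsilon>) * d"
        if "b \<in> B" for b
        using deg[of b] bc.vertex_degree_B[OF that] that by simp
      show "real (card {e \<in> bc.G. c \<in> bc.\<chi> e}) \<le> (1 - \<alpha>) * d" for c
        using col[of c] bc.colour_degree_pairs[of c] by simp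
      show "\<alpha> * (real n)\<^sup>2 \<le> real (card (bc.G \<inter> S \<times> T))"
        if "S \<subseteq> A" "T \<subseteq> B" "(1 - \<alpha>) * d \<le> real (card S)" "(1 - \<alpha>) * d \<le> real (card T)" for S T
        using dense[OF that] bc.edges_between_pairs[OF that(1,2)] by simp
    qed
    then show "\<exists>M. perfect_matching (A \<union> B) E M \<and> rainbow \<phi> M"
      using bc.perfect_matching_of_pairs by blast
  qed
qed

end
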